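(* Let $\mathcal{Q}_{49}$ be the 49-qubit code, encoding one logical qubit, obtained by encoding the logical qubit in the 7-qubit Steane code and then encoding each of the Steane-code qubits $1,2,7$ in the 15-qubit Reed-Muller code, while leaving the Steane-code qubits $3,4,5,6$ unencoded (so that there are $3\cdot 15+4=49$ physical qubits). Then there is a recovery operation $\mathcal{R}$ on 49 qubits such that: (i) $\mathcal{R}$ corrects an arbitrary error on any single physical qubit of $\mathcal{Q}_{49}$; (ii) each gate of the universal gate set $\{H, S, T, \mathrm{CNOT}\}$ can be implemented fault-tolerantly, with respect to $\mathcal{R}$, on logical qubits encoded in $\mathcal{Q}_{49}$.
   Context: Gates: $H$ is the Hadamard gate, $T=\mathrm{diag}(1,e^{i\pi/4})$, $S=T^2=\mathrm{diag}(1,i)$, $\mathrm{CNOT}$ is the controlled-NOT gate. A gate set is universal if, on any number of qubits, it generates a dense subgroup of the unitary group up to global phase. Steane code: let $c_1,\dots,c_7$ be an enumeration of the nonzero vectors of $\mathbb{F}_2^3$ with $c_1+c_2+c_7=0$. The Steane code is the 7-qubit stabilizer code with generators $\prod_{i:(c_i)_j=1}X_i$ and $\prod_{i:(c_i)_j=1}Z_i$ for $j=1,2,3$, and logical operators $\overline{X}=X^{\otimes 7}$, $\overline{Z}=Z^{\otimes 7}$ (so $Z_1Z_2Z_7$ also acts as logical $Z$). 15-qubit Reed-Muller code: the qubits are indexed by the nonzero vectors $v\in\mathbb{F}_2^4$. The stabilizer generators are $\prod_{v:v_i=1}X_v$ and $\prod_{v:v_i=1}Z_v$ for $1\le i\le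 4$, and $\prod_{v:v_i=v_j=1}Z_v$ for $1\le i<j\le 4$. The logical operators are $\overline{X}=X^{\otimes 15}$, $\overline{Z}=Z^{\otimes 15}$. Logical basis: for each code, $|\overline 0\rangle,|\overline 1\rangle$ are the $\pm1$ eigenstates of $\overline Z$ in the code space with $\overline X|\overline0\rangle=|\overline1\rangle$. The encoding isometry of the concatenated code is the Steane encoding isometry followed by the Reed-Muller encoding isometry on each of the qubits $1,2,7$ and the identity on the qubits $3,4,5,6$. The encoded version of a state $|\psi\rangle$ of $r$ logical qubits uses $r$ blocks of 49 physical qubits. A recovery operation is a quantum channel (completely positive trace-preserving map) on 49 qubits. It corrects an error $\mathcal{E}$ if $\mathcal{R}\circ\mathcal{E}$ fixes every state in the code space. Fault-tolerant implementation: an $r$-qubit gate $G$ can be implemented fault-tolerantly with respect to $\mathcal{R}$ if there is a finite sequence of physical unitary gates on the $49r$ physical qubits, each acting on at most three qubits, such that (a) in the absence of errors the sequence maps the encoded version of every $|\psi\rangle$ to the encoded version of $G|\psi\rangle$, up to a global phase; and (b) if one arbitrary single-qubit error (a quantum channel on one physical qubit) occurs on one physical qubit at one point of the sequence (before the first gate, between two consecutive gates, or after the last gate), then applying $\mathcal{R}$ afterwards to each of the $r$ blocks yields the encoded version of $G|\psi\rangle$, up to a global phase. *)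

theory Defs
  imports "HOL-Analysis.Analysis" "HOL-Library.Z2"
begin

section \<open>Operators on finitely many qubits\<close>

text \<open>
  The qubits of a register are the elements of a finite type \<open>'q\<close>. Computational basis vectors are
  labelled by \<open>'q \<Rightarrow> bool\<close>, where \<open>False\<close> stands for 0 and \<open>True\<close> for 1. A single qubit has the
  basis labels \<open>bool\<close>. In a matrix \<open>A\<close>, the entry \<open>A $ x $ y\<close> is in row \<open>x\<close> and column \<open>y\<close>.
\<close>

type_synonym qmat = "complex ^ bool ^ bool"
type_synonym 'q ket = "(complex, 'q \<Rightarrow> bool) vec"
type_synonym 'q oper = "((complex, 'q \<Rightarrow> bool) vec, 'q \<Rightarrow> bool) vec"

definition adj :: "complex ^ 'n ^ 'm \<Rightarrow> complex ^ 'm ^ 'n"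
  where "adj A = (\<chi> i j. cnj (A $ j $ i))"

definition cscale :: "complex \<Rightarrow> complex ^ 'n ^ 'm \<Rightarrow> complex ^ 'n ^ 'm"
  where "cscale z A = (\<chi> i j. z * A $ i $ j)"

definition cdot :: "complex ^ 'n \<Rightarrow> complex ^ 'n \<Rightarrow> complex"
  where "cdot v w = (\<Sum>i\<in>UNIV. cnj (v $ i) * w $ i)"

definition unitary :: "complex ^ 'n ^ 'n \<Rightarrow> bool"
  where "unitary U \<longleftrightarrow> adj U ** U = mat 1 \<and> U ** adj U = mat 1"

definition conjugate_by :: "complex ^ 'n ^ 'm \<Rightarrow> complex ^ 'n ^ 'n \<Rightarrow> complex ^ 'm ^ 'm"
  where "conjugate_by U \<rho> = U ** \<rho> ** adj U"

definition pure_state :: "complex ^ 'n \<Rightarrow> complex ^ 'n ^ 'n"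
  where "pure_state \<psi> = (\<chi> i j. \<psi> $ i * cnj (\<psi> $ j))"

definition density_operator :: "complex ^ 'n ^ 'n \<Rightarrow> bool"
  where "density_operator \<rho> \<longleftrightarrow> (\<forall>v. cdot v (\<rho> *v v) \<in> \<real>\<^sub>\<ge>\<^sub>0) \<and> trace \<rho> = 1"

definition tensor :: "('q::finite \<Rightarrow> qmat) \<Rightarrow> 'q oper"
  where "tensor M = (\<chi> x y. \<Prod>q\<in>UNIV. M q $ x q $ y q)"


section \<open>Gates and universality\<close>

definition phase_gate :: "complex \<Rightarrow> qmat"
  where "phase_gate z = (\<chi> a b. if a = b then (if a then z else 1) else 0)"

definition pauli_X :: qmat
  where "pauli_X = (\<chi> a b. if a = b then 0 else 1)"

definition pauli_Z :: qmat
  where "pauli_Z = phase_gate (- 1)"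

text \<open>As gates on a register, one-qubit gates act on the index type \<open>1\<close>. For CNOT on the index type
  \<open>2\<close>, qubit \<open>0\<close> is the control and qubit \<open>1\<close> is the target.\<close>

definition H_gate :: "1 oper"
  where "H_gate = tensor (\<lambda>_. \<chi> a b. (if a \<and> b then - 1 else 1) / complex_of_real (sqrt 2))"

definition S_gate :: "1 oper"
  where "S_gate = tensor (\<lambda>_. phase_gate \<i>)"

definition T_gate :: "1 oper"
  where "T_gate = tensor (\<lambda>_. phase_gate (cis (pi / 4)))"

definition CNOT_gate :: "2 oper"
  where "CNOT_gate = (\<chi> x y. if x 0 = y 0 \<and> x 1 = (y 1 \<noteq> y 0) then 1 else 0)"

text \<open>For injective \<open>f\<close>, the gate \<open>G\<close> applied to the qubits \<open>f k\<close>, tensored with the identity on the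
  remaining qubits.\<close>

definition embed_gate :: "('k::finite \<Rightarrow> 'q::finite) \<Rightarrow> 'k oper \<Rightarrow> 'q oper"
  where "embed_gate f G =
    (\<chi> x y. if \<forall>q. q \<notin> range f \<longrightarrow> x q = y q then G $ (x \<circ> f) $ (y \<circ> f) else 0)"

inductive_set generated_group :: "1 oper set \<Rightarrow> 2 oper set \<Rightarrow> ('q::finite) oper set"
  for G1 :: "1 oper set" and G2 :: "2 oper set"
  where
    one: "mat 1 \<in> generated_group G1 G2"
  | gate1: "G \<in> G1 \<Longrightarrow> inj f \<Longrightarrow> embed_gate f G \<in> generated_group G1 G2"
  | gate2: "G \<in> G2 \<Longrightarrow> inj f \<Longrightarrow> embed_gate f G \<in> generated_group G1 G2"
  | mult: "U \<in> generated_group G1 G2 \<Longrightarrow> V \<in> generated_group G1 G2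
      \<Longrightarrow> U ** V \<in> generated_group G1 G2"
  | inv: "U \<in> generated_group G1 G2 \<Longrightarrow> adj U \<in> generated_group G1 G2"

definition universal_on :: "('q::finite) itself \<Rightarrow> 1 oper set \<Rightarrow> 2 oper set \<Rightarrow> bool"
  where "universal_on _ G1 G2 \<longleftrightarrow>
    {U :: 'q oper. unitary U}
      \<subseteq> closure {cscale z V |z V. cmod z = 1 \<and> V \<in> generated_group G1 G2}"


section \<open>Quantum channels\<close>

text \<open>\<open>A\<close> stands for the operator \<open>\<Sum>i j<k. |i\<rangle>\<langle>j| \<otimes> A i j\<close> on \<open>\<complex>\<^sup>k \<otimes> \<complex>\<^sup>n\<close>, so that complete positivity
  says that \<open>id\<^sub>k \<otimes> \<Phi>\<close> preserves positivity for every \<open>k\<close>.\<close>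

definition block_positive :: "nat \<Rightarrow> (nat \<Rightarrow> nat \<Rightarrow> complex ^ 'n ^ 'n) \<Rightarrow> bool"
  where "block_positive k A \<longleftrightarrow>
    (\<forall>v. (\<Sum>i<k. \<Sum>j<k. cdot (v i) (A i j *v v j)) \<in> \<real>\<^sub>\<ge>\<^sub>0)"

definition completely_positive :: "(complex ^ 'n ^ 'n \<Rightarrow> complex ^ 'n ^ 'n) \<Rightarrow> bool"
  where "completely_positive \<Phi> \<longleftrightarrow>
    (\<forall>k A. block_positive k A \<longrightarrow> block_positive k (\<lambda>i j. \<Phi> (A i j)))"

definition quantum_channel :: "(complex ^ 'n ^ 'n \<Rightarrow> complex ^ 'n ^ 'n) \<Rightarrow> bool"
  where "quantum_channel \<Phi> \<longleftrightarrow>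
    (\<forall>A B. \<Phi> (A + B) = \<Phi> A + \<Phi> B) \<and> (\<forall>z A. \<Phi> (cscale z A) = cscale z (\<Phi> A)) \<and>
    completely_positive \<Phi> \<and> (\<forall>A. trace (\<Phi> A) = trace A)"

text \<open>The following two definitions extend a linear map on one qubit, respectively on one block of
  qubits, by the identity on the rest of the register: the partial matrix with fixed labels outside
  is mapped and then read off at the labels inside.\<close>

definition on_qubit :: "'q::finite \<Rightarrow> (qmat \<Rightarrow> qmat) \<Rightarrow> 'q oper \<Rightarrow> 'q oper"
  where "on_qubit p \<E> \<rho> =
    (\<chi> x y. \<E> (\<chi> a b. \<rho> $ (x(p := a)) $ (y(p := b))) $ x p $ y p)"

definition set_block :: "'r \<Rightarrow> ('q \<Rightarrow> bool) \<Rightarrow> ('r \<times> 'q \<Rightarrow> bool) \<Rightarrow> ('r \<times> 'q \<Rightarrow> bool)"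
  where "set_block i a x = (\<lambda>(j, q). if j = i then a q else x (j, q))"

definition on_block ::
    "'r::finite \<Rightarrow> (('q::finite) oper \<Rightarrow> 'q oper) \<Rightarrow> ('r \<times> 'q) oper \<Rightarrow> ('r \<times> 'q) oper"
  where "on_block i \<R> \<rho> =
    (\<chi> x y. \<R> (\<chi> a b. \<rho> $ set_block i a x $ set_block i b y) $ (\<lambda>q. x (i, q)) $ (\<lambda>q. y (i, q)))"

definition on_all_blocks ::
    "(('q::finite) oper \<Rightarrow> 'q oper) \<Rightarrow> ('r::enum \<times> 'q) oper \<Rightarrow> ('r \<times> 'q) oper"
  where "on_all_blocks \<R> = fold (\<lambda>i. on_block i \<R>) Enum.enum"


section \<open>Codes\<close>

definition X_on :: "('q::finite) set \<Rightarrow> 'q oper"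
  where "X_on A = tensor (\<lambda>q. if q \<in> A then pauli_X else mat 1)"

definition Z_on :: "('q::finite) set \<Rightarrow> 'q oper"
  where "Z_on A = tensor (\<lambda>q. if q \<in> A then pauli_Z else mat 1)"

definition stabilized_space :: "('q::finite) oper set \<Rightarrow> 'q ket set"
  where "stabilized_space gens = {\<psi>. \<forall>g\<in>gens. g *v \<psi> = \<psi>}"

text \<open>\<open>V\<close> maps the two basis vectors of a qubit to a logical basis of the stabilizer code \<open>gens\<close> with
  logical operators \<open>X_on UNIV\<close> and \<open>Z_on UNIV\<close>. For a code with one logical qubit, this determines
  \<open>V\<close> up to a global phase.\<close>

definition encoding_isometry :: "('q::finite) oper set \<Rightarrow> complex ^ bool ^ ('q \<Rightarrow> bool) \<Rightarrow> bool"
  where "encoding_isometry gens V \<longleftrightarrow>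
    (let ket0 = column False V; ket1 = column True V in
      ket0 \<in> stabilized_space gens \<and> ket1 \<in> stabilized_space gens \<and>
      norm ket0 = 1 \<and> norm ket1 = 1 \<and>
      Z_on UNIV *v ket0 = ket0 \<and> Z_on UNIV *v ket1 = - ket1 \<and> X_on UNIV *v ket0 = ket1)"

text \<open>The Steane-code qubits, split into those that are encoded further and those that are not.\<close>

datatype encoded_pos = Q1 | Q2 | Q7
datatype bare_pos = Q3 | Q4 | Q5 | Q6

instance encoded_pos :: finite
proof
  have "(UNIV :: encoded_pos set) = {Q1, Q2, Q7}"
    using encoded_pos.exhaust by blast
  then show "finite (UNIV :: encoded_pos set)"
    by (metis finite.emptyI finite.insertI)
qed

instance bare_pos :: finite
proof
  have "(UNIV :: bare_pos set) = {Q3, Q4, Q5, Q6}"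
    using bare_pos.exhaust by blast
  then show "finite (UNIV :: bare_pos set)"
    by (metis finite.emptyI finite.insertI)
qed

type_synonym steane_qubit = "encoded_pos + bare_pos"

definition steane_generators :: "(steane_qubit \<Rightarrow> bit ^ 3) \<Rightarrow> steane_qubit oper set"
  where "steane_generators c =
    range (\<lambda>j. X_on {i. c i $ j = 1}) \<union> range (\<lambda>j. Z_on {i. c i $ j = 1})"

instance bit :: finite
proof
  have "(UNIV :: bit set) = {0, 1}"
    using bit_not_one_iff by blast
  then show "finite (UNIV :: bit set)"
    by (metis finite.emptyI finite.insertI)
qed

typedef rm_qubit = "{v :: bit ^ 4. v \<noteq> 0}"
  morphisms rm_vec Abs_rm_qubit
  by (rule exI [of _ 1]) simp

instance rm_qubit :: finite
proof
  have "inj rm_vec"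
    by (simp add: inj_def rm_vec_inject)
  then show "finite (UNIV :: rm_qubit set)"
    by (rule finite_imageD [rotated]) (rule finite)
qed

definition rm_generators :: "rm_qubit oper set"
  where "rm_generators =
    range (\<lambda>i. X_on {v. rm_vec v $ i = 1}) \<union> range (\<lambda>i. Z_on {v. rm_vec v $ i = 1}) \<union>
    {Z_on {v. rm_vec v $ i = 1 \<and> rm_vec v $ j = 1} |i j. i \<noteq> j}"

type_synonym qubit49 = "encoded_pos \<times> rm_qubit + bare_pos"

definition inner_encoding ::
    "complex ^ bool ^ (rm_qubit \<Rightarrow> bool) \<Rightarrow> complex ^ (steane_qubit \<Rightarrow> bool) ^ (qubit49 \<Rightarrow> bool)"
  where "inner_encoding W =
    (\<chi> x y. (\<Prod>b\<in>UNIV. W $ (\<lambda>v. x (Inl (b, v))) $ y (Inl b)) *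
      (if \<forall>b. x (Inr b) = y (Inr b) then 1 else 0))"

definition Q49_encoding ::
    "complex ^ bool ^ (steane_qubit \<Rightarrow> bool) \<Rightarrow> complex ^ bool ^ (rm_qubit \<Rightarrow> bool)
      \<Rightarrow> complex ^ bool ^ (qubit49 \<Rightarrow> bool)"
  where "Q49_encoding V W = inner_encoding W ** V"

text \<open>The \<open>r\<close>-fold tensor power of an encoding, where \<open>'r\<close> labels both the logical qubits and the blocks.\<close>

definition encode_blocks ::
    "complex ^ bool ^ ('q::finite \<Rightarrow> bool) \<Rightarrow> complex ^ ('r::finite \<Rightarrow> bool) ^ ('r \<times> 'q \<Rightarrow> bool)"
  where "encode_blocks V = (\<chi> x a. \<Prod>i\<in>UNIV. V $ (\<lambda>q. x (i, q)) $ a i)"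


section \<open>Error correction and fault tolerance\<close>

definition corrects ::
    "complex ^ bool ^ ('q::finite \<Rightarrow> bool) \<Rightarrow> ('q oper \<Rightarrow> 'q oper) \<Rightarrow> ('q oper \<Rightarrow> 'q oper) \<Rightarrow> bool"
  where "corrects V \<R> \<E> \<longleftrightarrow>
    (\<forall>\<rho>. density_operator \<rho> \<and> range (\<lambda>v. \<rho> *v v) \<subseteq> range (\<lambda>\<psi>. V *v \<psi>) \<longrightarrow> \<R> (\<E> \<rho>) = \<rho>)"

text \<open>\<open>U\<close> is the tensor product of an operator on the qubits in \<open>A\<close> with the identity.\<close>

definition acts_on :: "('q::finite) set \<Rightarrow> 'q oper \<Rightarrow> bool"
  where "acts_on A U \<longleftrightarrow>
    (\<exists>u. \<forall>x y. U $ x $ y =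
      (if \<forall>q. q \<notin> A \<longrightarrow> x q = y q then u (\<lambda>q. q \<in> A \<and> x q) (\<lambda>q. q \<in> A \<and> y q) else 0))"

definition circuit :: "('q::finite) oper list \<Rightarrow> 'q oper"
  where "circuit gs = fold (\<lambda>g U. g ** U) gs (mat 1)"

text \<open>In the last condition, the global phase has disappeared because the states are density operators.\<close>

definition fault_tolerant ::
    "complex ^ bool ^ ('q::finite \<Rightarrow> bool) \<Rightarrow> ('q oper \<Rightarrow> 'q oper) \<Rightarrow> ('r::enum) oper \<Rightarrow> bool"
  where "fault_tolerant V \<R> G \<longleftrightarrow>
    (\<exists>gs :: ('r \<times> 'q) oper list.
      (\<forall>g\<in>set gs. unitary g \<and> (\<exists>A. card A \<le> 3 \<and> acts_on A g)) \<and>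
      (\<exists>z. cmod z = 1 \<and>
        (\<forall>\<psi>. circuit gs *v (encode_blocks V *v \<psi>) = z *s (encode_blocks V *v (G *v \<psi>)))) \<and>
      (\<forall>gs1 gs2 p \<E> \<psi>. gs = gs1 @ gs2 \<and> quantum_channel \<E> \<and> norm \<psi> = 1 \<longrightarrow>
        on_all_blocks \<R>
          (conjugate_by (circuit gs2)
            (on_qubit p \<E>
              (conjugate_by (circuit gs1) (pure_state (encode_blocks V *v \<psi>)))))
        = pure_state (encode_blocks V *v (G *v \<psi>))))"

end

(* Universality. For a unit vector w and a phase z let P_w(z) be the unitary that multiplies w by z and
   fixes the orthogonal complement of w. Complex Householder reflections are of this form, so a closed
   group G of unitaries that contains all P_w(z) contains every unitary, and the set of w for which G
   contains all P_w(z) is invariant under G. For one qubit, T H T H T is a rotation by an irrational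
   angle around a real vector w, and Z H w lies at 45 degrees to w; this gives all unit vectors. For n
   qubits, conjugating phase gates by CNOT gates gives all diagonal unitaries, hence all basis vectors
   w, from which one-qubit gates reach the other vectors.

   Fault tolerance. The recovery decodes the three Reed-Muller blocks and then the Steane code. It
   corrects errors on one whole block, since this is one error on the Steane code, and errors on the
   qubits with one label v in all three blocks, since this is one error in each block. The gates T and S
   act on such triples: the parity of a triple is a phase, and the weights modulo 8 of the Reed-Muller
   codewords turn these phases into a phase gate on the logical value of Z_1 Z_2 Z_7. The gate H acts on
   each block and each bare qubit separately, and CNOT is transversal. In each case the gates preserve a
   partition of the qubits into correctable sets, so that an error spreads only inside one such set. *)

theory Submission
  imports Defs
begin

text \<open>The rotation angle of T H T H T is irrational because the ratio z of its eigenvalues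
  satisfies z + 1/z = 1 / sqrt 2 - 1, which is not an algebraic integer; a parity induction makes
  this elementary. Recovery is reduced to one condition: every Kraus operator sends the damaged
  encoding to a scalar multiple of the encoding. It is linear in the damage, so product errors
  suffice, and it allows the different left and right factors in which a channel expands. The
  scalars need no computation, since trace preservation forces their total to be 1. Both codes are
  instances of one family. Z checks of degree at most n - 2 are dual to affine functions, so they
  and logical Z confine each encoded state to a coset of a linear code, and the X operators make all
  amplitudes there equal. Hence the encoding is unique up to phase, which yields transversal H on
  the Steane code, and uniform, which yields transversal CNOT. For T and S, the relation between
  c_1, c_2 and c_7 makes the xor of the three Reed-Muller words again such a word, of the class of
  the logical bit.\<close>

section \<open>Complex matrices\<close>

lemma mult_nth: "(A ** B) $ i $ j = (\<Sum>k\<in>UNIV. A $ i $ k * B $ k $ j)"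
  by (simp add: matrix_matrix_mult_def)

lemma mult_vec_nth: "(A *v v) $ i = (\<Sum>k\<in>UNIV. A $ i $ k * v $ k)"
  by (simp add: matrix_vector_mult_def)

lemma mat_nth: "mat z $ i $ j = (if i = j then z else 0)"
  by (simp add: mat_def)

lemma adj_nth [simp]: "adj A $ i $ j = cnj (A $ j $ i)"
  by (simp add: adj_def)

lemma cscale_nth [simp]: "cscale z A $ i $ j = z * A $ i $ j"
  by (simp add: cscale_def)

lemma pure_state_nth [simp]: "pure_state \<psi> $ i $ j = \<psi> $ i * cnj (\<psi> $ j)"
  by (simp add: pure_state_def)

lemma adj_adj [simp]: "adj (adj A) = A"
  by (simp add: vec_eq_iff)

lemma adj_mult: "adj (A ** B) = adj B ** adj A"
  by (simp add: vec_eq_iff mult_nth mult.commute)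

lemma adj_add: "adj (A + B) = adj A + adj B"
  by (simp add: vec_eq_iff)

lemma adj_diff: "adj (A - B) = adj A - adj B"
  by (simp add: vec_eq_iff)

lemma adj_mat: "adj (mat z) = mat (cnj z)"
  by (simp add: vec_eq_iff mat_nth)

lemma adj_one [simp]: "adj (mat 1) = mat 1"
  by (simp add: adj_mat)

lemma adj_cscale: "adj (cscale z A) = cscale (cnj z) (adj A)"
  by (simp add: vec_eq_iff)

lemma adj_sum: "adj (\<Sum>i\<in>I. A i) = (\<Sum>i\<in>I. adj (A i))"
  by (simp add: vec_eq_iff)

lemma cscale_mult_left: "cscale z A ** B = cscale z (A ** B)"
  by (simp add: vec_eq_iff mult_nth sum_distrib_left mult.assoc)

lemma cscale_mult_right: "A ** cscale z B = cscale z (A ** B)"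
  by (simp add: vec_eq_iff mult_nth sum_distrib_left mult.left_commute)

lemma cscale_cscale [simp]: "cscale z (cscale w A) = cscale (z * w) A"
  by (simp add: vec_eq_iff)

lemma cscale_one [simp]: "cscale 1 A = A"
  by (simp add: vec_eq_iff)

lemma cscale_zero [simp]: "cscale 0 A = 0"
  by (simp add: vec_eq_iff)

lemma cscale_add_left: "cscale (z + w) A = cscale z A + cscale w A"
  by (simp add: vec_eq_iff distrib_right)

lemma cscale_sum: "cscale z (\<Sum>i\<in>I. A i) = (\<Sum>i\<in>I. cscale z (A i))"
  by (simp add: vec_eq_iff sum_distrib_left)

lemma cscale_sum_left: "cscale (\<Sum>i\<in>I. z i) A = (\<Sum>i\<in>I. cscale (z i) A)"
  by (simp add: vec_eq_iff sum_distrib_right)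

lemma cscale_vec: "cscale z A *v v = z *s (A *v v)"
  by (simp add: vec_eq_iff mult_vec_nth sum_distrib_left mult.assoc)

lemma matrix_add_rdistrib: "(A + B) ** C = A ** C + B ** C" for A :: "complex ^ 'n ^ 'm"
  by (simp add: vec_eq_iff mult_nth distrib_right sum.distrib)

lemma sum_mult_left: "(\<Sum>i\<in>I. A i) ** B = (\<Sum>i\<in>I. A i ** B)" for A :: "_ \<Rightarrow> complex ^ _ ^ _"
  by (induction I rule: infinite_finite_induct) (simp_all add: matrix_add_rdistrib)

lemma sum_mult_right: "A ** (\<Sum>i\<in>I. B i) = (\<Sum>i\<in>I. A ** B i)"
  by (induction I rule: infinite_finite_induct) (simp_all add: matrix_add_ldistrib)

lemma sum_mult_vec: "(\<Sum>i\<in>I. A i) *v v = (\<Sum>i\<in>I. A i *v v)" for A :: "_ \<Rightarrow> complex ^ _ ^ _"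
  by (induction I rule: infinite_finite_induct) (simp_all add: matrix_vector_mult_add_rdistrib)

lemma trace_mult_comm: "trace (A ** B) = trace (B ** A)" for A :: "complex ^ 'n ^ 'm"
  unfolding trace_def mult_nth by (subst sum.swap) (simp add: mult.commute)

lemma trace_cscale: "trace (cscale z A) = z * trace A"
  by (simp add: trace_def sum_distrib_left)

lemma trace_sum: "trace (\<Sum>i\<in>I. A i) = (\<Sum>i\<in>I. trace (A i))" for A :: "_ \<Rightarrow> complex ^ _ ^ _"
  unfolding trace_def by (simp, rule sum.swap)

lemma cdot_adj: "cdot v (A *v w) = cdot (adj A *v v) w"
  unfolding cdot_def mult_vec_nth
  by (simp add: sum_distrib_left sum_distrib_right, subst sum.swap) (simp add: ac_simps)

lemma cdot_self: "cdot v v = of_real ((norm v)\<^sup>2)"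
proof -
  have "cdot v v = (\<Sum>i\<in>UNIV. of_real ((cmod (v $ i))\<^sup>2))"
    unfolding cdot_def by (intro sum.cong refl) (metis complex_norm_square mult.commute)
  then show ?thesis
    by (simp add: norm_vec_def L2_set_def sum_nonneg)
qed

lemma cdot_add_right: "cdot u (v + w) = cdot u v + cdot u w"
  by (simp add: cdot_def distrib_left sum.distrib)

lemma cdot_add_left: "cdot (u + v) w = cdot u w + cdot v w"
  by (simp add: cdot_def distrib_right sum.distrib)

lemma cdot_diff_right: "cdot u (v - w) = cdot u v - cdot u w"
  by (simp add: cdot_def right_diff_distrib sum_subtractf)

lemma cdot_diff_left: "cdot (u - v) w = cdot u w - cdot v w"
  by (simp add: cdot_def left_diff_distrib sum_subtractf)

lemma cdot_scale_right: "cdot u (z *s v) = z * cdot u v"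
  by (simp add: cdot_def sum_distrib_left mult.left_commute)

lemma cdot_scale_left: "cdot (z *s u) v = cnj z * cdot u v"
  by (simp add: cdot_def sum_distrib_left mult.assoc)

lemma cdot_commute: "cdot u v = cnj (cdot v u)"
  by (simp add: cdot_def mult.commute)

lemma cdot_axis: "cdot (axis x 1) v = v $ x"
  by (simp add: cdot_def axis_def if_distrib[of cnj] cong: if_cong)
    (simp add: if_distrib[of "\<lambda>z. z * _"] cong: if_cong)

lemma unitary_mult: "unitary A \<Longrightarrow> unitary B \<Longrightarrow> unitary (A ** B)"
  unfolding unitary_def adj_mult by (metis matrix_mul_assoc matrix_mul_lid)

lemma unitary_adj: "unitary A \<Longrightarrow> unitary (adj A)"
  by (simp add: unitary_def)

lemma unitary_one [simp]: "unitary (mat 1)"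
  by (simp add: unitary_def)

lemma unitaryI: "adj U ** U = mat 1 \<Longrightarrow> unitary U"
  by (simp add: unitary_def matrix_left_right_inverse)

lemma unitary_cdot: "unitary U \<Longrightarrow> cdot (U *v v) (U *v w) = cdot v w"
  by (simp add: cdot_adj matrix_vector_mul_assoc unitary_def)

lemma norm_eq_1_iff: "norm v = 1 \<longleftrightarrow> cdot v v = 1"
  unfolding cdot_self of_real_eq_1_iff by (metis abs_norm_cancel abs_square_eq_1)

lemma unitary_norm: "unitary U \<Longrightarrow> norm (U *v v) = norm v"
  by (metis cdot_self norm_ge_zero of_real_eq_iff power2_eq_iff_nonneg unitary_cdot)

lemma unitary_cscale: "cmod z = 1 \<Longrightarrow> unitary U \<Longrightarrow> unitary (cscale z U)"
  by (simp add: unitary_def adj_cscale cscale_mult_left cscale_mult_right complex_norm_square[symmetric] mult.commute)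

section \<open>Tensor products\<close>

lemma prod_sum_fun:
  fixes f :: "'q::finite \<Rightarrow> 'b::finite \<Rightarrow> 'c::comm_semiring_1"
  shows "(\<Prod>q\<in>UNIV. \<Sum>b\<in>UNIV. f q b) = (\<Sum>g\<in>UNIV. \<Prod>q\<in>UNIV. f q (g q))"
  using prod_sum_PiE[of UNIV "\<lambda>_. UNIV" f] by (simp add: PiE_UNIV_domain)

lemma tensor_nth: "tensor M $ x $ y = (\<Prod>q\<in>UNIV. M q $ x q $ y q)"
  by (simp add: tensor_def)

lemma tensor_mult: "tensor A ** tensor B = tensor (\<lambda>q. A q ** B q)"
  by (simp add: vec_eq_iff mult_nth tensor_nth prod.distrib[symmetric] prod_sum_fun)

lemma prod_if_eq: "(\<Prod>q\<in>UNIV. if x q = y q then 1 else 0) = (if x = y then 1 else (0::complex))"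
  for x :: "'q::finite \<Rightarrow> bool"
  by (auto simp: fun_eq_iff prod_zero_iff)

lemma tensor_one: "tensor (\<lambda>_. mat 1) = mat 1"
  by (simp add: vec_eq_iff tensor_nth mat_nth prod_if_eq)

lemma adj_tensor: "adj (tensor A) = tensor (\<lambda>q. adj (A q))"
  by (simp add: vec_eq_iff tensor_nth)

section \<open>Universality: closed groups of unitaries and the phases along vectors that they
  contain\<close>

section \<open>Closed groups of unitaries\<close>

definition phase_along :: "complex ^ 'n \<Rightarrow> complex \<Rightarrow> complex ^ 'n ^ 'n"
  where "phase_along w z = mat 1 + cscale (z - 1) (pure_state w)"

lemma phase_along_nth:
  "phase_along w z $ i $ j = (if i = j then 1 else 0) + (z - 1) * (w $ i * cnj (w $ j))"
  by (simp add: phase_along_def mat_nth)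

lemma pure_state_vec: "pure_state w *v v = cdot w v *s w"
  by (simp add: vec_eq_iff mult_vec_nth cdot_def sum_distrib_left sum_distrib_right ac_simps)

lemma phase_along_vec: "phase_along w z *v v = v + ((z - 1) * cdot w v) *s w"
  by (simp add: phase_along_def matrix_vector_mult_add_rdistrib cscale_vec pure_state_vec)

lemma pure_state_unitary: "U ** pure_state w ** adj U = pure_state (U *v w)"
  by (simp add: vec_eq_iff mult_nth mult_vec_nth sum_distrib_left sum_distrib_right ac_simps)

lemma phase_along_conjugate:
  assumes "unitary U"
  shows "phase_along (U *v w) z = U ** phase_along w z ** adj U"
  using assms unfolding phase_along_def
  by (simp add: matrix_add_ldistrib matrix_add_rdistrib cscale_mult_left cscale_mult_right
      pure_state_unitary unitary_def)

lemma phase_along_scale: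
  assumes "cmod c = 1"
  shows "phase_along (c *s w) z = phase_along w z"
proof -
  have "c * cnj c = 1"
    using assms by (metis complex_norm_square of_real_1 one_power2)
  then have "pure_state (c *s w) = pure_state w"
    by (simp add: vec_eq_iff)
  then show ?thesis
    by (simp add: phase_along_def)
qed

text \<open>The projection onto a unit vector is idempotent, so phases along one vector multiply
  like complex numbers. Powers of one gate thus realize powers of its phase.\<close>

lemma phase_along_mult:
  assumes "norm w = 1"
  shows "phase_along w y ** phase_along w z = phase_along w (y * z)"
proof -
  have "cdot w w = 1"
    using assms by (simp add: norm_eq_1_iff)
  have "pure_state w ** pure_state w = cscale (cdot w w) (pure_state w)"
    by (simp add: vec_eq_iff mult_nth cdot_def sum_distrib_left sum_distrib_right ac_simps)
  then have *: "pure_state w ** pure_state w = pure_state w"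
    by (simp add: \<open>cdot w w = 1\<close>)
  show ?thesis
    unfolding phase_along_def
    by (simp add: matrix_add_ldistrib matrix_add_rdistrib cscale_mult_left cscale_mult_right *)
      (simp add: vec_eq_iff algebra_simps)
qed

lemma phase_along_one [simp]: "phase_along w 1 = mat 1"
  by (simp add: phase_along_def)

definition normalize_vec :: "complex ^ 'n \<Rightarrow> complex ^ 'n"
  where "normalize_vec v = of_real (1 / norm v) *s v"

lemma norm_scale: "norm (c *s v) = cmod c * norm v" for v :: "complex ^ 'n"
proof -
  have "complex_of_real ((norm (c *s v))\<^sup>2) = of_real ((cmod c * norm v)\<^sup>2)"
    unfolding cdot_self[symmetric] cdot_scale_left cdot_scale_right
    by (simp add: cdot_self power_mult_distrib complex_norm_square[symmetric] mult.assoc[symmetric] mult.commute[of "cnj c"])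
  then show ?thesis
    unfolding of_real_eq_iff by (simp add: power2_eq_iff_nonneg)
qed

lemma cdot_normalize_vec: "cdot (normalize_vec v) w = of_real (1 / norm v) * cdot v w"
  unfolding normalize_vec_def cdot_scale_left by simp

lemma norm_normalize_vec: "v \<noteq> 0 \<Longrightarrow> norm (normalize_vec v) = 1"
  by (simp add: normalize_vec_def norm_scale norm_divide)

text \<open>A complex Householder reflection: the phase has to be \<open>- (1 - cnj s) / (1 - s)\<close> for
  \<open>s = cdot \<psi> \<phi>\<close>.\<close>

lemma householder:
  assumes "norm \<phi> = 1" "norm \<psi> = 1" "\<phi> \<noteq> \<psi>"
  obtains z where "cmod z = 1" "phase_along (normalize_vec (\<phi> - \<psi>)) z *v \<phi> = \<psi>"
proof -
  define s where "s = cdot \<psi> \<phi>"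
  define d where "d = norm (\<phi> - \<psi>)"
  have d0: "d > 0"
    using assms(3) by (simp add: d_def)
  have self: "cdot \<phi> \<phi> = 1" "cdot \<psi> \<psi> = 1"
    using assms by (simp_all add: norm_eq_1_iff)
  have d2: "of_real (d\<^sup>2) = (1 - s) + (1 - cnj s)"
    unfolding d_def cdot_self[symmetric] s_def
    by (simp add: cdot_diff_left cdot_diff_right self cdot_commute[of \<phi> \<psi>])
  have s1: "1 - s \<noteq> 0"
  proof
    assume "1 - s = 0"
    then have "complex_of_real (d\<^sup>2) = 0"
      unfolding d2 by simp
    then show False
      using d0 by simp
  qed
  define z where "z = - (1 - cnj s) / (1 - s)"
  have "cmod z = cmod (cnj (1 - s)) / cmod (1 - s)"
    unfolding z_def norm_divide norm_minus_cancel by simp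
  then have z1: "cmod z = 1"
    using s1 by (simp only: complex_mod_cnj) simp
  have inner: "cdot (\<phi> - \<psi>) \<phi> = 1 - s"
    by (simp add: cdot_diff_left self s_def)
  \<comment> \<open>The phase is chosen for this identity: it makes the correction added to \<phi>
    exactly \<psi> - \<phi>.\<close>
  have "z - 1 = - of_real (d\<^sup>2) / (1 - s)"
    unfolding d2 z_def using s1 by (simp add: field_simps)
  then have "(z - 1) * (1 - s) = - of_real (d\<^sup>2)"
    using s1 by simp
  then have "(z - 1) * (cnj (of_real (1 / d)) * (1 - s)) * of_real (1 / d) = - 1"
    using d0 by (simp add: field_simps power2_eq_square)
  then have "phase_along (normalize_vec (\<phi> - \<psi>)) z *v \<phi> = \<phi> + (- 1) *s (\<phi> - \<psi>)"
    unfolding phase_along_vec normalize_vec_def d_def[symmetric] cdot_scale_left inner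
      vector_smult_assoc by simp
  then show thesis
    using that[OF z1] by simp
qed

lemma continuous_on_matI:
  "(\<And>i j. continuous_on S (\<lambda>x. f x $ i $ j)) \<Longrightarrow> continuous_on S (f :: _ \<Rightarrow> complex ^ 'n ^ 'm)"
  unfolding continuous_on_def by (auto intro!: vec_tendstoI)

lemma mat_eq_oneI:
  assumes "\<And>x. A *v axis x 1 = axis x (1::complex)"
  shows "A = mat 1"
proof -
  have "A $ i $ j = mat 1 $ i $ j" for i j
  proof -
    have "A $ i $ j = (A *v axis j 1) $ i"
      by (simp add: mult_vec_nth axis_def if_distrib cong: if_cong)
    then show ?thesis
      unfolding assms by (simp add: mat_nth axis_def)
  qed
  then show ?thesis
    by (simp add: vec_eq_iff)
qed

lemma norm_axis_1: "norm (axis x (1::complex)) = 1"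
  by (simp add: norm_eq_1_iff cdot_axis)

locale closed_unitary_group =
  fixes \<G> :: "(complex ^ 'a ^ 'a) set"
  assumes closed_G: "closed \<G>"
    and unitary_G: "U \<in> \<G> \<Longrightarrow> unitary U"
    and phase_G: "cmod z = 1 \<Longrightarrow> cscale z (mat 1) \<in> \<G>"
    and mult_G: "U \<in> \<G> \<Longrightarrow> V \<in> \<G> \<Longrightarrow> U ** V \<in> \<G>"
    and adj_G: "U \<in> \<G> \<Longrightarrow> adj U \<in> \<G>"
begin

definition axes :: "(complex ^ 'a) set"
  where "axes = {w. norm w = 1 \<and> (\<forall>z. cmod z = 1 \<longrightarrow> phase_along w z \<in> \<G>)}"

lemma one_G: "mat 1 \<in> \<G>"
  using phase_G[of 1] by simp

lemma cscale_G: "cmod z = 1 \<Longrightarrow> U \<in> \<G> \<Longrightarrow> cscale z U \<in> \<G>"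
  using mult_G[OF phase_G, of z U] by (simp add: cscale_mult_left)

lemma axes_phase: "w \<in> axes \<Longrightarrow> cmod z = 1 \<Longrightarrow> phase_along w z \<in> \<G>"
  by (simp add: axes_def)

lemma axes_image: "w \<in> axes \<Longrightarrow> U \<in> \<G> \<Longrightarrow> U *v w \<in> axes"
  by (auto simp: axes_def unitary_norm unitary_G phase_along_conjugate intro!: mult_G adj_G)

lemma axes_scale: "cmod c = 1 \<Longrightarrow> w \<in> axes \<Longrightarrow> c *s w \<in> axes"
  by (simp add: axes_def phase_along_scale norm_scale)

lemma axes_scale_iff: "cmod c = 1 \<Longrightarrow> c *s w \<in> axes \<longleftrightarrow> w \<in> axes"
  by (simp add: axes_def phase_along_scale norm_scale)

lemma axes_image_iff:
  assumes "U \<in> \<G>"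
  shows "U *v w \<in> axes \<longleftrightarrow> w \<in> axes"
proof -
  have "adj U *v (U *v w) = w"
    using unitary_G[OF assms] by (simp add: matrix_vector_mul_assoc unitary_def)
  then show ?thesis
    by (metis assms adj_G axes_image)
qed

text \<open>The columns of \<open>U\<close> are straightened one at a time: a reflection moves the
  image of the next basis vector back to its place and leaves the basis vectors already fixed alone.
  When all are fixed, \<open>U\<close> is the inverse of the product of the reflections.\<close>

theorem all_unitaries:
  assumes axes: "\<And>w. norm w = 1 \<Longrightarrow> w \<in> axes" and U: "unitary U"
  shows "U \<in> \<G>"
proof -
  have "\<exists>V\<in>\<G>. \<forall>x\<in>S. (V ** U) *v axis x 1 = axis x 1" if "finite S" for S
    using that
  proof (induction S)
    case empty
    show ?case
      using one_G by auto
  next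
    case (insert x S)
    then obtain V where V: "V \<in> \<G>" and fixed: "\<And>y. y \<in> S \<Longrightarrow> (V ** U) *v axis y 1 = axis y 1"
      by blast
    define \<phi> where "\<phi> = (V ** U) *v axis x 1"
    have VU: "unitary (V ** U)"
      using V U unitary_G unitary_mult by blast
    show ?case
    proof (cases "\<phi> = axis x 1")
      case True
      with V fixed show ?thesis
        unfolding \<phi>_def by auto
    next
      case False
      have n1: "norm \<phi> = 1"
        unfolding \<phi>_def by (simp add: unitary_norm[OF VU] norm_axis_1)
      then obtain z where z: "cmod z = 1"
        and P: "phase_along (normalize_vec (\<phi> - axis x 1)) z *v \<phi> = axis x 1"
        using householder[OF _ norm_axis_1 False] by blast
      let ?P = "phase_along (normalize_vec (\<phi> - axis x 1)) z"
      have "?P \<in> \<G>"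
        using axes[OF norm_normalize_vec] axes_phase z False by simp
      moreover have "(?P ** V ** U) *v axis y 1 = axis y 1" if y: "y \<in> insert x S" for y
      proof (cases "y = x")
        case True
        then show ?thesis
          using P by (simp add: \<phi>_def matrix_vector_mul_assoc matrix_mul_assoc)
      next
        case False
        then have "y \<in> S"
          using y by simp
        \<comment> \<open>Inner products are preserved and \<open>axis y 1\<close> is already fixed,
          so it is orthogonal to the direction of the reflection.\<close>
        have "cdot \<phi> (axis y 1) = cdot (axis x 1) (axis y 1)"
          using fixed[OF \<open>y \<in> S\<close>] unitary_cdot[OF VU, of "axis x 1" "axis y 1"] by (simp add: \<phi>_def)
        then have "?P *v axis y 1 = axis y 1"
          by (simp add: phase_along_vec cdot_normalize_vec cdot_diff_left)
        then show ?thesis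
          using fixed[OF \<open>y \<in> S\<close>] by (simp add: matrix_vector_mul_assoc[symmetric])
      qed
      ultimately show ?thesis
        using V mult_G by blast
    qed
  qed
  then obtain V where V: "V \<in> \<G>" and "\<And>x. (V ** U) *v axis x 1 = axis x 1"
    by (metis UNIV_I finite)
  then have "V ** U = mat 1"
    by (intro mat_eq_oneI)
  then have "adj V ** (V ** U) = adj V"
    by simp
  then have "U = adj V"
    using unitary_G[OF V] by (simp add: matrix_mul_assoc unitary_def)
  then show ?thesis
    using V adj_G by simp
qed

text \<open>The reflection that carries \<phi> to \<psi> belongs to the group and fixes \<xi>, which
  is orthogonal to its direction; axes are invariant under the group.\<close>

lemma axes_move:
  assumes "norm \<phi> = 1" "norm \<psi> = 1" "\<phi> \<noteq> \<psi> \<Longrightarrow> normalize_vec (\<phi> - \<psi>) \<in> axes"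
    and "cdot (\<phi> - \<psi>) \<xi> = 0" "\<alpha> *s \<psi> + \<beta> *s \<xi> \<in> axes"
  shows "\<alpha> *s \<phi> + \<beta> *s \<xi> \<in> axes"
proof (cases "\<phi> = \<psi>")
  case False
  then obtain z where z: "cmod z = 1" and P: "phase_along (normalize_vec (\<phi> - \<psi>)) z *v \<phi> = \<psi>"
    using householder assms by metis
  let ?P = "phase_along (normalize_vec (\<phi> - \<psi>)) z"
  have "?P *v \<xi> = \<xi>"
    using assms(4) by (simp add: phase_along_vec cdot_normalize_vec)
  then have "?P *v (\<alpha> *s \<phi> + \<beta> *s \<xi>) = \<alpha> *s \<psi> + \<beta> *s \<xi>"
    using P by (simp add: matrix_vector_right_distrib vector_scalar_commute)
  moreover have "?P \<in> \<G>"
    using assms(3) False axes_phase z by blast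
  ultimately show ?thesis
    using assms(5) axes_image_iff by metis
qed (use assms in simp)

text \<open>Full control of the plane spanned by two basis vectors. This is the unit from which
  control of the whole space is assembled.\<close>

definition linked :: "'a \<Rightarrow> 'a \<Rightarrow> bool"
  where "linked x y \<longleftrightarrow> (\<forall>\<alpha> \<beta>. (cmod \<alpha>)\<^sup>2 + (cmod \<beta>)\<^sup>2 = 1 \<longrightarrow> \<alpha> *s axis x 1 + \<beta> *s axis y 1 \<in> axes)"

lemma linked_sym: "linked x y \<Longrightarrow> linked y x"
  unfolding linked_def by (metis add.commute)

lemma axis_orthogonal: "x \<noteq> y \<Longrightarrow> cdot (axis x 1) (axis y 1) = 0"
  by (simp add: cdot_axis) (simp add: axis_def)

text \<open>The link between \<open>y\<close> and \<open>z\<close> supplies the reflection that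
  carries the basis vector of \<open>z\<close> to that of \<open>y\<close>. It fixes the basis
  vector of \<open>x\<close>, so it carries the plane of \<open>x\<close> and \<open>z\<close> to
  the plane of \<open>x\<close> and \<open>y\<close>.\<close>

lemma linked_trans:
  assumes "linked x y" "linked y z" "x \<noteq> y" "y \<noteq> z" "x \<noteq> z"
  shows "linked x z"
proof -
  have "\<alpha> *s axis z 1 + \<beta> *s axis x 1 \<in> axes" if ab: "(cmod \<alpha>)\<^sup>2 + (cmod \<beta>)\<^sup>2 = 1" for \<alpha> \<beta>
  proof (rule axes_move[where \<psi> = "axis y 1"])
    \<comment> \<open>The norm here is sqrt 2, so the normalized difference is a unit vector in the
      plane of \<open>y\<close> and \<open>z\<close>.\<close>
    define r where "r = complex_of_real (1 / norm (axis z (1::complex) - axis y 1))"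
    have "normalize_vec (axis z 1 - axis y 1) = (- r) *s axis y 1 + r *s axis z 1"
      by (simp add: normalize_vec_def r_def vec_eq_iff algebra_simps)
    moreover have "(cmod (- r))\<^sup>2 + (cmod r)\<^sup>2 = 1"
    proof -
      have "complex_of_real ((norm (axis z (1::complex) - axis y 1))\<^sup>2) = 2"
        unfolding cdot_self[symmetric] using assms(4)
        by (simp add: cdot_diff_left cdot_diff_right axis_orthogonal cdot_axis) (simp add: axis_def)
      then have "(norm (axis z (1::complex) - axis y 1))\<^sup>2 = 2"
        by (metis of_real_eq_iff of_real_numeral)
      then show ?thesis
        by (simp add: r_def norm_divide power_divide)
    qed
    ultimately show "normalize_vec (axis z 1 - axis y 1) \<in> axes"
      using assms(2) unfolding linked_def by metis
    show "cdot (axis z 1 - axis y 1) (axis x 1) = 0"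
      using assms by (simp add: cdot_diff_left axis_orthogonal)
    show "\<alpha> *s axis y 1 + \<beta> *s axis x 1 \<in> axes"
      using linked_sym[OF assms(1)] ab unfolding linked_def by blast
  qed (simp_all add: norm_axis_1)
  then have "linked z x"
    unfolding linked_def by blast
  then show ?thesis
    by (rule linked_sym)
qed

text \<open>Induction on the support. The part of \<open>v\<close> on \<open>S\<close> is, up to
  length, a unit vector \<phi>; the induction hypothesis provides the reflection from \<phi> to a
  basis vector of \<open>S\<close>, and what remains lies in the plane of two linked basis
  vectors.\<close>

lemma axes_supported:
  assumes linked: "\<And>x y. x \<noteq> y \<Longrightarrow> linked x y" and axis: "\<And>x. axis x 1 \<in> axes"
    and "finite S"
  shows "norm v = 1 \<Longrightarrow> (\<And>x. x \<notin> S \<Longrightarrow> v $ x = 0) \<Longrightarrow> v \<in> axes"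
  using \<open>finite S\<close>
proof (induction S arbitrary: v)
  case empty
  then have "v = 0"
    by (simp add: vec_eq_iff)
  then show ?case
    using empty by simp
next
  case (insert y S)
  define u where "u = (\<chi> x. if x \<in> S then v $ x else 0)"
  have v: "v = u + (v $ y) *s axis y 1"
    using insert.hyps insert.prems(2) by (auto simp: vec_eq_iff u_def axis_def)
  have uy: "cdot u (axis y 1) = 0" "cdot (axis y 1) u = 0"
    using insert.hyps by (simp_all add: cdot_axis cdot_commute[of u]) (simp_all add: u_def)
  show ?case
  proof (cases "u = 0")
    case True
    then have v': "v = (v $ y) *s axis y 1"
      using v by simp
    then have "cmod (v $ y) = 1"
      by (metis insert.prems(1) mult.right_neutral norm_axis_1 norm_scale)
    then show ?thesis
      using v' axis axes_scale by metis
  next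
    case False
    then obtain x where x: "x \<in> S"
      unfolding u_def by (auto simp: vec_eq_iff split: if_splits)
    define \<phi> where "\<phi> = normalize_vec u"
    have u: "u = of_real (norm u) *s \<phi>"
      using False by (simp add: \<phi>_def normalize_vec_def)
    have \<phi>1: "norm \<phi> = 1"
      using False by (simp add: \<phi>_def norm_normalize_vec)
    have "complex_of_real ((norm u)\<^sup>2 + (cmod (v $ y))\<^sup>2) = cdot v v"
    proof -
      have "cdot v v = cdot u u + cnj (v $ y) * (v $ y)"
        unfolding arg_cong2[of v _ v _ cdot, OF v v]
        using uy(2) by (simp add: cdot_add_left cdot_add_right cdot_scale_left cdot_scale_right uy cdot_axis)
      then show ?thesis
        unfolding cdot_self by (metis complex_norm_square mult.commute of_real_add)
    qed
    also have "\<dots> = of_real 1"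
      using insert.prems(1) by (simp add: norm_eq_1_iff)
    finally have sq: "(norm u)\<^sup>2 + (cmod (v $ y))\<^sup>2 = 1"
      unfolding of_real_eq_iff .
    have "of_real (norm u) *s \<phi> + (v $ y) *s axis y 1 \<in> axes"
    proof (rule axes_move[where \<psi> = "axis x 1"])
      show "normalize_vec (\<phi> - axis x 1) \<in> axes" if "\<phi> \<noteq> axis x 1"
      proof (rule insert.IH)
        show "norm (normalize_vec (\<phi> - axis x 1)) = 1"
          using that by (simp add: norm_normalize_vec)
        show "normalize_vec (\<phi> - axis x 1) $ i = 0" if "i \<notin> S" for i
          using that x by (auto simp: normalize_vec_def \<phi>_def u_def axis_def)
      qed
      have "x \<noteq> y"
        using x insert.hyps by blast
      then show "cdot (\<phi> - axis x 1) (axis y 1) = 0"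
        by (simp add: cdot_diff_left axis_orthogonal \<phi>_def normalize_vec_def cdot_scale_left uy)
      show "of_real (norm u) *s axis x 1 + (v $ y) *s axis y 1 \<in> axes"
        using linked[OF \<open>x \<noteq> y\<close>] sq unfolding linked_def by simp
    qed (simp_all add: \<phi>1 norm_axis_1)
    then show ?thesis
      using u v by metis
  qed
qed

end

section \<open>Density of one-qubit gates\<close>

text \<open>With \<open>z + 1/z = 1/\<surd>2 - 1\<close>, the number \<open>(\<surd>2)\<^sup>n (z\<^sup>n + 1/z\<^sup>n)\<close> has the form
  \<open>p + q\<surd>2\<close> with \<open>p\<close> odd, whereas \<open>2 (\<surd>2)\<^sup>n\<close> has even \<open>p\<close>.\<close>

lemma power_sum_odd:
  fixes z :: complex
  assumes z: "z \<noteq> 0" "z + 1 / z = of_real (1 / sqrt 2 - 1)"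
  shows "\<exists>p q p' q' :: int. odd p \<and>
    of_real (sqrt 2 ^ Suc n) * (z ^ Suc n + (1 / z) ^ Suc n) = of_real (of_int p + of_int q * sqrt 2) \<and>
    of_real (sqrt 2 ^ n) * (z ^ n + (1 / z) ^ n) = of_real (of_int p' + of_int q' * sqrt 2)"
proof (induction n)
  case 0
  have "of_real (sqrt 2) * (z + 1 / z) = of_real (of_int 1 + of_int (- 1) * sqrt 2)"
    unfolding z(2) of_real_mult[symmetric] of_real_eq_iff by (simp add: field_simps)
  then show ?case
    by (intro exI[of _ 1] exI[of _ "- 1"] exI[of _ 2] exI[of _ 0]) simp
next
  case (Suc n)
  then obtain p q p' q' :: int where "odd p"
    and 1: "of_real (sqrt 2 ^ Suc n) * (z ^ Suc n + (1 / z) ^ Suc n) = of_real (of_int p + of_int q * sqrt 2)"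
    and 0: "of_real (sqrt 2 ^ n) * (z ^ n + (1 / z) ^ n) = of_real (of_int p' + of_int q' * sqrt 2)"
    by blast
  have r: "of_real (sqrt 2) * (z + 1 / z) = of_real (1 - sqrt 2)"
    unfolding z(2) of_real_mult[symmetric] of_real_eq_iff by (simp add: field_simps)
  have r2: "complex_of_real (sqrt 2) * of_real (sqrt 2) = 2"
    unfolding of_real_mult[symmetric] by simp
  \<comment> \<open>A two-term recursion, which is why two consecutive values are carried along.
    After scaling its coefficients are 1 - sqrt 2 and 2, so the new integer part differs from
    \<open>p\<close> by an even number.\<close>
  have "z ^ Suc (Suc n) + (1 / z) ^ Suc (Suc n) =
      (z + 1 / z) * (z ^ Suc n + (1 / z) ^ Suc n) - (z ^ n + (1 / z) ^ n)"
    using z(1) by (simp add: field_simps)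
  then have "of_real (sqrt 2 ^ Suc (Suc n)) * (z ^ Suc (Suc n) + (1 / z) ^ Suc (Suc n)) =
      (of_real (sqrt 2) * (z + 1 / z)) * (of_real (sqrt 2 ^ Suc n) * (z ^ Suc n + (1 / z) ^ Suc n))
      - (of_real (sqrt 2) * of_real (sqrt 2)) * (of_real (sqrt 2 ^ n) * (z ^ n + (1 / z) ^ n))"
    by (simp only: of_real_mult power_Suc right_diff_distrib mult.assoc mult.left_commute)
  also have "\<dots> = of_real ((1 - sqrt 2) * (of_int p + of_int q * sqrt 2) - 2 * (of_int p' + of_int q' * sqrt 2))"
    unfolding r r2 1 0 by simp
  also have "\<dots> = of_real (of_int (p - 2 * q - 2 * p') + of_int (q - p - 2 * q') * sqrt 2)"
    unfolding of_real_eq_iff by (simp add: algebra_simps)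
  finally show ?case
    using 1 \<open>odd p\<close>
    by (intro exI[of _ "p - 2 * q - 2 * p'"] exI[of _ "q - p - 2 * q'"] exI[of _ p] exI[of _ q]) simp
qed

lemma even_if_sqrt2_multiple:
  assumes "of_int p = of_int q * sqrt 2"
  shows "even p"
proof -
  have "(of_int p :: real)\<^sup>2 = 2 * (of_int q)\<^sup>2"
    using assms by (simp add: power_mult_distrib)
  then have "p\<^sup>2 = 2 * q\<^sup>2"
    by (metis (mono_tags, lifting) of_int_eq_iff of_int_mult of_int_numeral of_int_power)
  then show ?thesis
    by (metis dvd_triv_left even_power)
qed

text \<open>If the power were 1, then \<open>p + q * sqrt 2\<close> would be
  \<open>2 * sqrt 2 ^ n\<close>, which is an even integer for even \<open>n\<close> and an integer
  multiple of sqrt 2 for odd \<open>n\<close>. Either way an odd integer would be an integer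
  multiple of sqrt 2.\<close>

lemma not_root_of_unity:
  fixes z :: complex
  assumes z: "z \<noteq> 0" "z + 1 / z = of_real (1 / sqrt 2 - 1)" and "n > 0"
  shows "z ^ n \<noteq> 1"
proof
  assume "z ^ n = 1"
  obtain m where n: "n = Suc m"
    using \<open>n > 0\<close> by (cases n) auto
  obtain p q :: int where "odd p"
    and "of_real (sqrt 2 ^ n) * (z ^ n + (1 / z) ^ n) = complex_of_real (of_int p + of_int q * sqrt 2)"
    using power_sum_odd[OF z, of m] unfolding n by blast
  then have "complex_of_real (sqrt 2 ^ n * 2) = of_real (of_int p + of_int q * sqrt 2)"
    using \<open>z ^ n = 1\<close> by (simp add: power_divide)
  then have eq: "sqrt 2 ^ n * 2 = of_int p + of_int q * sqrt 2"
    unfolding of_real_eq_iff .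
  show False
  proof (cases "even n")
    case True
    then obtain k where "n = 2 * k"
      by blast
    then have "sqrt 2 ^ n = 2 ^ k"
      by (simp add: power_mult)
    then have "of_int (p - 2 * 2 ^ k) = of_int (- q) * sqrt 2"
      using eq by simp
    then show False
      using even_if_sqrt2_multiple \<open>odd p\<close> by fastforce
  next
    case False
    then obtain k where "n = 2 * k + 1"
      by (meson oddE)
    then have "sqrt 2 ^ n = 2 ^ k * sqrt 2"
      by (simp add: power_mult)
    then have "of_int p = of_int (2 * 2 ^ k - q) * sqrt 2"
      using eq by (simp add: algebra_simps)
    then show False
      using even_if_sqrt2_multiple \<open>odd p\<close> by fastforce
  qed
qed

lemma cis_diff_le: "cmod (cis a - cis b) \<le> \<bar>a - b\<bar>"
proof -
  have "cis a - cis b = cis b * (cis (a - b) - 1)"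
    by (simp add: right_diff_distrib cis_mult)
  then have "cmod (cis a - cis b) = cmod (exp (\<i> * of_real (a - b)) - 1)"
    by (simp add: norm_mult cis_conv_exp)
  also have "\<dots> = 2 * \<bar>sin ((a - b) / 2)\<bar>"
    using dist_exp_i_1[of "a - b"] by simp
  also have "\<dots> \<le> 2 * \<bar>(a - b) / 2\<bar>"
    using abs_sin_x_le_abs_x[of "(a - b) / 2"] by linarith
  finally show ?thesis
    by simp
qed

text \<open>A rational multiple of the full angle would make \<open>z\<close> a root of unity. So
  the angle is irrational, the fractional parts of its multiples are dense, and a chord is at most
  as long as its arc.\<close>

lemma powers_dense_in_circle:
  assumes z: "cmod z = 1" "\<And>n. n > 0 \<Longrightarrow> z ^ n \<noteq> 1" and w: "cmod w = 1" and "e > 0"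
  obtains n where "cmod (z ^ n - w) < e"
proof -
  define \<theta> where "\<theta> = Arg z / (2 * pi)"
  define \<alpha> where "\<alpha> = Arg w / (2 * pi)"
  have "z = cis (Arg z)" "w = cis (Arg w)"
    using z(1) w by (metis norm_zero zero_neq_one cis_Arg sgn_eq div_by_1 of_real_1)+
  then have z\<theta>: "z = cis (2 * pi * \<theta>)" and w\<alpha>: "w = cis (2 * pi * \<alpha>)"
    by (simp_all add: \<theta>_def \<alpha>_def)
  have "\<theta> \<notin> \<rat>"
  proof
    assume "\<theta> \<in> \<rat>"
    then obtain a b :: int where "b > 0" "\<theta> = of_int a / of_int b"
      by (metis Rats_cases')
    then have "z ^ nat b = cis (2 * pi * of_int a)"
      by (simp add: z\<theta> Complex.DeMoivre)
    also have "\<dots> = 1"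
      by (rule cis_multiple_2pi) simp
    finally show False
      using z(2)[of "nat b"] \<open>b > 0\<close> by simp
  qed
  then obtain h k where hk: "k > 0" "\<bar>of_int k * \<theta> - of_int h - \<alpha>\<bar> < e / (2 * pi)"
    using sequence_of_fractional_parts_is_dense[of \<theta> "e / (2 * pi)" \<alpha>] \<open>e > 0\<close> pi_gt_zero
    by (metis divide_pos_pos zero_less_mult_iff zero_less_numeral)
  have "z ^ nat k = cis (2 * pi * (of_int k * \<theta>))"
    using hk(1) by (simp add: z\<theta> Complex.DeMoivre ac_simps)
  also have "\<dots> = cis (2 * pi * (of_int k * \<theta> - of_int h)) * cis (2 * pi * of_int h)"
    by (simp add: cis_mult algebra_simps)
  also have "cis (2 * pi * of_int h) = 1"
    by (rule cis_multiple_2pi) simp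
  finally have "cmod (z ^ nat k - w) \<le> \<bar>2 * pi * (of_int k * \<theta> - of_int h) - 2 * pi * \<alpha>\<bar>"
    unfolding w\<alpha> mult_1_right using cis_diff_le by metis
  also have "\<dots> = 2 * pi * \<bar>of_int k * \<theta> - of_int h - \<alpha>\<bar>"
    by (simp add: right_diff_distrib[symmetric] abs_mult)
  also have "\<dots> < e"
    using hk(2) by (simp add: field_simps)
  finally show thesis
    by (rule that)
qed

context closed_unitary_group
begin

lemma phase_along_power:
  "norm w = 1 \<Longrightarrow> phase_along w z \<in> \<G> \<Longrightarrow> phase_along w (z ^ n) \<in> \<G>"
proof (induction n)
  case 0
  then show ?case
    using one_G by simp
next
  case (Suc n)
  then show ?case
    using mult_G[of "phase_along w z" "phase_along w (z ^ n)"] by (simp add: phase_along_mult)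
qed

text \<open>The phases \<open>y\<close> whose gate lies in the group form a closed set, and this set
  contains the dense powers of \<open>z\<close>.\<close>

lemma axes_if_irrational:
  assumes "norm w = 1" "phase_along w z \<in> \<G>" "cmod z = 1" "\<And>n. n > 0 \<Longrightarrow> z ^ n \<noteq> 1"
  shows "w \<in> axes"
proof -
  have "phase_along w y \<in> \<G>" if y: "cmod y = 1" for y
  proof -
    define C where "C = phase_along w -` \<G>"
    have "continuous_on UNIV (phase_along w)"
      by (intro continuous_on_matI) (unfold phase_along_nth, intro continuous_intros)
    then have "closed C"
      unfolding C_def using closed_G by (simp add: continuous_on_closed_vimage)
    moreover have "y \<in> closure C"
      unfolding closure_approachable
    proof (intro allI impI)
      fix e :: real assume "e > 0"
      then obtain n where "cmod (z ^ n - y) < e"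
        using powers_dense_in_circle[OF assms(3,4) y] by blast
      then show "\<exists>x\<in>C. dist x y < e"
        using phase_along_power[OF assms(1,2)] by (auto simp: C_def dist_norm)
    qed
    ultimately show ?thesis
      by (simp add: C_def)
  qed
  then show ?thesis
    using assms(1) by (simp add: axes_def)
qed

end

definition hadamard :: qmat
  where "hadamard = (\<chi> a b. (if a \<and> b then - 1 else 1) / complex_of_real (sqrt 2))"

lemma hadamard_nth [simp]: "hadamard $ a $ b = (if a \<and> b then - 1 else 1) / complex_of_real (sqrt 2)"
  by (simp add: hadamard_def)

lemma phase_gate_nth [simp]: "phase_gate z $ a $ b = (if a = b then (if a then z else 1) else 0)"
  by (simp add: phase_gate_def)

lemma sqrt2_square: "complex_of_real (sqrt 2) * of_real (sqrt 2) = 2"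
  unfolding of_real_mult[symmetric] by simp

lemma phase_gate_mult: "phase_gate y ** phase_gate z = phase_gate (y * z)"
  by (simp add: vec_eq_iff mult_nth UNIV_bool)

lemma adj_phase_gate: "adj (phase_gate z) = phase_gate (cnj z)"
  by (simp add: vec_eq_iff)

lemma phase_gate_one: "phase_gate 1 = mat 1"
  by (simp add: vec_eq_iff mat_nth)

lemma phase_gate_unitary: "cmod z = 1 \<Longrightarrow> unitary (phase_gate z)"
  by (rule unitaryI)
    (simp add: adj_phase_gate phase_gate_mult phase_gate_one complex_norm_square[symmetric] mult.commute[of "cnj z"])

lemma adj_hadamard: "adj hadamard = hadamard"
  by (simp add: vec_eq_iff)

lemma hadamard_square: "hadamard ** hadamard = mat 1"
  by (simp add: vec_eq_iff mult_nth UNIV_bool mat_nth sqrt2_square)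

lemma hadamard_unitary: "unitary hadamard"
  by (rule unitaryI) (simp add: adj_hadamard hadamard_square)

text \<open>The parameter is the angle in the real plane, half the angle on the Bloch sphere; adding
  \<open>pi / 2\<close> gives an orthogonal vector.\<close>

definition real_ket :: "real \<Rightarrow> complex ^ bool"
  where "real_ket \<eta> = (\<chi> a. if a then of_real (sin \<eta>) else of_real (cos \<eta>))"

lemma norm_real_ket: "norm (real_ket \<eta>) = 1"
  unfolding norm_eq_1_iff
  by (simp add: cdot_def UNIV_bool real_ket_def of_real_mult[symmetric] of_real_add[symmetric]
      power2_eq_square[symmetric] del: of_real_mult of_real_add of_real_power)
    (simp add: cos_of_real[symmetric] sin_of_real[symmetric] del: cos_of_real sin_of_real)

text \<open>Up to a global phase, \<open>T H T H T\<close> is \<open>cos \<theta> - \<i> sin \<theta> N\<close> with \<open>N\<close> real, symmetric and traceless.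
  So it is a rotation around a real eigenvector of \<open>N\<close>.\<close>

lemma THTHT_rotation:
  fixes T :: qmat
  defines "T \<equiv> phase_gate (cis (pi / 4))"
  obtains \<eta> z p where "T ** hadamard ** T ** hadamard ** T = cscale p (phase_along (real_ket \<eta>) z)"
    "cmod p = 1" "cmod z = 1" "z + 1 / z = of_real (1 / sqrt 2 - 1)"
proof -
  define c s where "c = cos (pi / 8)" and "s = sin (pi / 8)"
  \<comment> \<open>With \<nu> = exp (i pi / 8), the product of the five gates has determinant
    \<open>\<nu> ^ 6\<close>. Once the phase \<open>\<nu> ^ 3\<close> is split off,
    \<open>C0\<close> is half of the trace, that is, the cosine of the rotation angle
    \<theta>.\<close>
  define C0 where "C0 = c / sqrt 2"
  have cs: "c\<^sup>2 + s\<^sup>2 = 1"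
    by (simp add: c_def s_def)
  have c2: "2 * c\<^sup>2 = 1 + 1 / sqrt 2"
  proof -
    have "2 * c\<^sup>2 = 1 + cos (pi / 4)"
      using cos_double_cos[of "pi / 8"] by (simp add: c_def)
    moreover have "sqrt 2 / 2 = 1 / sqrt 2"
      by (simp add: field_simps)
    ultimately show ?thesis
      unfolding cos_45 by simp
  qed
  have C02: "C0\<^sup>2 = c\<^sup>2 / 2"
    by (simp add: C0_def power_divide)
  define \<theta> where "\<theta> = arccos C0"
  have "C0\<^sup>2 \<le> 1"
    unfolding C02 using cs by (smt (verit) sum_squares_ge_zero zero_le_power2 field_sum_of_halves)
  then have "\<bar>C0\<bar> \<le> 1"
    by (simp add: abs_square_le_1)
  then have cos\<theta>: "cos \<theta> = C0"
    by (simp add: \<theta>_def cos_arccos_abs)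
  define S0 where "S0 = sin \<theta>"
  have S02: "S0\<^sup>2 = C0\<^sup>2 + s\<^sup>2"
    using sin_cos_squared_add[of \<theta>] cs unfolding S0_def cos\<theta> C02 by simp
  have "s > 0"
    unfolding s_def by (rule sin_gt_zero) (simp_all add: pi_gt_zero)
  then have S0: "S0 \<noteq> 0"
    using S02 by (metis power_zero_numeral sum_power2_gt_zero_iff less_irrefl less_numeral_extra(3) zero_eq_power2 power2_less_0 add.commute)
  \<comment> \<open>The matrix \<open>N\<close> has the rows \<open>(C0, s) / S0\<close> and
    \<open>(s, - C0) / S0\<close>. With these entries as cosine and sine of \<tau> it is a
    reflection of the real plane, whose fixed vector has the angle
    \<open>\<tau> / 2\<close>.\<close>
  have "(C0 / S0)\<^sup>2 + (s / S0)\<^sup>2 = 1"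
    unfolding power_divide add_divide_distrib[symmetric] S02[symmetric] using S0 by simp
  then obtain \<tau> where \<tau>: "C0 / S0 = cos \<tau>" "s / S0 = sin \<tau>"
    using sincos_total_2pi by metis
  define \<eta> where "\<eta> = \<tau> / 2"
  define \<nu> where "\<nu> = cis (pi / 8)"
  \<comment> \<open>The eigenvalues of the product are \<open>\<nu> ^ 3 * cis \<theta>\<close> and
    \<open>\<nu> ^ 3 * cis (- \<theta>)\<close>. The first one becomes the global phase, and
    \<open>z\<close> is the second divided by the first.\<close>
  define p where "p = \<nu> ^ 3 * cis \<theta>"
  define z where "z = cis (- 2 * \<theta>)"
  have pz: "p * (z - 1) = - 2 * \<i> * S0 * \<nu> ^ 3"
  proof -
    have "cis \<theta> * z = cis (- \<theta>)"
      by (simp add: z_def cis_mult)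
    then have "cis \<theta> * (z - 1) = cis (- \<theta>) - cis \<theta>"
      by (simp add: right_diff_distrib)
    also have "\<dots> = - 2 * \<i> * S0"
      by (simp add: S0_def complex_eq_iff)
    finally show ?thesis
      unfolding p_def by (simp add: mult.assoc mult.left_commute)
  qed
  have \<nu>: "\<nu> = of_real c + \<i> * of_real s"
    by (simp add: \<nu>_def c_def s_def complex_eq_iff)
  have \<omega>: "cis (pi / 4) = \<nu> ^ 2"
    by (simp add: \<nu>_def Complex.DeMoivre)
  have \<nu>4: "\<nu> ^ 4 = \<i>"
    by (simp add: \<nu>_def Complex.DeMoivre)
  have r2: "of_real (sqrt 2) * \<nu> ^ 2 = 1 + \<i>"
    unfolding \<omega>[symmetric] by (simp add: complex_eq_iff cos_45 sin_45)
  have cos2: "2 * (cos \<eta>)\<^sup>2 = 1 + C0 / S0"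
    using cos_double_cos[of \<eta>] \<tau>(1) by (simp add: \<eta>_def)
  have sin2: "2 * (sin \<eta>)\<^sup>2 = 1 - C0 / S0"
    using cos2 sin_cos_squared_add[of \<eta>] by linarith
  have sincos: "2 * (sin \<eta> * cos \<eta>) = s / S0"
    using sin_double[of \<eta>] \<tau>(2) by (simp add: \<eta>_def)
  have "cmod p = 1" "cmod z = 1"
    by (simp_all add: p_def z_def \<nu>_def norm_mult norm_power)
  moreover have "z + 1 / z = of_real (1 / sqrt 2 - 1)"
  proof -
    have "1 / z = cis (2 * \<theta>)"
      by (simp add: z_def divide_inverse cis_inverse)
    then have "z + 1 / z = of_real (2 * cos (2 * \<theta>))"
      by (simp add: z_def complex_eq_iff)
    also have "2 * cos (2 * \<theta>) = 1 / sqrt 2 - 1"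
      unfolding cos_double_cos cos\<theta> C02 using c2 by simp
    finally show ?thesis .
  qed
  moreover have "T ** hadamard ** T ** hadamard ** T = cscale p (phase_along (real_ket \<eta>) z)"
  proof -
    define U where "U = T ** hadamard ** T ** hadamard ** T"
    have om: "(1 + \<nu>\<^sup>2) = 2 * c * \<nu>" "1 - \<nu>\<^sup>2 = - 2 * \<i> * s * \<nu>"
    proof -
      have "\<nu> * cnj \<nu> = 1"
        by (simp add: \<nu>_def cis_cnj cis_mult)
      moreover have "\<nu> + cnj \<nu> = 2 * c" "cnj \<nu> - \<nu> = - 2 * \<i> * s"
        by (simp_all add: \<nu> complex_eq_iff)
      ultimately show "(1 + \<nu>\<^sup>2) = 2 * c * \<nu>" "1 - \<nu>\<^sup>2 = - 2 * \<i> * s * \<nu>"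
        by (metis distrib_right add.commute mult.commute power2_eq_square, 
            metis left_diff_distrib mult.commute power2_eq_square)
    qed
    have U: "U $ False $ False = (1 + \<nu>\<^sup>2) / 2" "U $ False $ True = \<nu>\<^sup>2 * (1 - \<nu>\<^sup>2) / 2"
      "U $ True $ False = \<nu>\<^sup>2 * (1 - \<nu>\<^sup>2) / 2" "U $ True $ True = \<nu> ^ 4 * (1 + \<nu>\<^sup>2) / 2"
      unfolding U_def T_def \<omega>
      by (simp_all add: mult_nth UNIV_bool sqrt2_square field_simps power4_eq_xxxx power2_eq_square) 
    let ?P = "cscale p (phase_along (real_ket \<eta>) z)"
    have P: "?P $ a $ b = p * (if a = b then 1 else 0) + (- 2 * \<i> * S0 * \<nu> ^ 3) * (real_ket \<eta> $ a * cnj (real_ket \<eta> $ b))" for a b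
      unfolding pz[symmetric] by (simp add: phase_along_nth algebra_simps)
    have p: "p = \<nu> ^ 3 * (C0 + \<i> * S0)"
      unfolding p_def by (simp add: S0_def cos\<theta>[symmetric] complex_eq_iff)
    have k: "of_real S0 * (2 * complex_of_real (cos \<eta>) * of_real (cos \<eta>)) = of_real (S0 + C0)"
      "of_real S0 * (2 * complex_of_real (sin \<eta>) * of_real (sin \<eta>)) = of_real (S0 - C0)"
      "of_real S0 * (2 * complex_of_real (sin \<eta>) * of_real (cos \<eta>)) = of_real s"
    proof -
      have "S0 * (2 * cos \<eta> * cos \<eta>) = S0 + C0" "S0 * (2 * sin \<eta> * sin \<eta>) = S0 - C0"
        "S0 * (2 * sin \<eta> * cos \<eta>) = s"
        using cos2 sin2 sincos S0 by (simp_all add: power2_eq_square mult.assoc field_simps)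
      then show "of_real S0 * (2 * complex_of_real (cos \<eta>) * of_real (cos \<eta>)) = of_real (S0 + C0)"
        "of_real S0 * (2 * complex_of_real (sin \<eta>) * of_real (sin \<eta>)) = of_real (S0 - C0)"
        "of_real S0 * (2 * complex_of_real (sin \<eta>) * of_real (cos \<eta>)) = of_real s"
        by (metis of_real_mult of_real_numeral)+
    qed
    \<comment> \<open>A consequence of \<open>r2\<close> and (1 + i) (1 - i) = 2.\<close>
    have diagonal: "\<nu> ^ 3 * C0 * (1 - \<i>) = c * \<nu>"
    proof -
      have "c = sqrt 2 * C0"
        by (simp add: C0_def)
      then have "c * \<nu> * 2 = C0 * \<nu> * sqrt 2 * 2"
        by simp
      also have "\<dots> = C0 * \<nu> * sqrt 2 * ((1 + \<i>) * (1 - \<i>))"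
        by (simp add: algebra_simps)
      also have "\<dots> = C0 * \<nu> * (of_real (sqrt 2) * of_real (sqrt 2)) * \<nu> ^ 2 * (1 - \<i>)"
        unfolding r2[symmetric] by (simp only: ac_simps)
      also have "\<dots> = \<nu> ^ 3 * C0 * (1 - \<i>) * 2"
        unfolding sqrt2_square by (simp add: power3_eq_cube power2_eq_square)
      finally show ?thesis
        by simp
    qed
    have "U $ False $ False = ?P $ False $ False"
    proof -
      have "?P $ False $ False = \<nu> ^ 3 * (C0 + \<i> * S0) - \<i> * \<nu> ^ 3 * (of_real S0 * (2 * complex_of_real (cos \<eta>) * of_real (cos \<eta>)))"
        unfolding P unfolding p by (simp add: real_ket_def algebra_simps)
      also have "\<dots> = \<nu> ^ 3 * C0 * (1 - \<i>)"
        unfolding k by (simp add: algebra_simps)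
      finally show ?thesis
        unfolding U om diagonal by simp
    qed
    moreover have "U $ True $ True = ?P $ True $ True"
    proof -
      have "?P $ True $ True = \<nu> ^ 3 * (C0 + \<i> * S0) - \<i> * \<nu> ^ 3 * (of_real S0 * (2 * complex_of_real (sin \<eta>) * of_real (sin \<eta>)))"
        unfolding P unfolding p by (simp add: real_ket_def algebra_simps)
      also have "\<dots> = \<i> * (\<nu> ^ 3 * C0 * (1 - \<i>))"
        unfolding k by (simp add: algebra_simps)
      finally show ?thesis
        unfolding U om diagonal \<nu>4 by simp
    qed
    moreover have "U $ False $ True = ?P $ False $ True" "U $ True $ False = ?P $ True $ False"
    proof -
      have "?P $ False $ True = - \<i> * \<nu> ^ 3 * (of_real S0 * (2 * complex_of_real (sin \<eta>) * of_real (cos \<eta>)))"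
        "?P $ True $ False = - \<i> * \<nu> ^ 3 * (of_real S0 * (2 * complex_of_real (sin \<eta>) * of_real (cos \<eta>)))"
        unfolding P unfolding p by (simp_all add: real_ket_def algebra_simps)
      then show "U $ False $ True = ?P $ False $ True" "U $ True $ False = ?P $ True $ False"
        unfolding k U om by (simp_all add: power3_eq_cube power2_eq_square)
    qed
    ultimately have "U $ a $ b = ?P $ a $ b" for a b
      by (cases a; cases b) simp_all
    then show ?thesis
      unfolding U_def by (simp add: vec_eq_iff)
  qed
  ultimately show thesis
    using that by blast
qed

text \<open>The two axes \<open>w\<close> and \<open>w'\<close> are perpendicular on the Bloch
  sphere, so this is an Euler decomposition: a phase along \<open>w'\<close> turns \<open>w\<close>
  until its two components have the right moduli, and a phase along \<open>w\<close> then adjusts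
  their relative phase.\<close>

lemma one_qubit_universal:
  assumes "closed_unitary_group \<G>"
    and H: "hadamard \<in> \<G>" and T: "phase_gate (cis (pi / 4)) \<in> \<G>" and "unitary U"
  shows "U \<in> \<G>"
proof -
  interpret closed_unitary_group \<G>
    by fact
  obtain \<eta> z p where rot: "phase_gate (cis (pi / 4)) ** hadamard ** phase_gate (cis (pi / 4)) ** hadamard **
      phase_gate (cis (pi / 4)) = cscale p (phase_along (real_ket \<eta>) z)"
    and p: "cmod p = 1" and z: "cmod z = 1" "z + 1 / z = of_real (1 / sqrt 2 - 1)"
    using THTHT_rotation by blast
  have "cnj p * p = 1"
    using p by (simp add: complex_norm_square[symmetric] mult.commute[of "cnj p"])
  have "cscale p (phase_along (real_ket \<eta>) z) \<in> \<G>"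
    unfolding rot[symmetric] by (intro mult_G H T)
  then have "cscale (cnj p) (cscale p (phase_along (real_ket \<eta>) z)) \<in> \<G>"
    using p by (intro cscale_G[of "cnj p"]) simp_all
  then have "phase_along (real_ket \<eta>) z \<in> \<G>"
    using \<open>cnj p * p = 1\<close> by simp
  moreover have "z ^ n \<noteq> 1" if "n > 0" for n
    by (rule not_root_of_unity[OF _ z(2) that]) (use z(1) in auto)
  ultimately have w1: "real_ket \<eta> \<in> axes"
    using axes_if_irrational norm_real_ket z(1) by blast
  have Z: "phase_gate (- 1) \<in> \<G>"
  proof -
    have "cis (pi / 4) * cis (pi / 4) * cis (pi / 4) * cis (pi / 4) = - 1"
      unfolding cis_mult by simp
    then have "phase_gate (- 1) = phase_gate (cis (pi / 4)) ** phase_gate (cis (pi / 4)) **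
        phase_gate (cis (pi / 4)) ** phase_gate (cis (pi / 4))"
      by (simp add: phase_gate_mult)
    then show ?thesis
      using mult_G T by simp
  qed
  define w where "w = real_ket \<eta>"
  define u where "u = real_ket (\<eta> + pi / 2)"
  \<comment> \<open>The product of Z and H is the real rotation by -45 degrees, so the angle to
    \<open>w\<close> is the same whatever \<eta> is.\<close>
  define w' where "w' = phase_gate (- 1) *v (hadamard *v w)"
  have "w \<in> axes" "w' \<in> axes"
    unfolding w'_def w_def by (intro axes_image w1 H Z)+
  have w': "w' = of_real (1 / sqrt 2) *s (w - u)"
  proof -
    have "u = (\<chi> a. if a then of_real (cos \<eta>) else - of_real (sin \<eta>))"
      by (simp add: u_def real_ket_def vec_eq_iff cos_add sin_add)
    then show ?thesis
      by (auto simp: w'_def w_def real_ket_def vec_eq_iff mult_vec_nth UNIV_bool field_simps)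
  qed
  have wu: "cdot w w = 1" "cdot u u = 1" "cdot w u = 0" "cdot u w = 0"
  proof -
    show "cdot w w = 1" "cdot u u = 1"
      by (simp_all add: w_def u_def norm_real_ket norm_eq_1_iff[symmetric])
    show "cdot w u = 0"
      by (simp add: w_def u_def cdot_def UNIV_bool real_ket_def cos_add sin_add)
    then show "cdot u w = 0"
      by (metis cdot_commute complex_cnj_zero)
  qed
  have "v \<in> axes" if v: "norm v = 1" for v
  proof -
    define \<alpha> where "\<alpha> = cdot w v"
    define \<beta> where "\<beta> = cdot u v"
    have v_eq: "v = \<alpha> *s w + \<beta> *s u"
    proof -
      define c s where "c = complex_of_real (cos \<eta>)" and "s = complex_of_real (sin \<eta>)"
      have cs: "s * s + c * c = 1"
        unfolding c_def s_def by (simp add: cos_of_real[symmetric] sin_of_real[symmetric] power2_eq_square[symmetric]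
            del: cos_of_real sin_of_real)
      have w_nth: "w $ False = c" "w $ True = s" "u $ False = - s" "u $ True = c"
        by (simp_all add: w_def u_def c_def s_def real_ket_def cos_add sin_add)
      have cc: "cnj c = c" "cnj s = s"
        by (simp_all add: c_def s_def)
      have "\<alpha> * w $ False + \<beta> * u $ False = (s * s + c * c) * v $ False"
        "\<alpha> * w $ True + \<beta> * u $ True = (s * s + c * c) * v $ True"
        by (simp_all add: \<alpha>_def \<beta>_def cdot_def UNIV_bool w_nth cc algebra_simps)
      then have "v $ a = (\<alpha> *s w + \<beta> *s u) $ a" for a
        unfolding cs by (cases a) simp_all
      then show ?thesis
        by (simp add: vec_eq_iff)
    qed
    have "cdot v v = cnj \<alpha> * \<alpha> + cnj \<beta> * \<beta>"
      by (subst (1 2) v_eq) (simp add: cdot_add_left cdot_add_right cdot_scale_left cdot_scale_right wu)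
    then have "complex_of_real ((cmod \<alpha>)\<^sup>2 + (cmod \<beta>)\<^sup>2) = of_real 1"
      using v unfolding norm_eq_1_iff of_real_add complex_norm_square by (simp add: mult.commute)
    then have "(cmod \<alpha>)\<^sup>2 + (cmod \<beta>)\<^sup>2 = 1"
      unfolding of_real_eq_iff .
    then obtain \<tau> where \<tau>: "cmod \<alpha> = cos \<tau>" "cmod \<beta> = sin \<tau>"
      using sincos_total_2pi by metis
    define b where "b = cis (Arg \<beta>)"
    \<comment> \<open>After the final multiplication by \<open>\<i> * b\<close> the coefficient of
      \<open>u\<close> has the argument of \<beta>; this \<open>r\<close> gives the coefficient of
      \<open>w\<close> the argument of \<alpha>.\<close>
    define r where "r = - \<i> * cis (Arg \<alpha>) * cnj b"
    have b: "cmod b = 1" "b * cnj b = 1"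
      by (simp_all add: b_def cis_cnj cis_mult)
    have "phase_along w' (cis (2 * \<tau>)) *v w \<in> axes"
      using \<open>w \<in> axes\<close> \<open>w' \<in> axes\<close> by (intro axes_image axes_phase) simp_all
    also have "phase_along w' (cis (2 * \<tau>)) *v w = cis \<tau> *s (of_real (cos \<tau>) *s w + (- \<i> * of_real (sin \<tau>)) *s u)"
    proof -
      have "cdot w' w = of_real (1 / sqrt 2)"
        unfolding w' cdot_scale_left by (simp add: cdot_diff_left wu)
      then have "phase_along w' (cis (2 * \<tau>)) *v w =
          w + ((cis (2 * \<tau>) - 1) * (of_real (1 / sqrt 2) * of_real (1 / sqrt 2))) *s (w - u)"
        unfolding phase_along_vec by (simp add: w' vector_smult_assoc mult.assoc)
      also have "complex_of_real (1 / sqrt 2) * of_real (1 / sqrt 2) = 1 / 2"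
        by (simp add: sqrt2_square)
      finally have 1: "phase_along w' (cis (2 * \<tau>)) *v w =
          ((1 + cis (2 * \<tau>)) / 2) *s w + ((1 - cis (2 * \<tau>)) / 2) *s u"
        by (simp add: vec_eq_iff field_simps)
      have 2: "(1 + cis (2 * \<tau>)) / 2 = cis \<tau> * of_real (cos \<tau>)"
        "(1 - cis (2 * \<tau>)) / 2 = cis \<tau> * (- \<i> * of_real (sin \<tau>))"
        using sin_cos_squared_add[of \<tau>]
        by (auto simp: complex_eq_iff cos_double sin_double power2_eq_square)
      then show ?thesis
        unfolding 1 2 by (simp add: vec_eq_iff algebra_simps)
    qed
    finally have "of_real (cos \<tau>) *s w + (- \<i> * of_real (sin \<tau>)) *s u \<in> axes"
      by (subst (asm) axes_scale_iff) simp_all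
    moreover have "phase_along w r \<in> \<G>"
      using \<open>w \<in> axes\<close> b by (intro axes_phase) (simp_all add: r_def norm_mult)
    ultimately have "phase_along w r *v (of_real (cos \<tau>) *s w + (- \<i> * of_real (sin \<tau>)) *s u) \<in> axes"
      by (intro axes_image)
    then have "(r * of_real (cos \<tau>)) *s w + (- \<i> * of_real (sin \<tau>)) *s u \<in> axes"
      by (simp add: phase_along_vec cdot_add_right cdot_scale_right wu vec_eq_iff algebra_simps cong: rev_conj_cong)
    then have "(\<i> * b) *s ((r * of_real (cos \<tau>)) *s w + (- \<i> * of_real (sin \<tau>)) *s u) \<in> axes"
      by (intro axes_scale) (simp_all add: norm_mult b)
    also have "(\<i> * b) *s ((r * of_real (cos \<tau>)) *s w + (- \<i> * of_real (sin \<tau>)) *s u) =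
        (of_real (cos \<tau>) * cis (Arg \<alpha>) * (b * cnj b)) *s w + (of_real (sin \<tau>) * b) *s u"
      by (simp add: r_def vec_eq_iff algebra_simps)
    also have "\<dots> = v"
      unfolding b(2) using v_eq \<tau> rcis_cmod_Arg[of \<alpha>] rcis_cmod_Arg[of \<beta>] by (simp add: rcis_def b_def)
    finally show ?thesis .
  qed
  then show ?thesis
    using all_unitaries \<open>unitary U\<close> by blast
qed

section \<open>Universality on a register\<close>

definition site :: "'q::finite \<Rightarrow> qmat \<Rightarrow> 'q oper"
  where "site q A = tensor (\<lambda>p. if p = q then A else mat 1)"

lemma site_nth: "site q A $ x $ y = (if \<forall>p. p \<noteq> q \<longrightarrow> x p = y p then A $ x q $ y q else 0)"
proof -
  have "site q A $ x $ y = A $ x q $ y q * (\<Prod>p\<in>UNIV - {q}. if x p = y p then 1 else 0)"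
    unfolding site_def tensor_nth by (subst prod.remove[of _ q]) (auto simp: mat_nth intro!: prod.cong)
  also have "(\<Prod>p\<in>UNIV - {q}. if x p = y p then 1 else 0) = (if \<forall>p. p \<noteq> q \<longrightarrow> x p = y p then 1 else (0::complex))"
    by auto
  finally show ?thesis
    by auto
qed

lemma site_mult: "site q A ** site q B = site q (A ** B)"
  unfolding site_def tensor_mult by (rule arg_cong[where f = tensor]) auto

lemma site_one: "site q (mat 1) = mat 1"
  using tensor_one by (simp add: site_def cong: if_cong)

lemma adj_site: "adj (site q A) = site q (adj A)"
  unfolding site_def adj_tensor by (rule arg_cong[where f = tensor]) auto

lemma site_cscale: "site q (cscale z A) = cscale z (site q A)"
  by (auto simp: vec_eq_iff site_nth)

lemma site_unitary: "unitary A \<Longrightarrow> unitary (site q A)"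
  by (simp add: unitary_def adj_site site_mult site_one)

definition permutation_gate :: "(('q \<Rightarrow> bool) \<Rightarrow> ('q \<Rightarrow> bool)) \<Rightarrow> ('q::finite) oper"
  where "permutation_gate \<sigma> = (\<chi> x y. if x = \<sigma> y then 1 else 0)"

lemma permutation_gate_nth [simp]: "permutation_gate \<sigma> $ x $ y = (if x = \<sigma> y then 1 else 0)"
  by (simp add: permutation_gate_def)

lemma adj_permutation_gate_mult:
  "(adj (permutation_gate \<sigma>) ** A ** permutation_gate \<sigma>) $ x $ y = A $ \<sigma> x $ \<sigma> y"
  by (simp add: mult_nth if_distrib[of cnj] if_distrib[of "\<lambda>z. z * _"] if_distrib[of "(*) _"] cong: if_cong)

lemma permutation_gate_unitary: "inj \<sigma> \<Longrightarrow> unitary (permutation_gate \<sigma>)"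
  by (rule unitaryI)
    (use adj_permutation_gate_mult[of \<sigma> "mat 1"] in \<open>simp add: vec_eq_iff mat_nth inj_eq\<close>)

definition cnot_map :: "'q \<Rightarrow> 'q \<Rightarrow> ('q \<Rightarrow> bool) \<Rightarrow> ('q \<Rightarrow> bool)"
  where "cnot_map p q x = x(q := x q \<noteq> x p)"

lemma inj_cnot_map: "p \<noteq> q \<Longrightarrow> inj (cnot_map p q)"
  by (rule inj_on_inverseI[of _ "cnot_map p q"]) (auto simp: cnot_map_def fun_eq_iff)

definition diagonal :: "('a \<Rightarrow> complex) \<Rightarrow> complex ^ 'a ^ 'a"
  where "diagonal f = (\<chi> x y. if x = y then f x else 0)"

lemma diagonal_nth [simp]: "diagonal f $ x $ y = (if x = y then f x else 0)"
  by (simp add: diagonal_def)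

lemma diagonal_mult: "diagonal f ** diagonal g = diagonal (\<lambda>x. f x * g x)"
  by (simp add: vec_eq_iff mult_nth if_distrib[of "\<lambda>z. z * _"] cong: if_cong)

lemma adj_diagonal: "adj (diagonal f) = diagonal (\<lambda>x. cnj (f x))"
  by (simp add: vec_eq_iff)

lemma diagonal_unitary: "(\<And>x. cmod (f x) = 1) \<Longrightarrow> unitary (diagonal f)"
  by (rule unitaryI)
    (simp add: adj_diagonal diagonal_mult vec_eq_iff mat_nth mult.commute[of "cnj _"] complex_norm_square[symmetric])

text \<open>The character of the group of bit strings that belongs to \<open>A\<close>, equally the
  eigenvalue of \<open>Z_on A\<close>. It is real-valued so that it can serve as an
  exponent.\<close>

definition parity_sign :: "'q set \<Rightarrow> ('q \<Rightarrow> bool) \<Rightarrow> real"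
  where "parity_sign A x = (\<Prod>q\<in>A. if x q then - 1 else 1)"

text \<open>The target in \<open>A\<close> flips exactly when the control is set, and the new factor
  for the control cancels that sign.\<close>

lemma parity_sign_cnot:
  fixes x :: "'q::finite \<Rightarrow> bool"
  assumes "q \<in> A" "p \<notin> A"
  shows "parity_sign A x = parity_sign (insert p A) (cnot_map p q x)"
proof -
  have "p \<noteq> q"
    using assms by blast
  have "(\<Prod>r\<in>A - {q}. if cnot_map p q x r then - 1 else 1) = (\<Prod>r\<in>A - {q}. if x r then - 1 else (1::real))"
    by (intro prod.cong) (auto simp: cnot_map_def)
  then show ?thesis
    using assms \<open>p \<noteq> q\<close> unfolding parity_sign_def
    by (simp add: prod.remove[of A q]) (simp add: cnot_map_def)
qed

text \<open>The sum over subsets factors into one binomial per qubit, and a qubit where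
  \<open>x\<close> and \<open>y\<close> differ contributes 1 - 1.\<close>

lemma parity_sign_orthogonal:
  fixes x y :: "'q::finite \<Rightarrow> bool"
  shows "(\<Sum>A\<in>UNIV. parity_sign A x * parity_sign A y) = (if x = y then 2 ^ CARD('q) else 0)"
proof -
  have "(\<Sum>A\<in>UNIV. parity_sign A x * parity_sign A y) =
      (\<Sum>A\<in>Pow UNIV. (\<Prod>q\<in>A. (if x q then - 1 else 1) * (if y q then - 1 else 1)) * (\<Prod>q\<in>UNIV - A. 1))"
    by (simp add: parity_sign_def prod.distrib)
  also have "\<dots> = (\<Prod>q\<in>UNIV. (if x q then - 1 else 1) * (if y q then - 1 else 1) + 1)"
    by (rule prod_add[symmetric]) simp
  also have "\<dots> = (\<Prod>q\<in>UNIV. if x q = y q then 2 else 0)"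
    by (intro prod.cong) auto
  also have "\<dots> = (if x = y then 2 ^ CARD('q) else 0)"
    by (auto simp: fun_eq_iff)
  finally show ?thesis .
qed

locale register_group = closed_unitary_group \<G> for \<G> :: "('q::finite) oper set" +
  assumes site_G: "unitary A \<Longrightarrow> site q A \<in> \<G>"
    and cnot_G: "p \<noteq> q \<Longrightarrow> permutation_gate (cnot_map p q) \<in> \<G>"
begin

text \<open>The diagonal part of the Lie algebra of the group, in real form. It is a real vector
  space, so gates for complicated functions arise from gates for characters.\<close>

definition generators :: "(('q \<Rightarrow> bool) \<Rightarrow> real) set"
  where "generators = {f. \<forall>t. diagonal (\<lambda>x. cis (t * f x)) \<in> \<G>}"

lemma generators_const: "(\<lambda>_. r) \<in> generators"
proof -
  have "diagonal (\<lambda>_. cis (t * r)) = cscale (cis (t * r)) (mat 1 :: 'q oper)" for t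
    by (simp add: vec_eq_iff mat_nth)
  then show ?thesis
    unfolding generators_def by (simp only: mem_Collect_eq) (simp add: phase_G)
qed

lemma generators_add: "f \<in> generators \<Longrightarrow> g \<in> generators \<Longrightarrow> (\<lambda>x. f x + g x) \<in> generators"
  unfolding generators_def by (auto simp: distrib_left cis_mult[symmetric] diagonal_mult[symmetric] mult_G)

lemma generators_scale: "f \<in> generators \<Longrightarrow> (\<lambda>x. r * f x) \<in> generators"
  unfolding generators_def by (auto simp: mult.assoc[symmetric])

lemma generators_sum: "(\<And>i. i \<in> I \<Longrightarrow> f i \<in> generators) \<Longrightarrow> (\<lambda>x. \<Sum>i\<in>I. f i x) \<in> generators"
  by (induction I rule: infinite_finite_induct) (simp_all add: generators_const generators_add)

lemma generators_cnot:
  assumes "p \<noteq> q" "f \<in> generators"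
  shows "(\<lambda>x. f (cnot_map p q x)) \<in> generators"
proof -
  let ?P = "permutation_gate (cnot_map p q)"
  have "diagonal (\<lambda>x. cis (t * f (cnot_map p q x))) = adj ?P ** diagonal (\<lambda>x. cis (t * f x)) ** ?P" for t
    using inj_cnot_map[OF assms(1)] by (simp add: vec_eq_iff adj_permutation_gate_mult inj_eq)
  then show ?thesis
    using assms unfolding generators_def by (auto intro!: mult_G adj_G cnot_G)
qed

text \<open>For one qubit this is a rotation around the Z axis up to global phase; conjugation by a
  CNOT whose target lies in the set adds the control to it.\<close>

lemma generators_parity_sign: "parity_sign A \<in> generators"
proof (cases "A = {}")
  case True
  then have "parity_sign A = (\<lambda>_. 1)"
    by (simp add: parity_sign_def fun_eq_iff)
  then show ?thesis
    using generators_const by simp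
next
  case False
  have "finite A"
    by simp
  then show ?thesis
    using False
  proof (induction rule: finite_ne_induct)
    case (singleton q)
    have "diagonal (\<lambda>x. cis (t * parity_sign {q} x)) = cscale (cis t) (site q (phase_gate (cis (- 2 * t))))" for t
      by (auto simp: vec_eq_iff site_nth parity_sign_def fun_eq_iff cis_mult)
    moreover have "cscale (cis t) (site q (phase_gate (cis (- 2 * t)))) \<in> \<G>" for t
      by (intro cscale_G site_G phase_gate_unitary) simp_all
    ultimately show ?case
      unfolding generators_def by simp
  next
    case (insert p A)
    then obtain q where q: "q \<in> A"
      by blast
    have "parity_sign A (cnot_map p q x) = parity_sign (insert p A) x" for x
    proof -
      have "cnot_map p q (cnot_map p q x) = x"
        using q insert.hyps by (auto simp: cnot_map_def fun_eq_iff)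
      then show ?thesis
        using parity_sign_cnot[OF q insert.hyps(3), of "cnot_map p q x"] by simp
    qed
    moreover have "p \<noteq> q"
      using q insert.hyps by blast
    ultimately show ?case
      using generators_cnot[OF \<open>p \<noteq> q\<close> insert.IH] by simp
  qed
qed

text \<open>The indicator function of a single label is a real combination of characters, so the
  group contains the phase on one basis vector alone.\<close>

lemma axis_in_axes: "axis y 1 \<in> axes"
proof -
  have "(\<lambda>x. 1 / 2 ^ CARD('q) * (\<Sum>A\<in>UNIV. parity_sign A y * parity_sign A x)) \<in> generators"
    by (intro generators_scale generators_sum generators_parity_sign)
  then have *: "(\<lambda>x. if y = x then 1 else 0) \<in> generators"
    unfolding parity_sign_orthogonal by (simp add: if_distrib cong: if_cong)
  have "phase_along (axis y 1) z \<in> \<G>" if "cmod z = 1" for z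
  proof -
    have z: "z = cis (Arg z)"
      using that by (metis norm_zero zero_neq_one cis_Arg sgn_eq div_by_1 of_real_1)
    have "phase_along (axis y 1) z = diagonal (\<lambda>x. cis (Arg z * (if y = x then 1 else 0)))"
      by (subst z) (auto simp: vec_eq_iff phase_along_nth axis_def)
    then show ?thesis
      using * by (simp add: generators_def)
  qed
  then show ?thesis
    by (simp add: axes_def norm_axis_1)
qed

text \<open>A one-qubit unitary on \<open>q\<close> whose column at the value \<open>x q\<close> is
  (\<alpha>, \<beta>) sends the basis vector of \<open>x\<close> to the required
  combination.\<close>

lemma linked_neighbour: "linked x (x(q := \<not> x q))"
proof -
  have "\<alpha> *s axis x 1 + \<beta> *s axis (x(q := \<not> x q)) 1 \<in> axes" if "(cmod \<alpha>)\<^sup>2 + (cmod \<beta>)\<^sup>2 = 1" for \<alpha> \<beta>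
  proof -
    define A :: qmat where "A = (\<chi> a b. if b = x q then (if a = x q then \<alpha> else \<beta>)
      else (if a = x q then - cnj \<beta> else cnj \<alpha>))"
    have "cnj \<alpha> * \<alpha> + cnj \<beta> * \<beta> = 1"
      using that by (metis complex_norm_square mult.commute of_real_1 of_real_add)
    then have "unitary A"
      by (intro unitaryI) (auto simp: vec_eq_iff A_def mult_nth mat_nth UNIV_bool algebra_simps)
    then have "site q A *v axis x 1 \<in> axes"
      by (intro axes_image site_G axis_in_axes)
    also have "site q A *v axis x 1 = \<alpha> *s axis x 1 + \<beta> *s axis (x(q := \<not> x q)) 1"
    proof -
      have "(site q A *v axis x 1) $ y = site q A $ y $ x" for y
        by (simp add: mult_vec_nth axis_def if_distrib cong: if_cong)
      moreover have "(\<forall>p. p \<noteq> q \<longrightarrow> y p = x p) \<longleftrightarrow> y = x \<or> y = x(q := \<not> x q)" for y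
        by (auto simp: fun_eq_iff)
      moreover have "x \<noteq> x(q := \<not> x q)"
        by (metis fun_upd_same)
      ultimately show ?thesis
        by (auto simp: vec_eq_iff site_nth A_def axis_def)
    qed
    finally show ?thesis .
  qed
  then show ?thesis
    unfolding linked_def by blast
qed

text \<open>Induction on the Hamming distance, with one flipped bit per step.\<close>

lemma linked_all:
  assumes "x \<noteq> y"
  shows "linked x y"
proof -
  have "finite {q. x q \<noteq> y q}"
    by simp
  then show ?thesis
    using assms
  proof (induction "{q. x q \<noteq> y q}" arbitrary: y rule: finite_psubset_induct)
    case psubset
    then obtain q where q: "x q \<noteq> y q"
      by (auto simp: fun_eq_iff)
    let ?y = "y(q := \<not> y q)"
    have "{p. x p \<noteq> ?y p} \<subset> {p. x p \<noteq> y p}"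
      using q by auto
    show ?case
    proof (cases "x = ?y")
      case True
      then show ?thesis
        using linked_sym[OF linked_neighbour[of y q]] by simp
    next
      case False
      then have "linked x ?y"
        using psubset.hyps(2) \<open>{p. x p \<noteq> ?y p} \<subset> {p. x p \<noteq> y p}\<close> by blast
      moreover have "linked ?y y"
        by (rule linked_sym[OF linked_neighbour])
      moreover have "?y \<noteq> y"
        by (metis fun_upd_same)
      ultimately show ?thesis
        using linked_trans False psubset.prems by blast
    qed
  qed
qed

theorem register_all_unitaries: "unitary U \<Longrightarrow> U \<in> \<G>"
  by (rule all_unitaries) (use axes_supported[OF linked_all axis_in_axes finite[of UNIV]] in auto)

end

lemma H_gate_eq: "H_gate = tensor (\<lambda>_. hadamard)"
  by (simp add: H_gate_def hadamard_def)

lemma embed_gate_site: "embed_gate f (tensor (\<lambda>_. A)) = site (f 1) A" for f :: "1 \<Rightarrow> 'q::finite"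
  by (auto simp: vec_eq_iff embed_gate_def site_nth tensor_nth)

lemma exhaust_01: "x = 0 \<or> x = 1" for x :: 2
  using exhaust_2[of x] by auto

lemma range_01: "range f = {f 0, f 1}" for f :: "2 \<Rightarrow> 'a"
proof -
  have "f k \<in> {f 0, f 1}" for k
    using exhaust_01[of k] by auto
  then show ?thesis
    by blast
qed

lemma embed_CNOT_gate:
  fixes f :: "2 \<Rightarrow> 'q::finite"
  assumes "inj f"
  shows "embed_gate f CNOT_gate = permutation_gate (cnot_map (f 0) (f 1))"
proof -
  have "f 0 \<noteq> f 1"
    using assms by (simp add: inj_eq)
  have iff: "(\<forall>q. q \<notin> range f \<longrightarrow> x q = y q) \<and> x (f 0) = y (f 0) \<and> x (f 1) = (y (f 1) \<noteq> y (f 0)) \<longleftrightarrow>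
      x = cnot_map (f 0) (f 1) y" (is "?L \<longleftrightarrow> ?R") for x y :: "'q \<Rightarrow> bool"
  proof
    assume ?L
    then have "x q = cnot_map (f 0) (f 1) y q" for q
      by (cases "q = f 0"; cases "q = f 1") (auto simp: range_01 cnot_map_def)
    then show ?R
      by blast
  next
    assume R: ?R
    show ?L
    proof (intro conjI allI impI)
      show "x q = y q" if "q \<notin> range f" for q
      proof -
        have "q \<noteq> f 1"
          using that by blast
        then show ?thesis
          unfolding R cnot_map_def by (rule fun_upd_other)
      qed
      show "x (f 0) = y (f 0)"
        by (simp only: R cnot_map_def fun_upd_other[OF \<open>f 0 \<noteq> f 1\<close>])
      show "x (f 1) = (y (f 1) \<noteq> y (f 0))"
        by (simp only: R cnot_map_def fun_upd_same)
    qed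
  qed
  have "embed_gate f CNOT_gate $ x $ y =
      (if \<forall>q. q \<notin> range f \<longrightarrow> x q = y q then CNOT_gate $ (x \<circ> f) $ (y \<circ> f) else 0)" for x y
    unfolding embed_gate_def vec_lambda_beta by (rule refl)
  moreover have "CNOT_gate $ a $ b = (if a 0 = b 0 \<and> a 1 = (b 1 \<noteq> b 0) then 1 else 0)" for a b
    unfolding CNOT_gate_def vec_lambda_beta by (rule refl)
  ultimately have "embed_gate f CNOT_gate $ x $ y = permutation_gate (cnot_map (f 0) (f 1)) $ x $ y" for x y
    by (simp only: permutation_gate_nth o_apply if_if_eq_conj iff)
  then show ?thesis
    by (simp only: vec_eq_iff) simp
qed

lemma unitary_closed: "closed {U :: complex ^ 'n ^ 'n. unitary U}"
proof -
  have "continuous_on UNIV (\<lambda>U :: complex ^ 'n ^ 'n. adj U ** U)"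
    by (intro continuous_on_matI) (unfold mult_nth adj_nth, intro continuous_intros)
  then have "closed ((\<lambda>U :: complex ^ 'n ^ 'n. adj U ** U) -` {mat 1})"
    by (simp add: continuous_on_closed_vimage)
  also have "(\<lambda>U :: complex ^ 'n ^ 'n. adj U ** U) -` {mat 1} = {U. unitary U}"
    using unitaryI by (auto simp: unitary_def)
  finally show ?thesis .
qed

text \<open>Continuity of multiplication by a fixed matrix is enough for products: first one factor
  ranges over the closure and the other over \<open>S\<close>, then both over the closure.\<close>

lemma closure_closed_unitary_group:
  fixes S :: "(complex ^ 'n ^ 'n) set"
  assumes unitary: "\<And>U. U \<in> S \<Longrightarrow> unitary U"
    and phase: "\<And>z. cmod z = 1 \<Longrightarrow> cscale z (mat 1) \<in> S"
    and mult: "\<And>U V. U \<in> S \<Longrightarrow> V \<in> S \<Longrightarrow> U ** V \<in> S"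
    and adj: "\<And>U. U \<in> S \<Longrightarrow> adj U \<in> S"
  shows "closed_unitary_group (closure S)"
proof
  show "closed (closure S)"
    by simp
  show "unitary U" if "U \<in> closure S" for U
    using closure_minimal[OF _ unitary_closed, of S] unitary that by blast
  show "cscale z (mat 1) \<in> closure S" if "cmod z = 1" for z
    using phase[OF that] closure_subset by blast
  have cont: "continuous_on UNIV (\<lambda>U. U ** V)" "continuous_on UNIV ((**) V)" "continuous_on UNIV adj"
    for V :: "complex ^ 'n ^ 'n"
    by (intro continuous_on_matI, unfold mult_nth adj_nth, intro continuous_intros)+
  have image: "f U \<in> closure S" if "continuous_on UNIV f" "U \<in> closure S" "\<And>V. V \<in> S \<Longrightarrow> f V \<in> closure S"
    for f :: "complex ^ 'n ^ 'n \<Rightarrow> complex ^ 'n ^ 'n" and U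
    using image_closure_subset[of S f "closure S"] that continuous_on_subset by (metis (no_types, lifting)
        closed_closure image_subset_iff subset_UNIV)
  have 1: "U ** V \<in> closure S" if "U \<in> closure S" "V \<in> S" for U V
    by (rule image[OF cont(1) that(1)]) (use mult[OF _ that(2)] closure_subset in blast)
  show "U ** V \<in> closure S" if "U \<in> closure S" "V \<in> closure S" for U V
    by (rule image[OF cont(2) that(2)]) (rule 1[OF that(1)])
  show "adj U \<in> closure S" if "U \<in> closure S" for U
    by (rule image[OF cont(3) that]) (use adj closure_subset in blast)
qed

theorem clifford_T_universal: "universal_on TYPE('n::finite) {H_gate, S_gate, T_gate} {CNOT_gate}"
proof -
  define \<Gamma> :: "'n oper set" where "\<Gamma> = generated_group {H_gate, S_gate, T_gate} {CNOT_gate}"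
  define S where "S = {cscale z V |z V. cmod z = 1 \<and> V \<in> \<Gamma>}"
  have \<Gamma>_unitary: "unitary U" if "U \<in> \<Gamma>" for U
    using that unfolding \<Gamma>_def
  proof (induction rule: generated_group.induct)
    case (gate1 G f)
    then show ?case
      by (auto simp: H_gate_eq S_gate_def T_gate_def embed_gate_site
          intro!: site_unitary hadamard_unitary phase_gate_unitary)
  next
    case (gate2 G f)
    then have "f 0 \<noteq> f 1"
      by (simp add: inj_eq)
    then show ?case
      using gate2 by (auto simp: embed_CNOT_gate intro!: permutation_gate_unitary inj_cnot_map)
  qed (auto intro: unitary_mult unitary_adj)
  interpret closed_unitary_group "closure S"
  proof (rule closure_closed_unitary_group)
    show "unitary U" if "U \<in> S" for U
      using that by (auto simp: S_def intro: unitary_cscale[OF _ \<Gamma>_unitary])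
    show "cscale z (mat 1) \<in> S" if "cmod z = 1" for z
      using that unfolding S_def \<Gamma>_def by (auto intro: generated_group.one)
    show "U ** V \<in> S" if "U \<in> S" "V \<in> S" for U V
    proof -
      obtain y z U' V' where "U = cscale y U'" "V = cscale z V'" "cmod y = 1" "cmod z = 1"
        "U' \<in> \<Gamma>" "V' \<in> \<Gamma>"
        using \<open>U \<in> S\<close> \<open>V \<in> S\<close> unfolding S_def by blast
      then have "U ** V = cscale (y * z) (U' ** V')" "cmod (y * z) = 1" "U' ** V' \<in> \<Gamma>"
        by (auto simp: cscale_mult_left cscale_mult_right norm_mult \<Gamma>_def mult.commute intro: generated_group.mult)
      then show ?thesis
        unfolding S_def by blast
    qed
    show "adj U \<in> S" if U: "U \<in> S" for U
    proof -
      obtain z V where "U = cscale z V" "cmod z = 1" "V \<in> \<Gamma>"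
        using U unfolding S_def by blast
      then have "adj U = cscale (cnj z) (adj V)" "cmod (cnj z) = 1" "adj V \<in> \<Gamma>"
        by (auto simp: adj_cscale \<Gamma>_def intro: generated_group.inv)
      then show ?thesis
        unfolding S_def by blast
    qed
  qed
  have in_closure: "U \<in> closure S" if "U \<in> \<Gamma>" for U
  proof -
    have "cscale 1 U \<in> S"
      unfolding S_def using that norm_one by blast
    then show ?thesis
      using closure_subset by auto
  qed
  have site: "site q A \<in> closure S" if A: "unitary A" for q A
  proof -
    \<comment> \<open>The one-qubit matrices realizable at \<open>q\<close> themselves form a closed
      group of unitaries, so the one-qubit theorem applies to them.\<close>
    define G1 where "G1 = {A. unitary A \<and> site q A \<in> closure S}"
    have "closed_unitary_group G1"
    proof
      have "continuous_on UNIV (\<lambda>A. site q A $ i $ j)" for i j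
        unfolding site_nth by (cases "\<forall>p. p \<noteq> q \<longrightarrow> i p = j p") (simp_all only: if_P if_False continuous_intros)
      then have "continuous_on UNIV (site q)"
        by (rule continuous_on_matI)
      then have "closed (site q -` closure S)"
        by (simp add: continuous_on_closed_vimage)
      then have "closed ({A. unitary A} \<inter> site q -` closure S)"
        using unitary_closed by (intro closed_Int)
      also have "{A. unitary A} \<inter> site q -` closure S = G1"
        by (auto simp: G1_def)
      finally show "closed G1" .
    qed (auto simp: G1_def site_cscale site_one site_mult[symmetric] adj_site[symmetric]
        intro!: unitary_cscale unitary_mult unitary_adj mult_G adj_G phase_G)
    moreover have gates: "embed_gate (\<lambda>_. q) G \<in> \<Gamma>" if "G \<in> {H_gate, S_gate, T_gate}" for G
      using that unfolding \<Gamma>_def by (rule generated_group.gate1) (simp add: inj_def)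
    have "site q hadamard \<in> \<Gamma>" "site q (phase_gate (cis (pi / 4))) \<in> \<Gamma>"
      using gates[of H_gate] gates[of T_gate] by (simp_all add: H_gate_eq T_gate_def embed_gate_site)
    then have "hadamard \<in> G1" "phase_gate (cis (pi / 4)) \<in> G1"
      by (auto simp: G1_def in_closure hadamard_unitary intro!: phase_gate_unitary)
    ultimately show ?thesis
      using one_qubit_universal[OF _ _ _ A] by (auto simp: G1_def)
  qed
  interpret register_group "closure S"
  proof
    show "permutation_gate (cnot_map p q) \<in> closure S" if "p \<noteq> q" for p q
    proof -
      define f :: "2 \<Rightarrow> 'n" where "f k = (if k = 0 then p else q)" for k
      have "inj f"
        using that exhaust_01 by (auto simp: inj_def f_def split: if_splits)
      then have "embed_gate f CNOT_gate \<in> \<Gamma>"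
        unfolding \<Gamma>_def by (intro generated_group.gate2) auto
      then show ?thesis
        using in_closure embed_CNOT_gate[OF \<open>inj f\<close>] by (simp add: f_def)
    qed
  qed (rule site)
  show ?thesis
    using register_all_unitaries unfolding universal_on_def S_def \<Gamma>_def by blast
qed

section \<open>How errors spread: local operators, circuits, channels and blocks\<close>

section \<open>Local operators\<close>

text \<open>Operators on \<open>A\<close> generated as sums of product operators. Induction over
  this set reduces statements that are linear in the operator to products.\<close>

inductive_set local_ops :: "'q set \<Rightarrow> ('q::finite) oper set" for A :: "'q set"
  where
    tensor: "(\<And>q. q \<notin> A \<Longrightarrow> M q = mat 1) \<Longrightarrow> cscale z (tensor M) \<in> local_ops A"
  | add: "U \<in> local_ops A \<Longrightarrow> V \<in> local_ops A \<Longrightarrow> U + V \<in> local_ops A"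

lemma local_ops_tensor: "(\<And>q. q \<notin> A \<Longrightarrow> M q = mat 1) \<Longrightarrow> tensor M \<in> local_ops A"
  using local_ops.tensor[of A M 1] by simp

lemma local_ops_one: "mat 1 \<in> local_ops A"
  using local_ops_tensor[of A "\<lambda>_. mat 1"] by (simp add: tensor_one)

lemma local_ops_zero: "0 \<in> local_ops A"
  using local_ops.tensor[of A "\<lambda>_. mat 1" 0] by simp

lemma local_ops_sum: "(\<And>i. i \<in> I \<Longrightarrow> U i \<in> local_ops A) \<Longrightarrow> (\<Sum>i\<in>I. U i) \<in> local_ops A"
  by (induction I rule: infinite_finite_induct) (auto intro: local_ops_zero local_ops.add)

lemma local_ops_mono: "U \<in> local_ops A \<Longrightarrow> A \<subseteq> B \<Longrightarrow> U \<in> local_ops B"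
  by (induction rule: local_ops.induct) (auto intro: local_ops.intros)

lemma local_ops_mult:
  assumes "U \<in> local_ops A" "V \<in> local_ops A"
  shows "U ** V \<in> local_ops A"
  using assms(1)
proof induction
  case (tensor M z)
  show ?case
    using assms(2)
  proof induction
    case (tensor N y)
    then show ?case
      using \<open>\<And>q. q \<notin> A \<Longrightarrow> M q = mat 1\<close>
      by (auto simp: cscale_mult_left cscale_mult_right tensor_mult intro!: local_ops.tensor)
  qed (auto simp: matrix_add_ldistrib intro: local_ops.add)
qed (auto simp: matrix_add_rdistrib intro: local_ops.add)

lemma local_ops_adj: "U \<in> local_ops A \<Longrightarrow> adj U \<in> local_ops A"
  by (induction rule: local_ops.induct) (auto simp: adj_cscale adj_tensor adj_add intro: local_ops.intros)

lemma local_ops_commute: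
  assumes "U \<in> local_ops A" "V \<in> local_ops B" "A \<inter> B = {}"
  shows "U ** V = V ** U"
  using assms(1)
proof induction
  case (tensor M z)
  show ?case
    using assms(2)
  proof induction
    case (tensor N y)
    have "M q ** N q = N q ** M q" for q
      using assms(3) \<open>\<And>q. q \<notin> A \<Longrightarrow> M q = mat 1\<close> tensor by (cases "q \<in> A") (simp_all add: disjoint_iff)
    then show ?case
      by (simp add: cscale_mult_left cscale_mult_right tensor_mult mult.commute)
  qed (simp add: matrix_add_ldistrib matrix_add_rdistrib)
qed (simp add: matrix_add_ldistrib matrix_add_rdistrib)

definition matrix_unit :: "bool \<Rightarrow> bool \<Rightarrow> qmat"
  where "matrix_unit c d = (\<chi> a b. if a = c \<and> b = d then 1 else 0)"

lemma matrix_unit_nth [simp]: "matrix_unit c d $ a $ b = (if a = c \<and> b = d then 1 else 0)"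
  by (simp add: matrix_unit_def)

lemma prod_indicator: "finite A \<Longrightarrow> (\<Prod>q\<in>A. if P q then 1 else 0) = (if \<forall>q\<in>A. P q then 1 else (0::complex))"
  by (auto simp: prod_zero_iff)

text \<open>The local matrix is expanded in matrix units, and a matrix unit for several qubits is a
  tensor product of matrix units for one qubit.\<close>

lemma acts_on_local_ops:
  assumes "acts_on A U"
  shows "U \<in> local_ops A"
proof -
  obtain u where u: "\<And>x y. U $ x $ y =
      (if \<forall>q. q \<notin> A \<longrightarrow> x q = y q then u (\<lambda>q. q \<in> A \<and> x q) (\<lambda>q. q \<in> A \<and> y q) else 0)"
    using assms unfolding acts_on_def by blast
  \<comment> \<open>A label of the qubits in \<open>A\<close> is represented by its extension with
    \<open>False\<close>, as in \<open>acts_on\<close>, so that each pair of local labels is counted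
    once.\<close>
  define S where "S = {s. \<forall>q. q \<notin> A \<longrightarrow> \<not> s q}"
  define N where "N s t q = (if q \<in> A then matrix_unit (s q) (t q) else mat 1)" for s t q
  have "U = (\<Sum>s\<in>S. \<Sum>t\<in>S. cscale (u s t) (tensor (N s t)))"
  proof -
    have "(\<Sum>s\<in>S. \<Sum>t\<in>S. cscale (u s t) (tensor (N s t))) $ x $ y = U $ x $ y" for x y
    proof -
      define x' y' where "x' = (\<lambda>q. q \<in> A \<and> x q)" and "y' = (\<lambda>q. q \<in> A \<and> y q)"
      have N: "tensor (N s t) $ x $ y = (if s = x' \<and> t = y' then if \<forall>q. q \<notin> A \<longrightarrow> x q = y q then 1 else 0 else 0)"
        if "s \<in> S" "t \<in> S" for s t
      proof -
        have "tensor (N s t) $ x $ y =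
            (\<Prod>q\<in>UNIV. if (q \<in> A \<longrightarrow> x q = s q \<and> y q = t q) \<and> (q \<notin> A \<longrightarrow> x q = y q) then 1 else 0)"
          unfolding tensor_nth N_def by (intro prod.cong) (auto simp: mat_nth)
        also have "\<dots> = (if \<forall>q. (q \<in> A \<longrightarrow> x q = s q \<and> y q = t q) \<and> (q \<notin> A \<longrightarrow> x q = y q) then 1 else 0)"
          by (subst prod_indicator) auto
        also have "(\<forall>q. (q \<in> A \<longrightarrow> x q = s q \<and> y q = t q) \<and> (q \<notin> A \<longrightarrow> x q = y q)) \<longleftrightarrow>
            (s = x' \<and> t = y') \<and> (\<forall>q. q \<notin> A \<longrightarrow> x q = y q)"
        proof -
          have "s = x' \<longleftrightarrow> (\<forall>q\<in>A. x q = s q)" "t = y' \<longleftrightarrow> (\<forall>q\<in>A. y q = t q)"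
            using that by (auto simp: S_def x'_def y'_def)
          then show ?thesis
            by blast
        qed
        finally show ?thesis
          by (simp only: if_if_eq_conj)
      qed
      have S: "x' \<in> S" "y' \<in> S"
        by (auto simp: S_def x'_def y'_def)
      have "(\<Sum>s\<in>S. \<Sum>t\<in>S. cscale (u s t) (tensor (N s t))) $ x $ y =
          (\<Sum>s\<in>S. \<Sum>t\<in>S. if t = y' then if s = x' then U $ x $ y else 0 else 0)"
        unfolding sum_component by (intro sum.cong refl) (auto simp: N u x'_def y'_def)
      also have "\<dots> = (\<Sum>s\<in>S. if s = x' then U $ x $ y else 0)"
        using S by (subst sum.delta) auto
      also have "\<dots> = U $ x $ y"
        using S by (subst sum.delta) auto
      finally show ?thesis .
    qed
    then show ?thesis
      by (simp add: vec_eq_iff)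
  qed
  also have "\<dots> \<in> local_ops A"
    by (intro local_ops_sum local_ops.tensor) (simp add: N_def)
  finally show ?thesis .
qed

lemma acts_onI:
  assumes "\<And>x y. \<not> (\<forall>q. q \<notin> A \<longrightarrow> x q = y q) \<Longrightarrow> U $ x $ y = 0"
    and "\<And>x y. \<forall>q. q \<notin> A \<longrightarrow> x q = y q \<Longrightarrow> U $ x $ y = U $ (\<lambda>q. q \<in> A \<and> x q) $ (\<lambda>q. q \<in> A \<and> y q)"
  shows "acts_on A U"
  unfolding acts_on_def
proof (intro exI[of _ "\<lambda>a b. U $ a $ b"] allI)
  fix x y
  show "U $ x $ y = (if \<forall>q. q \<notin> A \<longrightarrow> x q = y q
      then U $ (\<lambda>q. q \<in> A \<and> x q) $ (\<lambda>q. q \<in> A \<and> y q) else 0)"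
    using assms[of x y] by presburger
qed

lemma embed_gate_nth:
  "embed_gate f G $ x $ y = of_bool (\<forall>q. q \<notin> range f \<longrightarrow> x q = y q) * G $ (x \<circ> f) $ (y \<circ> f)"
  unfolding embed_gate_def vec_lambda_beta by (cases "\<forall>q. q \<notin> range f \<longrightarrow> x q = y q") simp_all

lemma acts_on_site: "acts_on {q} (site q A)"
  by (rule acts_onI) (auto simp: site_nth)

lemma site_local: "site q A \<in> local_ops {q}"
  by (rule acts_on_local_ops[OF acts_on_site])

lemma acts_on_cnot: "acts_on {p, q} (permutation_gate (cnot_map p q))"
proof (rule acts_onI)
  fix x y :: "'a \<Rightarrow> bool"
  show "permutation_gate (cnot_map p q) $ x $ y = 0" if "\<not> (\<forall>r. r \<notin> {p, q} \<longrightarrow> x r = y r)"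
  proof -
    have "x \<noteq> cnot_map p q y"
    proof
      assume "x = cnot_map p q y"
      then have "\<forall>r. r \<notin> {p, q} \<longrightarrow> x r = y r"
        by (simp add: cnot_map_def)
      then show False
        using that by blast
    qed
    then show ?thesis
      by simp
  qed
  assume *: "\<forall>r. r \<notin> {p, q} \<longrightarrow> x r = y r"
  let ?x = "\<lambda>r. r \<in> {p, q} \<and> x r" and ?y = "\<lambda>r. r \<in> {p, q} \<and> y r"
  have "x r = cnot_map p q y r" "?x r = cnot_map p q ?y r" if "r \<notin> {p, q}" for r
    using * that by (simp_all add: cnot_map_def)
  moreover have "?x r = x r" "cnot_map p q ?y r = cnot_map p q y r" if "r \<in> {p, q}" for r
    using that by (auto simp: cnot_map_def)
  ultimately have "x = cnot_map p q y \<longleftrightarrow> ?x = cnot_map p q ?y"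
    unfolding fun_eq_iff by metis
  then show "permutation_gate (cnot_map p q) $ x $ y = permutation_gate (cnot_map p q) $ ?x $ ?y"
    by (simp only: permutation_gate_nth)
qed

lemma acts_on_diagonal:
  assumes "\<And>x. f x = f (\<lambda>q. q \<in> A \<and> x q)"
  shows "acts_on A (diagonal f)"
proof (rule acts_onI)
  fix x y :: "'a \<Rightarrow> bool"
  show "diagonal f $ x $ y = 0" if "\<not> (\<forall>q. q \<notin> A \<longrightarrow> x q = y q)"
    using that by auto
  assume *: "\<forall>q. q \<notin> A \<longrightarrow> x q = y q"
  have "x = y \<longleftrightarrow> (\<lambda>q. q \<in> A \<and> x q) = (\<lambda>q. q \<in> A \<and> y q)"
    using * by (auto simp: fun_eq_iff)
  then show "diagonal f $ x $ y = diagonal f $ (\<lambda>q. q \<in> A \<and> x q) $ (\<lambda>q. q \<in> A \<and> y q)"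
    unfolding diagonal_nth using assms[of x] by presburger
qed

section \<open>Gates on a part of a register\<close>

definition override :: "('k \<Rightarrow> 'q) \<Rightarrow> ('k \<Rightarrow> bool) \<Rightarrow> ('q \<Rightarrow> bool) \<Rightarrow> 'q \<Rightarrow> bool"
  where "override f a x = (\<lambda>q. if q \<in> range f then a (inv f q) else x q)"

lemma override_comp: "inj f \<Longrightarrow> override f a x \<circ> f = a"
  by (auto simp: override_def)

lemma override_other: "q \<notin> range f \<Longrightarrow> override f a x q = x q"
  by (simp add: override_def)

lemma agree_outside_iff:
  assumes "inj f"
  shows "(\<forall>q. q \<notin> range f \<longrightarrow> x q = y q) \<longleftrightarrow> y = override f (y \<circ> f) x"
  using assms by (auto simp: fun_eq_iff override_def f_inv_into_f)

lemma embed_gate_override: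
  assumes "inj f"
  shows "embed_gate f G $ x $ override f a x = G $ (x \<circ> f) $ a"
  using assms by (simp add: embed_gate_def override_comp override_other)

text \<open>Row \<open>x\<close> of an embedded gate lives on the labels that agree with
  \<open>x\<close> outside the range of \<open>f\<close>, and these are parametrized by their local
  part \<open>a\<close>.\<close>

lemma sum_embed_gate:
  fixes f :: "'k::finite \<Rightarrow> 'q::finite"
  assumes "inj f"
  shows "(\<Sum>y\<in>UNIV. embed_gate f G $ x $ y * h y) = (\<Sum>a\<in>UNIV. G $ (x \<circ> f) $ a * h (override f a x))"
proof -
  have "inj (\<lambda>a. override f a x)"
    by (rule inj_on_inverseI[of _ "\<lambda>y. y \<circ> f"]) (simp add: override_comp assms)
  have "(\<Sum>y\<in>UNIV. embed_gate f G $ x $ y * h y) = (\<Sum>y\<in>range (\<lambda>a. override f a x). embed_gate f G $ x $ y * h y)"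
  proof (rule sum.mono_neutral_right)
    show "\<forall>y\<in>UNIV - range (\<lambda>a. override f a x). embed_gate f G $ x $ y * h y = 0"
    proof
      fix y assume "y \<in> UNIV - range (\<lambda>a. override f a x)"
      then have "\<not> (\<forall>q. q \<notin> range f \<longrightarrow> x q = y q)"
        unfolding agree_outside_iff[OF assms] by blast
      then show "embed_gate f G $ x $ y * h y = 0"
        by (auto simp: embed_gate_def)
    qed
  qed auto
  also have "\<dots> = (\<Sum>a\<in>UNIV. G $ (x \<circ> f) $ a * h (override f a x))"
    using \<open>inj (\<lambda>a. override f a x)\<close> by (subst sum.reindex) (simp_all add: embed_gate_override assms)
  finally show ?thesis .
qed

lemma embed_gate_mult:
  assumes "inj f"
  shows "embed_gate f G ** embed_gate f K = embed_gate f (G ** K)"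
proof -
  have "(embed_gate f G ** embed_gate f K) $ x $ y = embed_gate f (G ** K) $ x $ y" for x y
  proof -
    have "(embed_gate f G ** embed_gate f K) $ x $ y = (\<Sum>a\<in>UNIV. G $ (x \<circ> f) $ a * embed_gate f K $ override f a x $ y)"
      unfolding mult_nth by (rule sum_embed_gate[OF assms])
    moreover have "(\<forall>q. q \<notin> range f \<longrightarrow> override f a x q = y q) \<longleftrightarrow> (\<forall>q. q \<notin> range f \<longrightarrow> x q = y q)" for a
      by (simp add: override_def)
    ultimately show ?thesis
      by (simp add: embed_gate_nth mult_nth override_comp assms sum_distrib_left mult.left_commute)
  qed
  then show ?thesis
    by (simp add: vec_eq_iff)
qed

lemma embed_gate_one:
  fixes f :: "'k::finite \<Rightarrow> 'q::finite"
  assumes "inj f"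
  shows "embed_gate f (mat 1) = mat 1"
proof -
  have "embed_gate f (mat 1) $ x $ y = mat 1 $ x $ y" for x y :: "'q \<Rightarrow> bool"
  proof (cases "x = y")
    case False
    have "x \<circ> f \<noteq> y \<circ> f" if "\<forall>q. q \<notin> range f \<longrightarrow> x q = y q"
    proof
      assume "x \<circ> f = y \<circ> f"
      then have "x q = y q" for q
        using that by (cases "q \<in> range f") (auto dest: fun_cong)
      then show False
        using False by blast
    qed
    then show ?thesis
      using False by (simp add: embed_gate_def mat_nth)
  qed (simp add: embed_gate_def mat_nth)
  then show ?thesis
    by (simp add: vec_eq_iff)
qed

lemma adj_embed_gate: "adj (embed_gate f G) = embed_gate f (adj G)" for f :: "'k::finite \<Rightarrow> 'q::finite"
proof -
  have "adj (embed_gate f G) $ x $ y = embed_gate f (adj G) $ x $ y" for x y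
  proof -
    have "(\<forall>q. q \<notin> range f \<longrightarrow> y q = x q) \<longleftrightarrow> (\<forall>q. q \<notin> range f \<longrightarrow> x q = y q)"
      by auto
    then show ?thesis
      by (cases "\<forall>q. q \<notin> range f \<longrightarrow> x q = y q") (simp_all only: adj_nth embed_gate_nth of_bool_def, simp_all)
  qed
  then show ?thesis
    by (simp only: vec_eq_iff) simp
qed

lemma embed_gate_unitary: "inj f \<Longrightarrow> unitary G \<Longrightarrow> unitary (embed_gate f G)"
  by (simp add: unitary_def adj_embed_gate embed_gate_mult embed_gate_one)

lemma embed_gate_sum: "embed_gate f (\<Sum>i\<in>I. G i) = (\<Sum>i\<in>I. embed_gate f (G i))"
  by (simp add: vec_eq_iff embed_gate_nth sum_distrib_left)

lemma acts_on_embed: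
  fixes f :: "'k::finite \<Rightarrow> 'q::finite"
  assumes "inj f" "acts_on A G"
  shows "acts_on (f ` A) (embed_gate f G)"
proof -
  obtain u where u: "\<And>x y. G $ x $ y =
      (if \<forall>q. q \<notin> A \<longrightarrow> x q = y q then u (\<lambda>q. q \<in> A \<and> x q) (\<lambda>q. q \<in> A \<and> y q) else 0)"
    using assms unfolding acts_on_def by blast
  show ?thesis
  proof (rule acts_onI)
    fix x y :: "'q \<Rightarrow> bool"
    have iff: "(\<forall>q. q \<notin> f ` A \<longrightarrow> x q = y q) \<longleftrightarrow>
        (\<forall>q. q \<notin> range f \<longrightarrow> x q = y q) \<and> (\<forall>q. q \<notin> A \<longrightarrow> (x \<circ> f) q = (y \<circ> f) q)" for x y :: "'q \<Rightarrow> bool"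
    proof (rule iffI; intro conjI allI impI)
      assume *: "\<forall>q. q \<notin> f ` A \<longrightarrow> x q = y q"
      show "x q = y q" if "q \<notin> range f" for q
        using * that by blast
      show "(x \<circ> f) q = (y \<circ> f) q" if "q \<notin> A" for q
        using * that inj_image_mem_iff[OF \<open>inj f\<close>] by simp
    next
      fix q
      assume "(\<forall>q. q \<notin> range f \<longrightarrow> x q = y q) \<and> (\<forall>q. q \<notin> A \<longrightarrow> (x \<circ> f) q = (y \<circ> f) q)" "q \<notin> f ` A"
      then show "x q = y q"
        by (cases "q \<in> range f") auto
    qed
    show "embed_gate f G $ x $ y = 0" if "\<not> (\<forall>q. q \<notin> f ` A \<longrightarrow> x q = y q)"
      using that unfolding iff by (auto simp: embed_gate_def u)
    assume *: "\<forall>q. q \<notin> f ` A \<longrightarrow> x q = y q"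
    have r: "(\<lambda>q. q \<in> A \<and> f q \<in> f ` A \<and> x (f q)) = (\<lambda>q. q \<in> A \<and> x (f q))" for x :: "'q \<Rightarrow> bool"
      by (rule ext) auto
    have "embed_gate f G $ x $ y = u (\<lambda>q. q \<in> A \<and> (x \<circ> f) q) (\<lambda>q. q \<in> A \<and> (y \<circ> f) q)"
      using * unfolding iff by (simp add: embed_gate_def u)
    moreover have "embed_gate f G $ (\<lambda>q. q \<in> f ` A \<and> x q) $ (\<lambda>q. q \<in> f ` A \<and> y q) =
        u (\<lambda>q. q \<in> A \<and> (x \<circ> f) q) (\<lambda>q. q \<in> A \<and> (y \<circ> f) q)"
    proof -
      have "\<forall>q. q \<notin> f ` A \<longrightarrow> (q \<in> f ` A \<and> x q) = (q \<in> f ` A \<and> y q)"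
        by simp
      then show ?thesis
        unfolding iff by (simp add: embed_gate_def u r)
    qed
    ultimately show "embed_gate f G $ x $ y = embed_gate f G $ (\<lambda>q. q \<in> f ` A \<and> x q) $ (\<lambda>q. q \<in> f ` A \<and> y q)"
      by simp
  qed
qed

section \<open>Circuits\<close>

text \<open>The head of a list acts first and therefore ends up rightmost in the product; the
  arbitrary initial matrix is what carries the induction.\<close>

lemma fold_mult: "fold (\<lambda>g U. g ** U) gs V = circuit gs ** V" for V :: "('q::finite) oper"
proof (induction gs arbitrary: V)
  case (Cons g gs)
  show ?case
    unfolding circuit_def by (simp add: Cons.IH[of "g ** V"] Cons.IH[of g] matrix_mul_assoc)
qed (simp add: circuit_def)

lemma circuit_Nil [simp]: "circuit [] = mat 1"
  by (simp add: circuit_def)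

lemma circuit_Cons: "circuit (g # gs) = circuit gs ** g"
  using fold_mult[of gs g] by (simp add: circuit_def)

lemma circuit_append: "circuit (gs @ hs) = circuit hs ** circuit gs"
  by (induction gs) (simp_all add: circuit_Cons matrix_mul_assoc)

lemma circuit_unitary: "(\<And>g. g \<in> set gs \<Longrightarrow> unitary g) \<Longrightarrow> unitary (circuit gs)"
  by (induction gs) (auto simp: circuit_Cons unitary_mult)

lemma circuit_embed: "inj f \<Longrightarrow> circuit (map (embed_gate f) gs) = embed_gate f (circuit gs)"
  by (induction gs) (simp_all add: circuit_Cons embed_gate_mult embed_gate_one)

text \<open>Gates on the set that contains the error conjugate it, and the other gates commute with it.\<close>

lemma circuit_local_ops:
  assumes "disjoint \<A>" "A \<in> \<A>" "E \<in> local_ops A"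
    and "\<And>g. g \<in> set gs \<Longrightarrow> unitary g \<and> (\<exists>B\<in>\<A>. g \<in> local_ops B)"
  obtains E' where "E' \<in> local_ops A" "circuit gs ** E = E' ** circuit gs"
  using assms(3,4)
proof (induction gs arbitrary: E thesis)
  case Nil
  then show ?case
    by auto
next
  case (Cons g gs)
  obtain B where g: "unitary g" "B \<in> \<A>" "g \<in> local_ops B"
    using Cons.prems(3)[of g] by auto
  obtain E1 where E1: "E1 \<in> local_ops A" "g ** E = E1 ** g"
  proof (cases "A = B")
    case True
    have "g ** E ** adj g \<in> local_ops A"
      using g Cons.prems(2) True by (auto intro!: local_ops_mult local_ops_adj)
    moreover have "g ** E = g ** E ** adj g ** g"
      using g(1) by (simp add: matrix_mul_assoc[symmetric] unitary_def)
    ultimately show ?thesis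
      using that by blast
  next
    case False
    then have "A \<inter> B = {}"
      using assms(1,2) g(2) by (auto dest: disjointD)
    then show ?thesis
      using that local_ops_commute Cons.prems(2) g(3) by metis
  qed
  obtain E' where E': "E' \<in> local_ops A" "circuit gs ** E1 = E' ** circuit gs"
    using Cons.IH[OF _ E1(1)] Cons.prems(3) by auto
  have "circuit (g # gs) ** E = circuit gs ** (g ** E)"
    by (simp add: circuit_Cons matrix_mul_assoc)
  also have "\<dots> = E' ** circuit (g # gs)"
    by (simp add: E1(2) E'(2) matrix_mul_assoc circuit_Cons)
  finally show ?case
    using Cons.prems(1) E'(1) by blast
qed

section \<open>Channels in Kraus form\<close>

definition kraus :: "('k::finite \<Rightarrow> complex ^ 'n ^ 'n) \<Rightarrow> complex ^ 'n ^ 'n \<Rightarrow> complex ^ 'n ^ 'n"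
  where "kraus K \<rho> = (\<Sum>k\<in>UNIV. K k ** \<rho> ** adj (K k))"

lemma kraus_add: "kraus K (\<rho> + \<sigma>) = kraus K \<rho> + kraus K \<sigma>"
  by (simp add: kraus_def matrix_add_ldistrib matrix_add_rdistrib sum.distrib)

lemma kraus_cscale: "kraus K (cscale z \<rho>) = cscale z (kraus K \<rho>)"
  by (simp add: kraus_def cscale_mult_left cscale_mult_right cscale_sum)

lemma trace_kraus:
  assumes "(\<Sum>k\<in>UNIV. adj (K k) ** K k) = mat 1"
  shows "trace (kraus K \<rho>) = trace \<rho>"
proof -
  have "trace (K k ** \<rho> ** adj (K k)) = trace ((adj (K k) ** K k) ** \<rho>)" for k
    by (metis trace_mult_comm matrix_mul_assoc)
  then have "trace (kraus K \<rho>) = trace ((\<Sum>k\<in>UNIV. adj (K k) ** K k) ** \<rho>)"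
    by (simp add: kraus_def trace_sum sum_mult_left)
  then show ?thesis
    by (simp add: assms)
qed

lemma cdot_sum_right: "cdot v (\<Sum>i\<in>I. w i) = (\<Sum>i\<in>I. cdot v (w i))"
  by (simp add: cdot_def sum_distrib_left) (rule sum.swap)

lemma nonneg_Reals_sum: "(\<And>i. i \<in> I \<Longrightarrow> f i \<in> \<real>\<^sub>\<ge>\<^sub>0) \<Longrightarrow> sum f I \<in> (\<real>\<^sub>\<ge>\<^sub>0 :: complex set)"
  by (induction I rule: infinite_finite_induct) (auto intro: nonneg_Reals_add_I)

text \<open>For each \<open>k\<close> the Kraus operator moves to the test vectors, where positivity
  of the original block matrix applies.\<close>

lemma kraus_completely_positive: "completely_positive (kraus K)"
  for K :: "'k::finite \<Rightarrow> complex ^ 'n ^ 'n"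
  unfolding completely_positive_def block_positive_def
proof (intro allI impI)
  fix n and A :: "nat \<Rightarrow> nat \<Rightarrow> complex ^ 'n ^ 'n" and v
  assume pos: "\<forall>v. (\<Sum>i<n. \<Sum>j<n. cdot (v i) (A i j *v v j)) \<in> \<real>\<^sub>\<ge>\<^sub>0"
  have "(\<Sum>i<n. \<Sum>j<n. cdot (v i) (kraus K (A i j) *v v j)) =
      (\<Sum>i<n. \<Sum>j<n. \<Sum>k\<in>UNIV. cdot (adj (K k) *v v i) (A i j *v (adj (K k) *v v j)))"
    by (simp add: kraus_def sum_mult_vec cdot_sum_right cdot_adj[symmetric, of "adj _", simplified]
        matrix_vector_mul_assoc matrix_mul_assoc)
  also have "\<dots> = (\<Sum>i<n. \<Sum>k\<in>UNIV. \<Sum>j<n. cdot (adj (K k) *v v i) (A i j *v (adj (K k) *v v j)))"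
    by (intro sum.cong refl sum.swap)
  also have "\<dots> = (\<Sum>k\<in>UNIV. \<Sum>i<n. \<Sum>j<n. cdot (adj (K k) *v v i) (A i j *v (adj (K k) *v v j)))"
    by (rule sum.swap)
  also have "\<dots> \<in> \<real>\<^sub>\<ge>\<^sub>0"
  proof (rule nonneg_Reals_sum)
    fix k
    show "(\<Sum>i<n. \<Sum>j<n. cdot (adj (K k) *v v i) (A i j *v (adj (K k) *v v j))) \<in> \<real>\<^sub>\<ge>\<^sub>0"
      using spec[OF pos, of "\<lambda>i. adj (K k) *v v i"] .
  qed
  finally show "(\<Sum>i<n. \<Sum>j<n. cdot (v i) (kraus K (A i j) *v v j)) \<in> \<real>\<^sub>\<ge>\<^sub>0" .
qed

lemma kraus_quantum_channel:
  "(\<Sum>k\<in>UNIV. adj (K k) ** K k) = mat 1 \<Longrightarrow> quantum_channel (kraus K)"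
  by (simp add: quantum_channel_def kraus_add kraus_cscale kraus_completely_positive trace_kraus)

section \<open>Blocks of qubits\<close>

text \<open>The encoding of several blocks with a separate map for each block. It describes states
  in which some blocks are damaged or already recovered and others are not.\<close>

definition block_tensor ::
    "('r::finite \<Rightarrow> complex ^ bool ^ ('q::finite \<Rightarrow> bool)) \<Rightarrow> complex ^ ('r \<Rightarrow> bool) ^ ('r \<times> 'q \<Rightarrow> bool)"
  where "block_tensor N = (\<chi> x a. \<Prod>i\<in>UNIV. N i $ (\<lambda>q. x (i, q)) $ a i)"

lemma block_tensor_nth: "block_tensor N $ x $ a = (\<Prod>i\<in>UNIV. N i $ (\<lambda>q. x (i, q)) $ a i)"
  by (simp add: block_tensor_def)

lemma encode_blocks_eq: "encode_blocks V = block_tensor (\<lambda>_. V)"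
  by (simp add: encode_blocks_def block_tensor_def)

lemma sum_blocks:
  fixes F :: "('r::finite \<Rightarrow> 'q::finite \<Rightarrow> bool) \<Rightarrow> complex"
  shows "(\<Sum>x\<in>UNIV. F (\<lambda>i q. x (i, q))) = (\<Sum>g\<in>UNIV. F g)"
  by (rule sum.reindex_bij_witness[of _ case_prod "\<lambda>x i q. x (i, q)"]) auto

lemma tensor_block_tensor:
  "tensor M ** block_tensor N = block_tensor (\<lambda>i. tensor (\<lambda>q. M (i, q)) ** N i)"
proof -
  have "(tensor M ** block_tensor N) $ x $ a = block_tensor (\<lambda>i. tensor (\<lambda>q. M (i, q)) ** N i) $ x $ a" for x a
  proof -
    have "(\<Prod>p\<in>UNIV. M p $ x p $ u p) = (\<Prod>i\<in>UNIV. tensor (\<lambda>q. M (i, q)) $ (\<lambda>q. x (i, q)) $ (\<lambda>q. u (i, q)))" for u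
      unfolding tensor_nth by (simp add: prod.cartesian_product UNIV_Times_UNIV[symmetric] del: UNIV_Times_UNIV)
    then have "(tensor M ** block_tensor N) $ x $ a =
        (\<Sum>u\<in>UNIV. \<Prod>i\<in>UNIV. tensor (\<lambda>q. M (i, q)) $ (\<lambda>q. x (i, q)) $ (\<lambda>q. u (i, q)) * N i $ (\<lambda>q. u (i, q)) $ a i)"
      by (simp add: mult_nth tensor_nth[of M] block_tensor_nth prod.distrib)
    also have "\<dots> = (\<Sum>g\<in>UNIV. \<Prod>i\<in>UNIV. tensor (\<lambda>q. M (i, q)) $ (\<lambda>q. x (i, q)) $ g i * N i $ g i $ a i)"
      by (rule sum_blocks)
    finally show ?thesis
      by (simp add: block_tensor_nth mult_nth prod_sum_fun)
  qed
  then show ?thesis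
    by (simp add: vec_eq_iff)
qed

lemma block_tensor_mult_tensor: "block_tensor N ** tensor g = block_tensor (\<lambda>i. N i ** g i)"
  by (simp add: vec_eq_iff mult_nth block_tensor_nth tensor_nth prod.distrib[symmetric] prod_sum_fun)

lemma adj_block_tensor_mult: "adj (block_tensor N) ** block_tensor N' = tensor (\<lambda>i. adj (N i) ** N' i)"
proof -
  have "(adj (block_tensor N) ** block_tensor N') $ a $ b = tensor (\<lambda>i. adj (N i) ** N' i) $ a $ b" for a b
  proof -
    have "(adj (block_tensor N) ** block_tensor N') $ a $ b =
        (\<Sum>u\<in>UNIV. \<Prod>i\<in>UNIV. cnj (N i $ (\<lambda>q. u (i, q)) $ a i) * N' i $ (\<lambda>q. u (i, q)) $ b i)"
      by (simp add: mult_nth block_tensor_nth prod.distrib)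
    also have "\<dots> = (\<Sum>g\<in>UNIV. \<Prod>i\<in>UNIV. cnj (N i $ g i $ a i) * N' i $ g i $ b i)"
      by (rule sum_blocks)
    finally show ?thesis
      by (simp add: tensor_nth mult_nth prod_sum_fun)
  qed
  then show ?thesis
    by (simp add: vec_eq_iff)
qed

lemma inj_Pair: "inj (Pair i)"
  by (simp add: inj_def)

lemma override_Pair: "override (Pair i) a x (j, q) = (if j = i then a q else x (j, q))"
proof (cases "j = i")
  case True
  then have "override (Pair i) a x (j, q) = (override (Pair i) a x \<circ> Pair i) q"
    by simp
  then show ?thesis
    using True override_comp[OF inj_Pair] by metis
qed (auto simp: override_def)

lemma embed_block_tensor: "embed_gate (Pair i) U ** block_tensor N = block_tensor (N(i := U ** N i))"
proof -
  have "(embed_gate (Pair i) U ** block_tensor N) $ x $ a = block_tensor (N(i := U ** N i)) $ x $ a" for x a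
  proof -
    have "(embed_gate (Pair i) U ** block_tensor N) $ x $ a =
        (\<Sum>c\<in>UNIV. U $ (x \<circ> Pair i) $ c * block_tensor N $ override (Pair i) c x $ a)"
      unfolding mult_nth by (rule sum_embed_gate[OF inj_Pair])
    also have "\<dots> = (\<Sum>c\<in>UNIV. U $ (\<lambda>q. x (i, q)) $ c * N i $ c $ a i) * (\<Prod>j\<in>UNIV - {i}. N j $ (\<lambda>q. x (j, q)) $ a j)"
    proof -
      have "block_tensor N $ override (Pair i) c x $ a =
          N i $ c $ a i * (\<Prod>j\<in>UNIV - {i}. N j $ (\<lambda>q. x (j, q)) $ a j)" for c
        unfolding block_tensor_nth by (subst prod.remove[of _ i]) (auto simp: override_Pair intro!: prod.cong)
      then show ?thesis
        by (simp add: sum_distrib_right mult.assoc comp_def)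
    qed
    also have "\<dots> = block_tensor (N(i := U ** N i)) $ x $ a"
      unfolding block_tensor_nth by (subst (2) prod.remove[of _ i]) (auto simp: mult_nth)
    finally show ?thesis .
  qed
  then show ?thesis
    by (simp add: vec_eq_iff)
qed

lemma block_tensor_cscale:
  "block_tensor (N(i := cscale z A)) = cscale z (block_tensor (N(i := A)))"
proof -
  have "block_tensor (N(i := cscale z A)) $ x $ a = z * block_tensor (N(i := A)) $ x $ a" for x a
    unfolding block_tensor_nth by (subst (1 2) prod.remove[of _ i]) auto
  then show ?thesis
    by (simp add: vec_eq_iff)
qed

text \<open>Extending a channel by reading off partial matrices is the same as embedding its Kraus
  operators, so that recovery can be computed with matrix products.\<close>

lemma on_block_kraus: "on_block i (kraus K) = kraus (\<lambda>k. embed_gate (Pair i) (K k))"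
proof -
  have set_block: "set_block i a x = override (Pair i) a x" for a x
    by (auto simp: set_block_def fun_eq_iff override_Pair)
  have "on_block i (kraus K) \<rho> $ x $ y = kraus (\<lambda>k. embed_gate (Pair i) (K k)) \<rho> $ x $ y" for \<rho> x y
  proof -
    have "(embed_gate (Pair i) (K k) ** \<rho> ** adj (embed_gate (Pair i) (K k))) $ x $ y =
        (K k ** (\<chi> a b. \<rho> $ set_block i a x $ set_block i b y) ** adj (K k)) $ (\<lambda>q. x (i, q)) $ (\<lambda>q. y (i, q))" for k
    proof -
      let ?B = "embed_gate (Pair i) (K k)"
      have "(?B ** \<rho>) $ x $ v = (\<Sum>a\<in>UNIV. K k $ (x \<circ> Pair i) $ a * \<rho> $ override (Pair i) a x $ v)" for v
        unfolding mult_nth by (rule sum_embed_gate[OF inj_Pair])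
      moreover have "(?B ** \<rho> ** adj ?B) $ x $ y = cnj (\<Sum>v\<in>UNIV. ?B $ y $ v * cnj ((?B ** \<rho>) $ x $ v))"
        unfolding mult_nth[of "?B ** \<rho>"] by (simp add: mult.commute)
      then have "(?B ** \<rho> ** adj ?B) $ x $ y =
          cnj (\<Sum>b\<in>UNIV. K k $ (y \<circ> Pair i) $ b * cnj ((?B ** \<rho>) $ x $ override (Pair i) b y))"
        unfolding sum_embed_gate[OF inj_Pair] .
      ultimately show ?thesis
        by (simp add: mult_nth set_block comp_def mult.commute)
    qed
    then show ?thesis
      by (simp add: on_block_def kraus_def)
  qed
  then show ?thesis
    by (simp add: fun_eq_iff vec_eq_iff)
qed

section \<open>Errors on one qubit\<close>

lemma sum_site: "(\<Sum>y\<in>UNIV. site p A $ x $ y * h y) = (\<Sum>c\<in>UNIV. A $ x p $ c * h (x(p := c)))"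
proof -
  have agree: "(\<forall>q. q \<noteq> p \<longrightarrow> x q = y q) \<longleftrightarrow> y \<in> range (\<lambda>c. x(p := c))" for y
  proof
    assume "\<forall>q. q \<noteq> p \<longrightarrow> x q = y q"
    then have "y = x(p := y p)"
      by (intro ext) auto
    then show "y \<in> range (\<lambda>c. x(p := c))"
      by blast
  qed auto
  have inj: "inj (\<lambda>c. x(p := c))"
    by (rule inj_on_inverseI[of _ "\<lambda>y. y p"]) simp
  have "(\<Sum>y\<in>UNIV. site p A $ x $ y * h y) = (\<Sum>y\<in>range (\<lambda>c. x(p := c)). A $ x p $ y p * h y)"
    unfolding site_nth agree by (rule sum.mono_neutral_cong_right) auto
  also have "\<dots> = (\<Sum>c\<in>UNIV. A $ x p $ c * h (x(p := c)))"
    by (simp add: sum.reindex[OF inj])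
  finally show ?thesis .
qed

lemma channel_linear:
  assumes "quantum_channel \<E>"
  shows "\<E> (A + B) = \<E> A + \<E> B" "\<E> (cscale z A) = cscale z (\<E> A)" "trace (\<E> A) = trace A"
  using assms unfolding quantum_channel_def by auto

lemma channel_sum:
  assumes "quantum_channel \<E>"
  shows "\<E> (\<Sum>i\<in>I. A i) = (\<Sum>i\<in>I. \<E> (A i))"
proof -
  have "\<E> 0 = 0"
    using channel_linear(2)[OF assms, of 0 0] by simp
  then show ?thesis
    by (induction I rule: infinite_finite_induct) (simp_all add: channel_linear(1)[OF assms])
qed

lemma matrix_unit_expansion: "A = (\<Sum>c\<in>UNIV. \<Sum>d\<in>UNIV. cscale (A $ c $ d) (matrix_unit c d))"
proof -
  have "A $ a $ b = (\<Sum>c\<in>UNIV. \<Sum>d\<in>UNIV. cscale (A $ c $ d) (matrix_unit c d)) $ a $ b" for a b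
    by (cases a; cases b) (simp_all add: UNIV_bool)
  then show ?thesis
    unfolding vec_eq_iff by blast
qed

lemma channel_expansion:
  assumes "quantum_channel \<E>"
  shows "\<E> A = (\<Sum>c\<in>UNIV. \<Sum>d\<in>UNIV. cscale (A $ c $ d) (\<E> (matrix_unit c d)))"
  using arg_cong[OF matrix_unit_expansion, of \<E> A]
  by (simp add: channel_sum[OF assms] channel_linear(2)[OF assms])

text \<open>By linearity the channel is determined by the images of the four matrix units. The left
  and right factors of a term may differ, which is why the recovery lemmas below treat two
  independent error operators.\<close>

lemma on_qubit_expansion:
  assumes "quantum_channel \<E>"
  shows "on_qubit p \<E> \<rho> = (\<Sum>c\<in>UNIV. \<Sum>d\<in>UNIV. \<Sum>a\<in>UNIV. \<Sum>b\<in>UNIV. cscale (\<E> (matrix_unit c d) $ a $ b)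
    (site p (matrix_unit a c) ** \<rho> ** adj (site p (matrix_unit b d))))" (is "_ = ?R")
proof -
  have "on_qubit p \<E> \<rho> $ x $ y = ?R $ x $ y" for x y
  proof -
    have "(site p (matrix_unit a c) ** \<rho> ** adj (site p (matrix_unit b d))) $ x $ y =
        (if a = x p \<and> b = y p then \<rho> $ (x(p := c)) $ (y(p := d)) else 0)" for a b c d
    proof -
      have 1: "(site p (matrix_unit a c) ** \<rho>) $ x $ v = (if a = x p then \<rho> $ (x(p := c)) $ v else 0)" for v
        unfolding mult_nth sum_site by (cases c) (auto simp: UNIV_bool)
      have 2: "(\<rho>' ** adj (site p (matrix_unit b d))) $ x $ y = (if b = y p then \<rho>' $ x $ (y(p := d)) else 0)" for \<rho>'
      proof -
        have "(\<rho>' ** adj (site p (matrix_unit b d))) $ x $ y =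
            cnj (\<Sum>v\<in>UNIV. site p (matrix_unit b d) $ y $ v * cnj (\<rho>' $ x $ v))"
          unfolding mult_nth by (simp add: mult.commute)
        then show ?thesis
          unfolding sum_site by (cases d) (auto simp: UNIV_bool)
      qed
      show ?thesis
        unfolding 2 1 by simp
    qed
    then have "?R $ x $ y = (\<Sum>c\<in>UNIV. \<Sum>d\<in>UNIV. \<Sum>a\<in>UNIV. \<Sum>b\<in>UNIV. \<E> (matrix_unit c d) $ a $ b *
        (if a = x p \<and> b = y p then \<rho> $ (x(p := c)) $ (y(p := d)) else 0))"
      by simp
    also have "\<dots> = (\<Sum>c\<in>UNIV. \<Sum>d\<in>UNIV. \<E> (matrix_unit c d) $ x p $ y p * \<rho> $ (x(p := c)) $ (y(p := d)))"
      by (intro sum.cong refl) (cases "x p"; cases "y p"; simp add: UNIV_bool)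
    also have "\<dots> = on_qubit p \<E> \<rho> $ x $ y"
      unfolding on_qubit_def vec_lambda_beta channel_expansion[OF assms, of "vec_lambda _"]
      by (simp add: mult.commute)
    finally show ?thesis ..
  qed
  then show ?thesis
    by (simp add: vec_eq_iff)
qed

text \<open>By cyclicity only the terms with equal \<open>a\<close> and \<open>b\<close> survive,
  and their coefficients add up to the traces of the images of matrix units.\<close>

lemma trace_on_qubit:
  assumes "quantum_channel \<E>"
  shows "trace (on_qubit p \<E> \<rho>) = trace \<rho>"
proof -
  have "trace (site p (matrix_unit a c) ** \<rho> ** adj (site p (matrix_unit b d))) =
      (if a = b then trace (site p (matrix_unit d c) ** \<rho>) else 0)" for a b c d
  proof -
    have "adj (matrix_unit b d) ** matrix_unit a c = (if a = b then matrix_unit d c else 0)"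
      by (cases a; cases b; simp add: vec_eq_iff mult_nth UNIV_bool)
    moreover have "site p 0 = 0"
      using site_cscale[of p 0 0] by simp
    ultimately have "adj (site p (matrix_unit b d)) ** site p (matrix_unit a c) =
        (if a = b then site p (matrix_unit d c) else 0)"
      by (simp add: adj_site site_mult)
    moreover have "trace (site p (matrix_unit a c) ** \<rho> ** adj (site p (matrix_unit b d))) =
        trace (adj (site p (matrix_unit b d)) ** site p (matrix_unit a c) ** \<rho>)"
      by (metis trace_mult_comm matrix_mul_assoc)
    ultimately show ?thesis
      by (simp add: trace_def)
  qed
  then have "trace (on_qubit p \<E> \<rho>) = (\<Sum>c\<in>UNIV. \<Sum>d\<in>UNIV. \<Sum>a\<in>UNIV. \<Sum>b\<in>UNIV.
      \<E> (matrix_unit c d) $ a $ b * (if a = b then trace (site p (matrix_unit d c) ** \<rho>) else 0))"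
    by (simp add: on_qubit_expansion[OF assms] trace_sum trace_cscale)
  also have "\<dots> = (\<Sum>c\<in>UNIV. \<Sum>d\<in>UNIV. trace (\<E> (matrix_unit c d)) * trace (site p (matrix_unit d c) ** \<rho>))"
    by (simp add: UNIV_bool trace_def algebra_simps)
  also have "\<dots> = trace (site p (matrix_unit False False) ** \<rho>) + trace (site p (matrix_unit True True) ** \<rho>)"
    unfolding channel_linear(3)[OF assms] by (simp add: UNIV_bool trace_def)
  also have "\<dots> = trace ((site p (matrix_unit False False) + site p (matrix_unit True True)) ** \<rho>)"
    by (simp add: matrix_add_rdistrib trace_add)
  also have "site p (matrix_unit False False) + site p (matrix_unit True True) = site p (mat 1)"
    by (auto simp: vec_eq_iff site_nth mat_nth)
  finally show ?thesis
    by (simp add: site_one)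
qed

section \<open>A criterion for error correction and fault tolerance\<close>

section \<open>Fault tolerance from correctable sets of qubits\<close>

text \<open>The factor may depend on the Kraus operator but not on the encoded state: the syndrome
  reveals nothing about the logical qubit. The condition is linear in \<open>X\<close>.\<close>

definition recovers :: "('k::finite \<Rightarrow> 'q oper) \<Rightarrow> complex ^ bool ^ ('q::finite \<Rightarrow> bool) \<Rightarrow>
    complex ^ bool ^ ('q \<Rightarrow> bool) \<Rightarrow> bool"
  where "recovers K Q X \<longleftrightarrow> (\<forall>k. \<exists>l. K k ** X = cscale l Q)"

text \<open>Only product errors are tested; \<open>correctable_local_ops\<close> extends this to
  every operator on the set by linearity.\<close>

definition correctable :: "('k::finite \<Rightarrow> 'q oper) \<Rightarrow> complex ^ bool ^ ('q::finite \<Rightarrow> bool) \<Rightarrow> 'q set \<Rightarrow> bool"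
  where "correctable K Q A \<longleftrightarrow> (\<forall>M. (\<forall>q. q \<notin> A \<longrightarrow> M q = mat 1) \<longrightarrow> recovers K Q (tensor M ** Q))"

lemma recovers_cscale: "recovers K Q X \<Longrightarrow> recovers K Q (cscale z X)"
  unfolding recovers_def cscale_mult_right by (metis cscale_cscale)

lemma recovers_add: "recovers K Q X \<Longrightarrow> recovers K Q Y \<Longrightarrow> recovers K Q (X + Y)"
  unfolding recovers_def matrix_add_ldistrib by (metis cscale_add_left)

lemma correctable_mono: "correctable K Q A \<Longrightarrow> B \<subseteq> A \<Longrightarrow> correctable K Q B"
  unfolding correctable_def by blast

lemma correctable_local_ops:
  assumes "correctable K Q A" "E \<in> local_ops A"
  shows "recovers K Q (E ** Q)"
  using assms(2)
proof induction
  case (tensor M z)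
  then show ?case
    using assms(1) by (simp add: cscale_mult_left recovers_cscale correctable_def)
qed (simp add: matrix_add_rdistrib recovers_add)

lemma kraus_sandwich:
  "kraus K (X ** \<sigma> ** adj Y) = (\<Sum>k\<in>UNIV. (K k ** X) ** \<sigma> ** adj (K k ** Y))"
  by (simp add: kraus_def adj_mult matrix_mul_assoc)

lemma kraus_recovers:
  assumes "recovers K Q X" "recovers K Q Y"
  shows "\<exists>l. kraus K (X ** \<sigma> ** adj Y) = cscale l (Q ** \<sigma> ** adj Q)"
proof -
  obtain l m where "\<And>k. K k ** X = cscale (l k) Q" "\<And>k. K k ** Y = cscale (m k) Q"
    using assms unfolding recovers_def by metis
  then have "kraus K (X ** \<sigma> ** adj Y) = cscale (\<Sum>k\<in>UNIV. l k * cnj (m k)) (Q ** \<sigma> ** adj Q)"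
    by (simp add: kraus_sandwich cscale_mult_left cscale_mult_right adj_cscale cscale_sum_left mult.commute)
  then show ?thesis
    by blast
qed

lemma on_block_recovers:
  assumes "recovers K Q (N i)" "recovers K Q (N' i)"
  shows "\<exists>l. on_block i (kraus K) (block_tensor N ** \<sigma> ** adj (block_tensor N')) =
    cscale l (block_tensor (N(i := Q)) ** \<sigma> ** adj (block_tensor (N'(i := Q))))"
proof -
  obtain l m where "\<And>k. K k ** N i = cscale (l k) Q" "\<And>k. K k ** N' i = cscale (m k) Q"
    using assms unfolding recovers_def by metis
  then have "on_block i (kraus K) (block_tensor N ** \<sigma> ** adj (block_tensor N')) =
      cscale (\<Sum>k\<in>UNIV. l k * cnj (m k)) (block_tensor (N(i := Q)) ** \<sigma> ** adj (block_tensor (N'(i := Q))))"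
    by (simp add: on_block_kraus kraus_sandwich embed_block_tensor block_tensor_cscale
        cscale_mult_left cscale_mult_right adj_cscale cscale_sum_left mult.commute)
  then show ?thesis
    by blast
qed

lemma fold_on_block_add:
  "fold (\<lambda>i. on_block i (kraus K)) is (\<rho> + \<sigma>) =
    fold (\<lambda>i. on_block i (kraus K)) is \<rho> + fold (\<lambda>i. on_block i (kraus K)) is \<sigma>"
  by (induction "is" arbitrary: \<rho> \<sigma>) (simp_all add: on_block_kraus kraus_add)

lemma fold_on_block_cscale:
  "fold (\<lambda>i. on_block i (kraus K)) is (cscale z \<rho>) = cscale z (fold (\<lambda>i. on_block i (kraus K)) is \<rho>)"
  by (induction "is" arbitrary: \<rho>) (simp_all add: on_block_kraus kraus_cscale)

lemma fold_on_block_trace: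
  assumes "(\<Sum>k\<in>UNIV. adj (K k) ** K k) = mat 1"
  shows "trace (fold (\<lambda>i. on_block i (kraus K)) is \<rho>) = trace \<rho>"
proof (induction "is" arbitrary: \<rho>)
  case (Cons i "is")
  have "(\<Sum>k\<in>UNIV. adj (embed_gate (Pair i) (K k)) ** embed_gate (Pair i) (K k)) = mat 1"
    by (simp add: adj_embed_gate embed_gate_mult inj_Pair embed_gate_sum[symmetric] assms embed_gate_one)
  then show ?case
    by (simp only: fold_Cons o_apply Cons.IH on_block_kraus[of i] trace_kraus)
qed simp

text \<open>During the fold the treated blocks carry \<open>Q\<close> and the others still carry
  their damage. The first assumption keeps the induction hypothesis applicable to blocks that
  already carry \<open>Q\<close>.\<close>

lemma fold_on_block_recovers:
  assumes "recovers K Q Q" "\<And>i. recovers K Q (N i)" "\<And>i. recovers K Q (N' i)"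
  shows "\<exists>l. fold (\<lambda>i. on_block i (kraus K)) is (block_tensor N ** \<sigma> ** adj (block_tensor N')) =
    cscale l (block_tensor (\<lambda>i. if i \<in> set is then Q else N i) ** \<sigma> **
      adj (block_tensor (\<lambda>i. if i \<in> set is then Q else N' i)))"
  using assms(2,3)
proof (induction "is" arbitrary: N N')
  case Nil
  show ?case
    by (rule exI[of _ 1]) simp
next
  case (Cons i "is")
  obtain l where l: "on_block i (kraus K) (block_tensor N ** \<sigma> ** adj (block_tensor N')) =
      cscale l (block_tensor (N(i := Q)) ** \<sigma> ** adj (block_tensor (N'(i := Q))))"
    using on_block_recovers[where N = N and N' = N' and i = i] Cons.prems by blast
  obtain m where m: "fold (\<lambda>i. on_block i (kraus K)) is
      (block_tensor (N(i := Q)) ** \<sigma> ** adj (block_tensor (N'(i := Q)))) =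
      cscale m (block_tensor (\<lambda>j. if j \<in> set is then Q else (N(i := Q)) j) ** \<sigma> **
        adj (block_tensor (\<lambda>j. if j \<in> set is then Q else (N'(i := Q)) j)))"
    using Cons.IH[of "N(i := Q)" "N'(i := Q)"] Cons.prems assms(1) by fastforce
  have "(\<lambda>j. if j \<in> set is then Q else (N(i := Q)) j) = (\<lambda>j. if j \<in> set (i # is) then Q else N j)" for N
    by auto
  then show ?case
    using m by (intro exI[of _ "l * m"]) (simp add: l fold_on_block_cscale)
qed

text \<open>By linearity in each of the two errors both may be taken as product operators, and these
  factor into one error per block, each confined to the correctable set \<open>A\<close>. So damage
  in all blocks at once is recovered block by block.\<close>

lemma on_all_blocks_recovers:
  fixes Q :: "complex ^ bool ^ ('q::finite \<Rightarrow> bool)" and E E' :: "('r::enum \<times> 'q) oper"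
  assumes correctable: "correctable K Q A"
    and "E \<in> local_ops (UNIV \<times> A)" "E' \<in> local_ops (UNIV \<times> A)"
  shows "\<exists>l. on_all_blocks (kraus K) ((E ** encode_blocks Q) ** \<sigma> ** adj (E' ** encode_blocks Q)) =
    cscale l (encode_blocks Q ** \<sigma> ** adj (encode_blocks Q))" (is "?P E E'")
proof -
  have Q: "recovers K Q Q"
    using correctable_local_ops[OF correctable local_ops_one] by simp
  have sum: "\<exists>l. on_all_blocks (kraus K) (\<rho> + \<rho>') = cscale l \<tau>"
    if "\<exists>l. on_all_blocks (kraus K) \<rho> = cscale l \<tau>" "\<exists>l. on_all_blocks (kraus K) \<rho>' = cscale l \<tau>"
    for \<rho> \<rho>' \<tau> :: "('r \<times> 'q) oper"
    using that unfolding on_all_blocks_def fold_on_block_add by (metis cscale_add_left)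
  show ?thesis
    using assms(2)
  proof induction
    case (tensor M z)
    note M = tensor
    show ?case
      using assms(3)
    proof induction
      case (tensor M' z')
      define N where "N M = (\<lambda>i. Defs.tensor (\<lambda>q. M (i, q)) ** Q)" for M :: "'r \<times> 'q \<Rightarrow> qmat"
      have eq: "(cscale z (Defs.tensor M) ** encode_blocks Q) ** \<sigma> ** adj (cscale z' (Defs.tensor M') ** encode_blocks Q) =
          cscale (z * cnj z') (block_tensor (N M) ** \<sigma> ** adj (block_tensor (N M')))"
        by (simp add: encode_blocks_eq tensor_block_tensor N_def cscale_mult_left cscale_mult_right adj_cscale mult.commute)
      have "recovers K Q (N M i)" "recovers K Q (N M' i)" for i
        using correctable M tensor unfolding correctable_def N_def by auto
      then obtain l where "on_all_blocks (kraus K) (block_tensor (N M) ** \<sigma> ** adj (block_tensor (N M'))) =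
          cscale l (encode_blocks Q ** \<sigma> ** adj (encode_blocks Q))"
        using fold_on_block_recovers[OF Q, of "N M" "N M'" Enum.enum \<sigma>]
        unfolding on_all_blocks_def encode_blocks_eq enum_UNIV by auto
      then show ?case
        unfolding eq by (auto simp: on_all_blocks_def fold_on_block_cscale)
    next
      case (add U V)
      then show ?case
        by (simp add: matrix_add_rdistrib adj_add matrix_add_ldistrib sum)
    qed
  next
    case (add U V)
    then show ?case
      by (simp add: matrix_add_rdistrib sum)
  qed
qed

lemma pure_state_mult_vec: "pure_state (U *v w) = U ** pure_state w ** adj U"
  by (rule pure_state_unitary[symmetric])

lemma trace_isometry:
  assumes "adj X ** X = mat 1"
  shows "trace (X ** \<sigma> ** adj X) = trace \<sigma>"
proof -
  have "trace (X ** \<sigma> ** adj X) = trace (adj X ** X ** \<sigma>)"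
    by (metis trace_mult_comm matrix_mul_assoc)
  then show ?thesis
    by (simp add: assms)
qed

lemma trace_pure_state: "norm \<psi> = 1 \<Longrightarrow> trace (pure_state \<psi>) = 1"
  by (simp add: trace_def norm_eq_1_iff cdot_def mult.commute)

lemma cscale_sandwich: "cmod z = 1 \<Longrightarrow> cscale z X ** \<sigma> ** adj (cscale z Y) = X ** \<sigma> ** adj Y"
  by (simp add: cscale_mult_left cscale_mult_right adj_cscale complex_norm_square[symmetric] mult.commute[of "cnj z"])

lemma encode_blocks_isometry: "adj Q ** Q = mat 1 \<Longrightarrow> adj (encode_blocks Q) ** encode_blocks Q = mat 1"
  by (simp add: encode_blocks_eq adj_block_tensor_mult tensor_one)

text \<open>The error is pushed through the remaining gates, where it stays on the same class of
  qubits; recovery then returns a multiple of the ideal output, and the trace shows that the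
  multiple is 1.\<close>

theorem fault_tolerantI:
  fixes Q :: "complex ^ bool ^ ('q::finite \<Rightarrow> bool)" and G :: "('r::enum) oper"
    and gs :: "('r \<times> 'q) oper list"
  assumes isometry: "adj Q ** Q = mat 1"
    and complete: "(\<Sum>k\<in>UNIV. adj (K k) ** K k) = mat 1"
    and disjoint: "disjoint \<A>" and cover: "\<Union>\<A> = UNIV"
    and correctable: "\<And>A. A \<in> \<A> \<Longrightarrow> correctable K Q A"
    and gates: "\<And>g. g \<in> set gs \<Longrightarrow> unitary g \<and> (\<exists>B. card B \<le> 3 \<and> acts_on B g \<and> (\<exists>A\<in>\<A>. B \<subseteq> UNIV \<times> A))"
    and z: "cmod z = 1" and circuit: "circuit gs ** encode_blocks Q = cscale z (encode_blocks Q ** G)"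
  shows "fault_tolerant Q (kraus K) G"
  unfolding fault_tolerant_def
proof (intro exI[of _ gs] conjI ballI allI impI)
  fix g assume "g \<in> set gs"
  then show "unitary g" "\<exists>B. card B \<le> 3 \<and> acts_on B g"
    using gates by blast+
next
  show "\<exists>z. cmod z = 1 \<and> (\<forall>\<psi>. circuit gs *v (encode_blocks Q *v \<psi>) = z *s (encode_blocks Q *v (G *v \<psi>)))"
    using z by (intro exI[of _ z]) (simp add: matrix_vector_mul_assoc circuit cscale_vec)
next
  fix gs1 gs2 and \<E> :: "qmat \<Rightarrow> qmat" and p :: "'r \<times> 'q" and \<psi> :: "complex ^ ('r \<Rightarrow> bool)"
  assume asm: "gs = gs1 @ gs2 \<and> quantum_channel \<E> \<and> norm \<psi> = 1"
  then have \<E>: "quantum_channel \<E>"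
    by blast
  define X where "X = (encode_blocks Q :: complex ^ ('r \<Rightarrow> bool) ^ ('r \<times> 'q \<Rightarrow> bool))"
  define \<sigma> where "\<sigma> = pure_state \<psi>"
  define \<tau> where "\<tau> = G ** \<sigma> ** adj G"
  define \<rho> where "\<rho> = circuit gs1 ** (X ** \<sigma> ** adj X) ** adj (circuit gs1)"
  have X: "adj X ** X = mat 1"
    unfolding X_def using isometry by (rule encode_blocks_isometry)
  have cXz: "circuit gs2 ** circuit gs1 ** X = cscale z (X ** G)"
    using circuit asm by (simp add: circuit_append X_def)
  have isometries: "adj (circuit gs1) ** circuit gs1 = mat 1" "adj (circuit gs2) ** circuit gs2 = mat 1"
  proof -
    have "unitary g" if "g \<in> set gs1 \<union> set gs2" for g
    proof -
      have "g \<in> set gs"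
        using asm that by auto
      then show ?thesis
        using gates by blast
    qed
    then have "unitary (circuit gs1)" "unitary (circuit gs2)"
      by (simp_all add: circuit_unitary)
    then show "adj (circuit gs1) ** circuit gs1 = mat 1" "adj (circuit gs2) ** circuit gs2 = mat 1"
      by (simp_all add: unitary_def)
  qed
  have "snd p \<in> \<Union>\<A>"
    using cover by simp
  then obtain A where A: "A \<in> \<A>" "snd p \<in> A"
    by blast
  \<comment> \<open>Gates may couple different blocks, so the error stays inside the union of the
    copies of \<open>A\<close> in all blocks rather than inside one copy.\<close>
  have "\<exists>E'. E' \<in> local_ops (UNIV \<times> A) \<and> circuit gs2 ** site p M = E' ** circuit gs2" for M
  proof (rule circuit_local_ops[of "(\<lambda>A. UNIV \<times> A) ` \<A>" "UNIV \<times> A" "site p M" gs2])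
    show "disjoint ((\<lambda>A. (UNIV :: 'r set) \<times> A) ` \<A>)"
    proof (unfold disjoint_def, intro ballI impI)
      fix B C :: "('r \<times> 'q) set"
      assume "B \<in> (\<lambda>A. UNIV \<times> A) ` \<A>" "C \<in> (\<lambda>A. UNIV \<times> A) ` \<A>" "B \<noteq> C"
      then obtain B' C' where "B' \<in> \<A>" "C' \<in> \<A>" "B = UNIV \<times> B'" "C = UNIV \<times> C'" "B' \<noteq> C'"
        by blast
      then show "B \<inter> C = {}"
        using disjointD[OF disjoint] by (simp add: Times_Int_Times)
    qed
    show "UNIV \<times> A \<in> (\<lambda>A. UNIV \<times> A) ` \<A>"
      using A by blast
    show "site p M \<in> local_ops (UNIV \<times> A)"
      by (rule local_ops_mono[OF site_local]) (use A in \<open>auto simp: mem_Times_iff\<close>)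
    fix g assume "g \<in> set gs2"
    then have "g \<in> set gs"
      using asm by simp
    then obtain B A' where B: "unitary g" "acts_on B g" "A' \<in> \<A>" "B \<subseteq> UNIV \<times> A'"
      using gates by blast
    have "g \<in> local_ops (UNIV \<times> A')"
      by (rule local_ops_mono[OF acts_on_local_ops[OF B(2)] B(4)])
    then show "unitary g \<and> (\<exists>B\<in>(\<lambda>A. UNIV \<times> A) ` \<A>. g \<in> local_ops B)"
      using B by blast
  qed blast
  then obtain S where S: "\<And>M. S M \<in> local_ops (UNIV \<times> A)"
    and commute: "\<And>M. circuit gs2 ** site p M = S M ** circuit gs2"
    by metis
  have "circuit gs2 ** (site p M ** \<rho> ** adj (site p M')) ** adj (circuit gs2) =
      (S M ** X) ** \<tau> ** adj (S M' ** X)" for M M'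
  proof -
    have *: "circuit gs2 ** (site p M ** (circuit gs1 ** X)) = cscale z (S M ** X ** G)" for M
    proof -
      have "circuit gs2 ** (site p M ** (circuit gs1 ** X)) = S M ** (circuit gs2 ** circuit gs1 ** X)"
        using commute by (metis matrix_mul_assoc)
      then show ?thesis
        unfolding cXz by (simp add: cscale_mult_right matrix_mul_assoc)
    qed
    have "circuit gs2 ** (site p M ** \<rho> ** adj (site p M')) ** adj (circuit gs2) =
        (circuit gs2 ** (site p M ** (circuit gs1 ** X))) ** \<sigma> ** adj (circuit gs2 ** (site p M' ** (circuit gs1 ** X)))"
      by (simp add: \<rho>_def adj_mult matrix_mul_assoc)
    also have "\<dots> = (S M ** X ** G) ** \<sigma> ** adj (S M' ** X ** G)"
      unfolding * by (rule cscale_sandwich[OF z])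
    finally show ?thesis
      by (simp add: \<tau>_def adj_mult matrix_mul_assoc)
  qed
  moreover have "\<exists>l. on_all_blocks (kraus K) ((S M ** X) ** \<tau> ** adj (S M' ** X)) = cscale l (X ** \<tau> ** adj X)" for M M'
    unfolding X_def by (rule on_all_blocks_recovers[OF correctable[OF A(1)] S S])
  ultimately obtain l where l: "\<And>M M'. on_all_blocks (kraus K)
      (circuit gs2 ** (site p M ** \<rho> ** adj (site p M')) ** adj (circuit gs2)) = cscale (l M M') (X ** \<tau> ** adj X)"
    by metis
  \<comment> \<open>The rest of the circuit followed by recovery, as one linear map, so that the
    expanded error can be treated term by term.\<close>
  define R :: "('r \<times> 'q) oper \<Rightarrow> ('r \<times> 'q) oper"
    where "R \<omega> = on_all_blocks (kraus K) (circuit gs2 ** \<omega> ** adj (circuit gs2))" for \<omega>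
  have R_sum: "R (\<Sum>i\<in>I. f i) = (\<Sum>i\<in>I. R (f i))" for I :: "bool set" and f
  proof (induction I rule: infinite_finite_induct)
    case empty
    show ?case
      using fold_on_block_cscale[of K _ 0 0] by (simp add: R_def on_all_blocks_def)
  qed (simp_all add: R_def on_all_blocks_def matrix_add_ldistrib matrix_add_rdistrib fold_on_block_add)
  have R_cscale: "R (cscale y \<omega>) = cscale y (R \<omega>)" for y \<omega>
    by (simp add: R_def on_all_blocks_def cscale_mult_left cscale_mult_right fold_on_block_cscale)
  have "\<exists>l. R (on_qubit p \<E> \<rho>) = cscale l (X ** \<tau> ** adj X)"
    unfolding on_qubit_expansion[OF \<E>] R_sum R_cscale
    by (simp add: R_def l cscale_sum_left[symmetric]) blast
  then obtain m where m: "R (on_qubit p \<E> \<rho>) = cscale m (X ** \<tau> ** adj X)"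
    by blast
  \<comment> \<open>Noise, gates and recovery all preserve the trace, and the ideal output has trace
    1; this determines the factor \<open>m\<close>.\<close>
  have tr: "trace (X ** \<sigma> ** adj X) = 1"
    unfolding trace_isometry[OF X] \<sigma>_def by (rule trace_pure_state) (use asm in blast)
  have "trace (R (on_qubit p \<E> \<rho>)) = 1"
    unfolding R_def on_all_blocks_def fold_on_block_trace[OF complete] trace_isometry[OF isometries(2)]
      trace_on_qubit[OF \<E>] \<rho>_def trace_isometry[OF isometries(1)] by (rule tr)
  moreover have "trace (X ** \<tau> ** adj X) = 1"
  proof -
    have "X ** \<tau> ** adj X = (cscale z (X ** G)) ** \<sigma> ** adj (cscale z (X ** G))"
      unfolding cscale_sandwich[OF z] by (simp add: \<tau>_def adj_mult matrix_mul_assoc)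
    also have "\<dots> = circuit gs2 ** (circuit gs1 ** (X ** \<sigma> ** adj X) ** adj (circuit gs1)) ** adj (circuit gs2)"
      unfolding cXz[symmetric] by (simp add: adj_mult matrix_mul_assoc)
    finally show ?thesis
      by (simp add: trace_isometry isometries tr)
  qed
  ultimately have "m = 1"
    unfolding m by (simp add: trace_cscale)
  have "pure_state (encode_blocks Q *v (G *v \<psi>)) = X ** \<tau> ** adj X"
    by (simp add: pure_state_mult_vec X_def \<tau>_def \<sigma>_def)
  moreover have "conjugate_by (circuit gs1) (pure_state (encode_blocks Q *v \<psi>)) = \<rho>"
    by (simp add: conjugate_by_def pure_state_mult_vec \<rho>_def X_def \<sigma>_def)
  ultimately show "on_all_blocks (kraus K) (conjugate_by (circuit gs2) (on_qubit p \<E>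
      (conjugate_by (circuit gs1) (pure_state (encode_blocks Q *v \<psi>))))) = pure_state (encode_blocks Q *v (G *v \<psi>))"
    using m \<open>m = 1\<close> by (simp add: R_def conjugate_by_def)
qed

theorem fault_tolerant_one_qubitI:
  fixes Q :: "complex ^ bool ^ ('q::finite \<Rightarrow> bool)" and gs :: "'q oper list"
  assumes isometry: "adj Q ** Q = mat 1"
    and complete: "(\<Sum>k\<in>UNIV. adj (K k) ** K k) = mat 1"
    and disjoint: "disjoint \<A>" and cover: "\<Union>\<A> = UNIV"
    and correctable: "\<And>A. A \<in> \<A> \<Longrightarrow> correctable K Q A"
    and gates: "\<And>g. g \<in> set gs \<Longrightarrow> unitary g \<and> (\<exists>B. card B \<le> 3 \<and> acts_on B g \<and> (\<exists>A\<in>\<A>. B \<subseteq> A))"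
    and z: "cmod z = 1" and circuit: "circuit gs ** Q = cscale z (Q ** g)"
  shows "fault_tolerant Q (kraus K) (tensor (\<lambda>_ :: 1. g))"
proof (rule fault_tolerantI[OF isometry complete disjoint cover correctable _ z,
      where gs = "map (embed_gate (Pair 1)) gs"])
  fix h :: "(1 \<times> 'q) oper"
  assume "h \<in> set (map (embed_gate (Pair 1)) gs)"
  then obtain g where g: "g \<in> set gs" "h = embed_gate (Pair 1) g"
    by auto
  then obtain B A where B: "unitary g" "card B \<le> 3" "acts_on B g" "A \<in> \<A>" "B \<subseteq> A"
    using gates by blast
  have "card (Pair (1 :: 1) ` B) \<le> 3" "Pair 1 ` B \<subseteq> UNIV \<times> A"
    using B card_image_le[of B "Pair (1 :: 1)"] by auto
  then show "unitary h \<and> (\<exists>B. card B \<le> 3 \<and> acts_on B h \<and> (\<exists>A\<in>\<A>. B \<subseteq> UNIV \<times> A))"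
    using B g acts_on_embed[OF inj_Pair B(3)] embed_gate_unitary[OF inj_Pair] by blast
next
  have single: "block_tensor N = block_tensor (\<lambda>_ :: 1. N 1)" for N :: "1 \<Rightarrow> complex ^ bool ^ ('q \<Rightarrow> bool)"
    by (rule arg_cong[where f = block_tensor], rule ext, rule arg_cong[where f = N], simp)
  have "circuit (map (embed_gate (Pair (1 :: 1))) gs) ** encode_blocks Q = block_tensor (\<lambda>_. circuit gs ** Q)"
    unfolding circuit_embed[OF inj_Pair] encode_blocks_eq embed_block_tensor by (subst single) simp
  also have "\<dots> = block_tensor ((\<lambda>_ :: 1. Q ** g)(1 := cscale z (Q ** g)))"
    by (subst (2) single) (simp add: circuit)
  also have "\<dots> = cscale z (block_tensor (\<lambda>_. Q ** g))"
    unfolding block_tensor_cscale by (subst single) simp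
  finally show "circuit (map (embed_gate (Pair (1 :: 1))) gs) ** encode_blocks Q =
      cscale z (encode_blocks Q ** tensor (\<lambda>_. g))"
    by (simp add: encode_blocks_eq block_tensor_mult_tensor)
qed

text \<open>A density operator on the code space has the form Q \<sigma> Q* for some \<sigma>. Each
  term of the expanded error is then recovered up to a factor, and the trace fixes the total
  factor.\<close>

theorem correctable_corrects:
  fixes Q :: "complex ^ bool ^ ('q::finite \<Rightarrow> bool)"
  assumes isometry: "adj Q ** Q = mat 1"
    and complete: "(\<Sum>k\<in>UNIV. adj (K k) ** K k) = mat 1"
    and correctable: "correctable K Q A" and "p \<in> A" and \<E>: "quantum_channel \<E>"
  shows "corrects Q (kraus K) (on_qubit p \<E>)"
  unfolding corrects_def
proof (intro allI impI)
  fix \<rho> :: "'q oper"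
  assume asm: "density_operator \<rho> \<and> range (\<lambda>v. \<rho> *v v) \<subseteq> range (\<lambda>\<psi>. Q *v \<psi>)"
  have hermitian: "adj \<rho> = \<rho>"
  proof -
    have real: "cdot v (\<rho> *v v) = cdot v (adj \<rho> *v v)" for v
    proof -
      have "cdot v (\<rho> *v v) \<in> \<real>\<^sub>\<ge>\<^sub>0"
        using asm by (simp add: density_operator_def)
      then have "cnj (cdot v (\<rho> *v v)) = cdot v (\<rho> *v v)"
        by (simp add: complex_nonneg_Reals_iff complex_eq_iff)
      then show ?thesis
        by (metis adj_adj cdot_adj cdot_commute)
    qed
    \<comment> \<open>Over the complex numbers a matrix with vanishing quadratic form is zero: test
      it on sums of two basis vectors with relative factor 1 and i.\<close>
    define D where "D = \<rho> - adj \<rho>"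
    have D: "cdot v (D *v v) = 0" for v
      unfolding D_def by (simp add: matrix_vector_mult_diff_rdistrib cdot_diff_right real)
    have entry: "cdot (axis x 1) (D *v axis y 1) = D $ x $ y" for x y
      by (simp add: cdot_axis mult_vec_nth) (simp add: axis_def if_distrib cong: if_cong)
    have "D $ x $ y = 0" for x y
    proof -
      have *: "D $ x $ y * c + D $ y $ x * cnj c = 0" for c
      proof -
        have "cdot (axis x 1 + c *s axis y 1) (D *v (axis x 1 + c *s axis y 1)) = 0"
          by (rule D)
        then show ?thesis
          using D[of "axis x 1"] D[of "axis y 1"]
          by (simp add: matrix_vector_right_distrib vector_scalar_commute cdot_add_left cdot_add_right
              cdot_scale_left cdot_scale_right entry algebra_simps)
      qed
      have 1: "D $ y $ x = - (D $ x $ y)"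
        using *[of 1] unfolding complex_cnj_one mult_1_right add_eq_0_iff .
      have "D $ x $ y * \<i> + - (D $ x $ y) * (- \<i>) = 0"
        using *[of \<i>] unfolding 1 complex_cnj_i .
      then show ?thesis
        by simp
    qed
    then have "D = 0"
      by (simp add: vec_eq_iff)
    then show ?thesis
      by (simp add: D_def)
  qed
  have proj: "Q ** adj Q ** \<rho> = \<rho>"
  proof -
    have "(Q ** adj Q ** \<rho>) *v v = \<rho> *v v" for v
    proof -
      obtain \<psi> where "\<rho> *v v = Q *v \<psi>"
        using asm by blast
      then have "(Q ** adj Q ** \<rho>) *v v = Q *v ((adj Q ** Q) *v \<psi>)"
        by (simp add: matrix_vector_mul_assoc[symmetric])
      then show ?thesis
        using \<open>\<rho> *v v = Q *v \<psi>\<close> isometry by simp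
    qed
    then show ?thesis
      by (simp add: matrix_eq)
  qed
  define \<sigma> where "\<sigma> = adj Q ** \<rho> ** Q"
  have \<rho>: "\<rho> = Q ** \<sigma> ** adj Q"
  proof -
    \<comment> \<open>The range condition gives the projection on the left; adjoints move it to the
      right because \<rho> is Hermitian.\<close>
    have "\<rho> ** Q ** adj Q = \<rho>"
      using arg_cong[OF proj, of adj] by (simp add: adj_mult hermitian matrix_mul_assoc)
    then show ?thesis
      by (metis \<sigma>_def proj matrix_mul_assoc)
  qed
  have "\<exists>l. kraus K (site p M ** \<rho> ** adj (site p M')) = cscale l \<rho>" for M M'
  proof -
    have "site p M \<in> local_ops A" for M
      by (rule local_ops_mono[OF site_local]) (use \<open>p \<in> A\<close> in simp)
    then have "\<exists>l. kraus K ((site p M ** Q) ** \<sigma> ** adj (site p M' ** Q)) = cscale l (Q ** \<sigma> ** adj Q)"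
      by (intro kraus_recovers correctable_local_ops[OF correctable])
    moreover have "site p M ** \<rho> ** adj (site p M') = (site p M ** Q) ** \<sigma> ** adj (site p M' ** Q)"
      unfolding \<rho> by (simp add: adj_mult matrix_mul_assoc)
    ultimately show ?thesis
      using \<rho> by metis
  qed
  then obtain l where l: "\<And>M M'. kraus K (site p M ** \<rho> ** adj (site p M')) = cscale (l M M') \<rho>"
    by metis
  have sum: "kraus K (\<Sum>i\<in>I. f i) = (\<Sum>i\<in>I. kraus K (f i))" for I :: "bool set" and f
    by (rule channel_sum[OF kraus_quantum_channel[OF complete]])
  have "\<exists>m. kraus K (on_qubit p \<E> \<rho>) = cscale m \<rho>"
    unfolding on_qubit_expansion[OF \<E>] sum kraus_cscale
    by (simp add: l cscale_sum_left[symmetric]) blast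
  then obtain m where m: "kraus K (on_qubit p \<E> \<rho>) = cscale m \<rho>"
    by blast
  have "trace \<rho> = 1"
    using asm by (simp add: density_operator_def)
  moreover have "trace (kraus K (on_qubit p \<E> \<rho>)) = trace \<rho>"
    by (simp add: trace_kraus[OF complete] trace_on_qubit[OF \<E>])
  ultimately have "m = 1"
    unfolding m by (simp add: trace_cscale)
  then show "kraus K (on_qubit p \<E> \<rho>) = \<rho>"
    using m by simp
qed

section \<open>Pauli operators and decoding of a single error\<close>

section \<open>Pauli operators\<close>

lemma pauli_X_nth [simp]: "pauli_X $ a $ b = (if a = b then 0 else 1)"
  by (simp add: pauli_X_def)

lemma pauli_Z_nth [simp]: "pauli_Z $ a $ b = (if a = b then if a then - 1 else 1 else 0)"
  by (simp add: pauli_Z_def)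

lemma pauli_square: "pauli_X ** pauli_X = mat 1" "pauli_Z ** pauli_Z = mat 1"
  by (simp_all add: vec_eq_iff mult_nth mat_nth UNIV_bool)

lemma pauli_anticommute: "pauli_Z ** pauli_X = cscale (- 1) (pauli_X ** pauli_Z)"
  by (simp add: vec_eq_iff mult_nth UNIV_bool)

lemma tensor_cscale: "tensor (\<lambda>q. cscale (z q) (M q)) = cscale (\<Prod>q\<in>UNIV. z q) (tensor M)"
  by (simp add: vec_eq_iff tensor_nth prod.distrib)

lemma adj_X_on: "adj (X_on A) = X_on A" and adj_Z_on: "adj (Z_on A) = Z_on A"
proof -
  have "adj pauli_X = pauli_X" "adj pauli_Z = pauli_Z"
    by (simp_all add: vec_eq_iff)
  then show "adj (X_on A) = X_on A" "adj (Z_on A) = Z_on A"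
    unfolding X_on_def Z_on_def adj_tensor by (simp_all add: if_distrib cong: if_cong)
qed

lemma X_on_mult: "X_on A ** X_on B = X_on ((A - B) \<union> (B - A))"
  and Z_on_mult: "Z_on A ** Z_on B = Z_on ((A - B) \<union> (B - A))"
  unfolding X_on_def Z_on_def tensor_mult
  by (rule arg_cong[where f = tensor]; auto simp: pauli_square)+

lemma X_on_empty: "X_on {} = mat 1" and Z_on_empty: "Z_on {} = mat 1"
  by (simp_all add: X_on_def Z_on_def tensor_one)

lemma X_on_square: "X_on A ** X_on A = mat 1" and Z_on_square: "Z_on A ** Z_on A = mat 1"
  by (simp_all add: X_on_mult Z_on_mult X_on_empty Z_on_empty)

lemma Z_on_commute: "Z_on A ** Z_on B = Z_on B ** Z_on A"
  by (simp add: Z_on_mult Un_commute)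

lemma Z_on_X_on: "Z_on A ** X_on B = cscale ((- 1) ^ card (A \<inter> B)) (X_on B ** Z_on A)"
proof -
  have "Z_on A ** X_on B = tensor (\<lambda>q. cscale (if q \<in> A \<inter> B then - 1 else 1)
      ((if q \<in> B then pauli_X else mat 1) ** (if q \<in> A then pauli_Z else mat 1)))"
    unfolding X_on_def Z_on_def tensor_mult
    by (rule arg_cong[where f = tensor]) (auto simp: pauli_anticommute)
  also have "(\<Prod>q\<in>UNIV. if q \<in> A \<inter> B then - 1 else 1 :: complex) = (- 1) ^ card (A \<inter> B)"
    by (subst prod.If_cases) (auto simp: Int_def)
  ultimately show ?thesis
    by (simp add: tensor_cscale tensor_mult X_on_def Z_on_def)
qed

lemma Z_on_eq_diagonal: "Z_on A = diagonal (\<lambda>x. of_real (parity_sign A x))"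
proof -
  have "Z_on A $ x $ y = diagonal (\<lambda>x. of_real (parity_sign A x)) $ x $ y" for x y
  proof (cases "x = y")
    case True
    have "Z_on A $ x $ x = (\<Prod>q\<in>UNIV. if q \<in> A then if x q then - 1 else 1 else 1)"
      unfolding Z_on_def tensor_nth by (intro prod.cong) (auto simp: mat_nth)
    also have "\<dots> = (\<Prod>q\<in>A. if x q then - 1 else 1)"
      by (simp add: prod.If_cases)
    also have "\<dots> = of_real (parity_sign A x)"
      by (simp add: parity_sign_def if_distrib[of of_real] cong: if_cong)
    finally show ?thesis
      using True by simp
  next
    case False
    then obtain q where "x q \<noteq> y q"
      by (auto simp: fun_eq_iff)
    then have "Z_on A $ x $ y = 0"
      unfolding Z_on_def tensor_nth by (intro prod_zero) (auto simp: mat_nth)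
    then show ?thesis
      using False by simp
  qed
  then show ?thesis
    by (simp add: vec_eq_iff)
qed

definition flip :: "'q set \<Rightarrow> ('q \<Rightarrow> bool) \<Rightarrow> 'q \<Rightarrow> bool"
  where "flip A x = (\<lambda>q. x q \<noteq> (q \<in> A))"

lemma flip_flip: "flip A (flip A x) = x"
  by (auto simp: flip_def)

lemma X_on_nth: "X_on A $ x $ y = (if y = flip A x then 1 else 0)"
proof -
  have "X_on A $ x $ y = (\<Prod>q\<in>UNIV. if y q = flip A x q then 1 else 0)"
    unfolding X_on_def tensor_nth by (intro prod.cong) (auto simp: mat_nth flip_def)
  then show ?thesis
    by (simp add: prod_if_eq)
qed

lemma X_on_mult_nth: "(X_on A ** V) $ x $ a = V $ flip A x $ a"
  by (simp add: mult_nth X_on_nth if_distrib[of "\<lambda>z. z * _"] cong: if_cong)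

lemma Z_on_mult_nth: "(Z_on A ** V) $ x $ a = of_real (parity_sign A x) * V $ x $ a"
  by (simp add: mult_nth Z_on_eq_diagonal if_distrib[of "\<lambda>z. z * _"] cong: if_cong)

lemma parity_sign_bit:
  "finite A \<Longrightarrow> parity_sign A x = (if (\<Sum>q\<in>A. of_bool (x q) :: bit) = 0 then 1 else - 1)"
  unfolding parity_sign_def by (induction A rule: finite_induct) auto

section \<open>Correcting one error in a stabilizer code with distinct checks\<close>

text \<open>At most one X and at most one Z, at independent positions: the two kinds have separate
  syndromes. The case of equal positions covers Y errors up to a factor.\<close>

definition pauli_error :: "'q option \<times> 'q option \<Rightarrow> ('q::finite) oper"
  where "pauli_error e = X_on (set_option (fst e)) ** Z_on (set_option (snd e))"

definition ket_bra :: "'a \<Rightarrow> 'b \<Rightarrow> complex ^ 'b ^ 'a"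
  where "ket_bra a b = (\<chi> i j. if i = a \<and> j = b then 1 else 0)"

text \<open>The projection onto the sum of the images of the code under all these errors; that it is
  one rests on their mutual orthogonality, shown below.\<close>

definition syndrome_projection :: "complex ^ bool ^ ('q::finite \<Rightarrow> bool) \<Rightarrow> 'q oper"
  where "syndrome_projection V =
    (\<Sum>e\<in>UNIV. (pauli_error e ** V) ** adj (pauli_error e ** V))"

text \<open>The Kraus operators of a decoding channel. The labels \<open>Inr\<close> only serve to make it trace
  preserving: they handle the states that no single error produces.\<close>

fun decoder :: "complex ^ bool ^ ('q::finite \<Rightarrow> bool) \<Rightarrow> ('q option \<times> 'q option) + ('q \<Rightarrow> bool)
    \<Rightarrow> complex ^ ('q \<Rightarrow> bool) ^ bool"
  where
    "decoder V (Inl e) = adj (pauli_error e ** V)"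
  | "decoder V (Inr x) = ket_bra False x ** (mat 1 - syndrome_projection V)"

lemma matrix_sub_ldistrib: "A ** (B - C) = A ** B - A ** C" for A :: "complex ^ 'n ^ 'm"
  by (simp add: vec_eq_iff mult_nth right_diff_distrib sum_subtractf)

lemma matrix_sub_rdistrib: "(A - B) ** C = A ** C - B ** C" for A :: "complex ^ 'n ^ 'm"
  by (simp add: vec_eq_iff mult_nth left_diff_distrib sum_subtractf)

lemma site_add: "site q (A + B) = site q A + site q B"
  by (auto simp: vec_eq_iff site_nth)

lemma ket_bra_complete: "(\<Sum>b\<in>UNIV. adj (ket_bra a b) ** ket_bra a b) = (mat 1 :: complex ^ 'b ^ 'b)"
proof -
  have "(adj (ket_bra a b) ** ket_bra a b) $ i $ j = (if b = i then if i = j then 1 else 0 else 0)" for b i j :: 'b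
    by (simp add: mult_nth ket_bra_def if_distrib[of cnj] if_distrib[of "\<lambda>z. z * _"] if_distrib[of "(*) _"] cong: if_cong)
  then show ?thesis
    by (simp add: vec_eq_iff mat_nth)
qed

locale check_code =
  fixes c :: "'q::finite \<Rightarrow> bit ^ 'n" and V :: "complex ^ bool ^ ('q \<Rightarrow> bool)"
  assumes inj_c: "inj c" and c_nonzero: "c q \<noteq> 0"
    and isometry: "adj V ** V = mat 1"
    and X_check: "X_on {i. c i $ j = 1} ** V = V"
    and Z_check: "Z_on {i. c i $ j = 1} ** V = V"
begin

text \<open>The code absorbs the check on either side, while moving it through \<open>D\<close>
  costs a sign, so the product equals its own negative.\<close>

lemma anticommuting_check:
  assumes "adj P = P" "P ** V = V" "P ** D = cscale (- 1) (D ** P)"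
  shows "adj V ** D ** V = 0"
proof -
  have "adj V ** P = adj V"
    using arg_cong[OF assms(2), of adj] by (simp add: adj_mult assms(1))
  then have "adj V ** D ** V = adj V ** (P ** D) ** V"
    by (metis matrix_mul_assoc)
  also have "\<dots> = cscale (- 1) (adj V ** D ** (P ** V))"
    unfolding assms(3) by (simp add: cscale_mult_left cscale_mult_right matrix_mul_assoc)
  finally have "adj V ** D ** V = cscale (- 1) (adj V ** D ** V)"
    by (simp add: assms(2))
  then have "(adj V ** D ** V) $ i $ j = - (adj V ** D ** V) $ i $ j" for i j
    by (metis cscale_nth mult_minus1)
  then show ?thesis
    by (simp add: vec_eq_iff)
qed

text \<open>With the column 0 for the absent error all columns are distinct, and two distinct
  columns differ in some row.\<close>

lemma distinguishing_check:
  assumes "u \<noteq> u'"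
  obtains j where "even (card ({i. c i $ j = 1} \<inter> set_option u)) \<longleftrightarrow>
    odd (card ({i. c i $ j = 1} \<inter> set_option u'))"
proof -
  define s where "s u = (case u of None \<Rightarrow> 0 | Some q \<Rightarrow> c q)" for u
  have "s u \<noteq> s u'"
    using assms inj_c c_nonzero c_nonzero[symmetric] by (cases u; cases u') (auto simp: s_def inj_eq)
  then obtain j where j: "s u $ j \<noteq> s u' $ j"
    by (auto simp: vec_eq_iff)
  have odd: "odd (card ({i. c i $ j = 1} \<inter> set_option u)) \<longleftrightarrow> s u $ j = 1" for u
    by (cases u) (auto simp: s_def Int_insert_right)
  have "s u $ j = 1 \<longleftrightarrow> s u' $ j \<noteq> 1"
    using j by (cases "s u $ j = 1"; cases "s u' $ j = 1") simp_all
  then show thesis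
    using that[of j] odd by blast
qed

text \<open>The Knill-Laflamme condition for a nondegenerate code. If the X positions differ, a Z
  check anticommutes with the product of the errors; if they agree, the X parts cancel and an X
  check separates the Z parts.\<close>

lemma pauli_error_orthogonal:
  assumes "e \<noteq> e'"
  shows "adj (pauli_error e ** V) ** (pauli_error e' ** V) = 0"
proof -
  obtain u w u' w' where e: "e = (u, w)" "e' = (u', w')"
    by (metis surj_pair)
  let ?X = "\<lambda>u. X_on (set_option u)" and ?Z = "\<lambda>w. Z_on (set_option w)"
  have eq: "adj (pauli_error e ** V) ** (pauli_error e' ** V) = adj V ** (?Z w ** ?X u ** ?X u' ** ?Z w') ** V"
    by (simp add: e pauli_error_def adj_mult adj_X_on adj_Z_on matrix_mul_assoc)
  show ?thesis
  proof (cases "u = u'")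
    case True
    then have "w \<noteq> w'"
      using assms e by simp
    then obtain j where j: "even (card ({i. c i $ j = 1} \<inter> set_option w)) \<longleftrightarrow>
        odd (card ({i. c i $ j = 1} \<inter> set_option w'))"
      by (rule distinguishing_check)
    let ?P = "X_on {i. c i $ j = 1}"
    have ZP: "?P ** ?Z w = cscale ((- 1) ^ card ({i. c i $ j = 1} \<inter> set_option w)) (?Z w ** ?P)" for w
      by (simp add: Z_on_X_on Int_commute power_mult_distrib[symmetric])
    have "?P ** (?Z w ** ?Z w') = cscale (- 1) ((?Z w ** ?Z w') ** ?P)"
    proof -
      have "?P ** (?Z w ** ?Z w') = (?P ** ?Z w) ** ?Z w'"
        by (simp add: matrix_mul_assoc)
      also have "\<dots> = cscale ((- 1) ^ card ({i. c i $ j = 1} \<inter> set_option w)) (?Z w ** (?P ** ?Z w'))"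
        unfolding ZP[of w] by (simp add: cscale_mult_left matrix_mul_assoc)
      also have "\<dots> = cscale ((- 1) ^ card ({i. c i $ j = 1} \<inter> set_option w) *
          (- 1) ^ card ({i. c i $ j = 1} \<inter> set_option w')) ((?Z w ** ?Z w') ** ?P)"
        unfolding ZP[of w'] by (simp add: cscale_mult_right matrix_mul_assoc)
      finally show ?thesis
        using j by (cases "even (card ({i. c i $ j = 1} \<inter> set_option w))") simp_all
    qed
    then have "adj V ** (?Z w ** ?Z w') ** V = 0"
      by (rule anticommuting_check[OF adj_X_on X_check])
    moreover have "?Z w ** ?X u ** ?X u' ** ?Z w' = ?Z w ** ?Z w'"
      using True X_on_square by (metis matrix_mul_assoc matrix_mul_rid)
    ultimately show ?thesis
      by (simp add: eq)
  next
    case False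
    then obtain j where j: "even (card ({i. c i $ j = 1} \<inter> set_option u)) \<longleftrightarrow>
        odd (card ({i. c i $ j = 1} \<inter> set_option u'))"
      by (rule distinguishing_check)
    let ?P = "Z_on {i. c i $ j = 1}"
    let ?s = "\<lambda>u. (- 1) ^ card ({i. c i $ j = 1} \<inter> set_option u)"
    have "?P ** (?Z w ** ?X u ** ?X u' ** ?Z w') = ?Z w ** (?P ** ?X u) ** ?X u' ** ?Z w'"
      by (simp add: matrix_mul_assoc Z_on_commute[of "{i. c i $ j = 1}" "set_option w"])
    also have "\<dots> = cscale (?s u) (?Z w ** ?X u ** (?P ** ?X u') ** ?Z w')"
      unfolding Z_on_X_on[of "{i. c i $ j = 1}" "set_option u"] by (simp add: cscale_mult_left cscale_mult_right matrix_mul_assoc)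
    also have "\<dots> = cscale (?s u * ?s u') (?Z w ** ?X u ** ?X u' ** (?P ** ?Z w'))"
      unfolding Z_on_X_on[of "{i. c i $ j = 1}" "set_option u'"] by (simp add: cscale_mult_left cscale_mult_right matrix_mul_assoc)
    also have "\<dots> = cscale (- 1) ((?Z w ** ?X u ** ?X u' ** ?Z w') ** ?P)"
      using j Z_on_commute[of "{i. c i $ j = 1}" "set_option w'"]
      by (cases "even (card ({i. c i $ j = 1} \<inter> set_option u))") (simp_all only: matrix_mul_assoc[symmetric], simp_all)
    finally show ?thesis
      unfolding eq by (rule anticommuting_check[OF adj_Z_on Z_check])
  qed
qed

lemma pauli_error_normalized: "adj (pauli_error e ** V) ** (pauli_error e ** V) = mat 1"
proof -
  have "unitary (pauli_error e)"
    unfolding pauli_error_def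
    by (rule unitary_mult) (simp_all add: unitary_def adj_X_on adj_Z_on X_on_square Z_on_square)
  moreover have "adj (pauli_error e ** V) ** (pauli_error e ** V) = adj V ** (adj (pauli_error e) ** pauli_error e) ** V"
    by (simp add: adj_mult matrix_mul_assoc)
  ultimately show ?thesis
    by (simp add: unitary_def isometry)
qed

lemma pauli_error_inner:
  "adj (pauli_error e ** V) ** (pauli_error e' ** V) = (if e = e' then mat 1 else 0)"
  using pauli_error_orthogonal pauli_error_normalized by simp

lemma syndrome_projection_error: "syndrome_projection V ** (pauli_error e ** V) = pauli_error e ** V"
proof -
  have "syndrome_projection V ** (pauli_error e ** V) =
      (\<Sum>e'\<in>UNIV. (pauli_error e' ** V) ** (adj (pauli_error e' ** V) ** (pauli_error e ** V)))"
    by (simp add: syndrome_projection_def sum_mult_left matrix_mul_assoc)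
  also have "\<dots> = (\<Sum>e'\<in>UNIV. if e' = e then pauli_error e ** V else 0)"
    unfolding pauli_error_inner by (intro sum.cong) auto
  finally show ?thesis
    by simp
qed

text \<open>The \<open>Inl\<close> operators sum to the syndrome projection and the
  \<open>Inr\<close> operators to its complement.\<close>

lemma decoder_complete: "(\<Sum>k\<in>UNIV. adj (decoder V k) ** decoder V k) = mat 1"
proof -
  let ?\<Pi> = "syndrome_projection V"
  have "?\<Pi> ** ?\<Pi> = (\<Sum>e\<in>UNIV. (?\<Pi> ** (pauli_error e ** V)) ** adj (pauli_error e ** V))"
    by (subst (2) syndrome_projection_def) (simp add: sum_mult_right matrix_mul_assoc)
  then have idem: "?\<Pi> ** ?\<Pi> = ?\<Pi>"
    unfolding syndrome_projection_error by (simp add: syndrome_projection_def)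
  have self: "adj ?\<Pi> = ?\<Pi>"
    unfolding syndrome_projection_def by (simp add: adj_sum adj_mult matrix_mul_assoc)
  have "(\<Sum>x\<in>UNIV. adj (decoder V (Inr x)) ** decoder V (Inr x)) =
      adj (mat 1 - ?\<Pi>) ** (\<Sum>x\<in>UNIV. adj (ket_bra False x) ** ket_bra False x) ** (mat 1 - ?\<Pi>)"
    by (simp add: adj_mult sum_mult_left sum_mult_right matrix_mul_assoc)
  also have "\<dots> = mat 1 - ?\<Pi>"
    by (simp add: ket_bra_complete adj_diff self matrix_sub_ldistrib matrix_sub_rdistrib idem)
  finally have Inr: "(\<Sum>x\<in>UNIV. adj (decoder V (Inr x)) ** decoder V (Inr x)) = mat 1 - ?\<Pi>" .
  have "(\<Sum>e\<in>UNIV. adj (decoder V (Inl e)) ** decoder V (Inl e)) = ?\<Pi>"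
    by (simp add: syndrome_projection_def)
  then show ?thesis
    unfolding UNIV_Plus_UNIV[symmetric] using Inr by (subst sum.Plus) simp_all
qed

lemma decoder_pauli_error: "\<exists>l. decoder V k ** (pauli_error e ** V) = cscale l (mat 1)"
proof (cases k)
  case (Inl e')
  then have "decoder V k ** (pauli_error e ** V) = cscale (if e' = e then 1 else 0) (mat 1)"
    by (simp add: pauli_error_inner)
  then show ?thesis
    by blast
next
  case (Inr x)
  then have "decoder V k ** (pauli_error e ** V) =
      ket_bra False x ** ((mat 1 - syndrome_projection V) ** (pauli_error e ** V))"
    by (simp add: matrix_mul_assoc)
  then have "decoder V k ** (pauli_error e ** V) = cscale 0 (mat 1)"
    unfolding matrix_sub_rdistrib syndrome_projection_error by simp
  then show ?thesis
    by blast
qed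

text \<open>The matrices 1, X, Z and XZ span all one-qubit matrices, and each of them at one
  position is a \<open>pauli_error\<close>. No unitarity of \<open>m\<close> is involved, as
  \<open>m\<close> may itself be the output of an inner decoder.\<close>

theorem decoder_site: "\<exists>l. decoder V k ** (site v m ** V) = cscale l (mat 1)"
proof -
  define \<alpha> \<beta> \<gamma> \<delta> where "\<alpha> = (m $ False $ False + m $ True $ True) / 2"
    and "\<beta> = (m $ False $ True + m $ True $ False) / 2"
    and "\<gamma> = (m $ False $ False - m $ True $ True) / 2"
    and "\<delta> = (m $ True $ False - m $ False $ True) / 2"
  have site: "mat 1 = pauli_error (None, None)" "site v pauli_X = pauli_error (Some v, None)"
    "site v pauli_Z = pauli_error (None, Some v)" "site v (pauli_X ** pauli_Z) = pauli_error (Some v, Some v)"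
    by (simp_all add: pauli_error_def X_on_empty Z_on_empty site_mult[symmetric])
      (simp_all add: site_def X_on_def Z_on_def)
  have "m = cscale \<alpha> (mat 1) + cscale \<beta> pauli_X + cscale \<gamma> pauli_Z + cscale \<delta> (pauli_X ** pauli_Z)"
  proof -
    have "m $ a $ b = (cscale \<alpha> (mat 1) + cscale \<beta> pauli_X + cscale \<gamma> pauli_Z + cscale \<delta> (pauli_X ** pauli_Z)) $ a $ b" for a b
      by (cases a; cases b) (simp_all add: mult_nth mat_nth UNIV_bool \<alpha>_def \<beta>_def \<gamma>_def \<delta>_def field_simps)
    then show ?thesis
      unfolding vec_eq_iff by blast
  qed
  then have "site v m = cscale \<alpha> (mat 1) + cscale \<beta> (site v pauli_X) + cscale \<gamma> (site v pauli_Z) +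
      cscale \<delta> (site v (pauli_X ** pauli_Z))"
    by (metis site_add site_cscale site_one)
  then have "decoder V k ** (site v m ** V) =
      cscale \<alpha> (decoder V k ** (pauli_error (None, None) ** V)) +
      cscale \<beta> (decoder V k ** (pauli_error (Some v, None) ** V)) +
      cscale \<gamma> (decoder V k ** (pauli_error (None, Some v) ** V)) +
      cscale \<delta> (decoder V k ** (pauli_error (Some v, Some v) ** V))"
    unfolding site by (simp add: matrix_add_ldistrib matrix_add_rdistrib cscale_mult_left cscale_mult_right)
  moreover obtain l where "\<And>e. decoder V k ** (pauli_error e ** V) = cscale (l e) (mat 1)"
    using decoder_pauli_error by metis
  ultimately show ?thesis
    by (simp add: cscale_add_left[symmetric]) blast
qed

end

section \<open>Reed-Muller duality and the encodings that it determines\<close>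

section \<open>Duality of Reed-Muller codes\<close>

lemma bit_add_self [simp]: "b + b = (0 :: bit)"
  by (cases "b = 0") simp_all

text \<open>Bits stay in field notation, so that they can be treated with sums and products over
  finite sets.\<close>

declare add_bit_eq_xor [simp del] mult_bit_eq_and [simp del]

lemma bit_add_eq_0_iff: "a + b = 0 \<longleftrightarrow> a = (b :: bit)"
  by (cases "a = 0"; cases "b = 0") simp_all

lemma prod_of_bool_bit: "finite S \<Longrightarrow> (\<Prod>k\<in>S. f k) = (of_bool (\<forall>k\<in>S. f k = 1) :: bit)"
  by (induction S rule: finite_induct) auto

lemma vec_bit_add_self [simp]: "v + v = (0 :: bit ^ 'n)"
  by (simp add: vec_eq_iff)

text \<open>The two-dimensional coordinate flat through \<open>p\<close> in directions \<open>i, j\<close> has an indicator function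
  of degree \<open>CARD('n) - 2\<close>.\<close>

lemma sum_coordinate_flat:
  fixes f :: "bit ^ 'n \<Rightarrow> bit"
  assumes orthogonal: "\<And>S. card S + 2 \<le> CARD('n) \<Longrightarrow> (\<Sum>v\<in>UNIV. f v * (\<Prod>k\<in>S. v $ k)) = 0"
    and "i \<noteq> j"
  shows "f p + f (p + axis i 1) + f (p + axis j 1) + f (p + axis i 1 + axis j 1) = 0"
proof -
  define K where "K = - {i, j}"
  define F where "F = {p, p + axis i 1, p + axis j 1, p + axis i 1 + axis j 1}"
  have flat: "(\<forall>k\<in>K. v $ k = p $ k) \<longleftrightarrow> v \<in> F" for v
  proof
    assume "\<forall>k\<in>K. v $ k = p $ k"
    then have *: "v = p + (\<chi> k. if k = i then v $ i + p $ i else if k = j then v $ j + p $ j else 0)"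
      by (auto simp: vec_eq_iff K_def add.left_commute[of _ "_ $ _"])
    have "(\<chi> k. if k = i then a else if k = j then b else 0) = (if a = 1 then axis i 1 else 0) + (if b = 1 then axis j 1 else 0)"
      for a b :: bit
      using \<open>i \<noteq> j\<close> by (auto simp: vec_eq_iff axis_def)
    then have "v = p + ((if v $ i + p $ i = 1 then axis i 1 else 0) + (if v $ j + p $ j = 1 then axis j 1 else 0))"
      using * by metis
    then show "v \<in> F"
      unfolding F_def by (auto simp: add.assoc split: if_splits)
  qed (auto simp: F_def K_def axis_def split: if_splits)
  have "card K + 2 = CARD('n)"
    using card_Diff_subset[of "{i, j}" UNIV] card_mono[of UNIV "{i, j}"] \<open>i \<noteq> j\<close>
    by (simp add: K_def Compl_eq_Diff_UNIV)
  then have card_K: "card S + 2 \<le> CARD('n)" if "S \<subseteq> K" for S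
    using card_mono[OF _ that] by simp
  have "(\<Sum>v\<in>F. f v) = (\<Sum>v\<in>UNIV. f v * (\<Prod>k\<in>K. v $ k + (p $ k + 1)))"
  proof -
    have indicator: "(\<Prod>k\<in>K. v $ k + (p $ k + 1)) = of_bool (v \<in> F)" for v
    proof -
      have "v $ k + (p $ k + 1) = 1 \<longleftrightarrow> v $ k = p $ k" for k
        by (cases "v $ k = 0"; cases "p $ k = 0") simp_all
      then show ?thesis
        by (subst prod_of_bool_bit) (simp_all add: flat[symmetric])
    qed
    have "(\<Sum>v\<in>F. f v) = (\<Sum>v\<in>UNIV. if v \<in> F then f v else 0)"
      by (simp add: sum.If_cases)
    also have "\<dots> = (\<Sum>v\<in>UNIV. f v * of_bool (v \<in> F))"
      by (intro sum.cong) auto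
    finally show ?thesis
      unfolding indicator .
  qed
  \<comment> \<open>Multiplying out the indicator leaves only monomials over subsets of
    \<open>K\<close>, all of degree at most \<open>CARD('n) - 2\<close>.\<close>
  also have "\<dots> = (\<Sum>v\<in>UNIV. \<Sum>S\<in>Pow K. (\<Prod>k\<in>K - S. p $ k + 1) * (f v * (\<Prod>k\<in>S. v $ k)))"
    by (subst prod_add) (simp_all add: sum_distrib_left ac_simps)
  also have "\<dots> = (\<Sum>S\<in>Pow K. (\<Prod>k\<in>K - S. p $ k + 1) * (\<Sum>v\<in>UNIV. f v * (\<Prod>k\<in>S. v $ k)))"
    by (subst sum.swap) (simp add: sum_distrib_left)
  also have "\<dots> = 0"
    using orthogonal card_K by simp
  finally have "(\<Sum>v\<in>F. f v) = 0" .
  have "axis i 1 \<noteq> (0 :: bit ^ 'n)" "axis j 1 \<noteq> (0 :: bit ^ 'n)" "axis i 1 \<noteq> (axis j 1 :: bit ^ 'n)"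
    using \<open>i \<noteq> j\<close> by (simp_all add: axis_eq_axis)
  moreover have "axis i 1 + axis j 1 \<noteq> (0 :: bit ^ 'n)"
  proof
    assume "axis i 1 + axis j 1 = (0 :: bit ^ 'n)"
    then have "(axis i 1 + axis j 1 :: bit ^ 'n) $ i = 0"
      by simp
    then show False
      using \<open>i \<noteq> j\<close> by (simp add: axis_def)
  qed
  ultimately have "(\<Sum>v\<in>F. f v) = f p + (f (p + axis i 1) + (f (p + axis j 1) + f (p + axis i 1 + axis j 1)))"
    unfolding F_def by (subst sum.insert; simp add: add.assoc)+
  with \<open>(\<Sum>v\<in>F. f v) = 0\<close> show ?thesis
    by (simp add: add.assoc)
qed

text \<open>The dual of the Reed-Muller code of degree n - 2 is the code of degree 1: second
  differences of \<open>f\<close> vanish, so its first differences are constant and \<open>f\<close>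
  is affine.\<close>

lemma affine_if_orthogonal:
  fixes f :: "bit ^ 'n \<Rightarrow> bit"
  assumes orthogonal: "\<And>S. card S + 2 \<le> CARD('n) \<Longrightarrow> (\<Sum>v\<in>UNIV. f v * (\<Prod>k\<in>S. v $ k)) = 0"
  shows "\<exists>J. \<forall>v. f v = f 0 + (\<Sum>j\<in>J. v $ j)"
proof -
  define g where "g i p = f (p + axis i 1) + f p" for i p
  have shift: "g i (p + axis j 1) = g i p" for i j p
  proof (cases "i = j")
    case True
    have "p + axis j 1 + axis j 1 = p"
      by (simp only: add.assoc vec_bit_add_self add_0_right)
    then show ?thesis
      unfolding g_def True by (simp only: add.commute)
  next
    case False
    have "f p + f (p + axis i 1) + f (p + axis j 1) + f (p + axis i 1 + axis j 1) = 0"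
      by (rule sum_coordinate_flat[OF orthogonal False])
    then have "g i p + g i (p + axis j 1) = 0"
      by (simp only: g_def ac_simps)
    then show ?thesis
      by (simp add: bit_add_eq_0_iff)
  qed
  \<comment> \<open>Every vector is the indicator of a set of coordinates, so it can be built up
    from 0 one coordinate at a time.\<close>
  define ax where "ax S = (\<chi> k. (of_bool (k \<in> S) :: bit))" for S :: "'n set"
  have ax_insert: "ax (insert j S) = ax S + axis j 1" if "j \<notin> S" for j S
    using that by (auto simp: ax_def vec_eq_iff axis_def)
  have ax_all: "v = ax {k. v $ k = 1}" for v
    by (auto simp: ax_def vec_eq_iff)
  have ax_empty: "ax {} = 0"
    by (simp add: ax_def vec_eq_iff)
  have g: "g i (ax S) = g i 0" for i S
    by (induction S rule: finite_induct[OF finite]) (simp_all add: ax_empty ax_insert shift)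
  define J where "J = {j. g j 0 = 1}"
  have "f (ax S) = f 0 + (\<Sum>j\<in>J. ax S $ j)" for S
  proof (induction S rule: finite_induct[OF finite])
    case 1
    show ?case
      by (simp add: ax_empty)
  next
    case (2 j S)
    have "f (ax S + axis j 1) = f (ax S) + g j (ax S)"
      by (simp add: g_def add.assoc[symmetric] add.commute[of "f (ax S)"])
    also have "g j (ax S) = (\<Sum>k\<in>J. axis j 1 $ k)"
      unfolding g by (simp add: axis_def J_def) 
    finally show ?case
      using 2 by (simp add: ax_insert sum.distrib add.assoc)
  qed
  then show ?thesis
    using ax_all by metis
qed

section \<open>Quantum Reed-Muller codes\<close>

text \<open>The X checks are the rows of the matrix with columns \<open>c i\<close>, and the Z checks are the products
  of at most \<open>CARD('n) - 2\<close> of these rows. The Steane code is the case of three rows, and the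
  15-qubit code is the case of four rows.\<close>

locale quantum_rm_code =
  fixes c :: "'q::finite \<Rightarrow> bit ^ 'n" and V :: "complex ^ bool ^ ('q \<Rightarrow> bool)"
  assumes bij_c: "bij_betw c UNIV {v. v \<noteq> 0}"
    and rows: "3 \<le> CARD('n)"
    and isometry: "adj V ** V = mat 1"
    and X_check: "X_on {i. c i $ j = 1} ** V = V"
    and Z_checks: "S \<noteq> {} \<Longrightarrow> card S + 2 \<le> CARD('n) \<Longrightarrow> Z_on {i. \<forall>k\<in>S. c i $ k = 1} ** V = V"
    and logical_X: "X_on UNIV ** V = V ** pauli_X"
    and logical_Z: "Z_on UNIV ** V = V ** pauli_Z"

sublocale quantum_rm_code \<subseteq> check_code
proof
  show "inj c" "c q \<noteq> 0" for q
    using bij_c by (auto simp: bij_betw_def)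
  show "Z_on {i. c i $ j = 1} ** V = V" for j
    using Z_checks[of "{j}"] rows by simp
qed (fact isometry X_check)+

context quantum_rm_code
begin

text \<open>The words for \<open>False\<close> form the simplex code spanned by the rows, those for
  \<open>True\<close> its complements; together they are the punctured Reed-Muller code of degree
  1.\<close>

definition codeword :: "'n set \<Rightarrow> bool \<Rightarrow> 'q \<Rightarrow> bool"
  where "codeword J a = (\<lambda>i. a \<noteq> ((\<Sum>j\<in>J. c i $ j) = 1))"

definition code :: "bool \<Rightarrow> ('q \<Rightarrow> bool) set"
  where "code a = range (\<lambda>J. codeword J a)"

lemma sum_sym_diff: "(\<Sum>j\<in>(J - J') \<union> (J' - J). v $ j) = (\<Sum>j\<in>J. v $ j) + (\<Sum>j\<in>J'. v $ j :: bit)"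
proof -
  have "(\<Sum>j\<in>J. v $ j) + (\<Sum>j\<in>J'. v $ j) =
      (\<Sum>j\<in>J - J'. v $ j) + (\<Sum>j\<in>J \<inter> J'. v $ j) + ((\<Sum>j\<in>J' - J. v $ j) + (\<Sum>j\<in>J \<inter> J'. v $ j))"
    using sum.Int_Diff[of J "\<lambda>j. v $ j" J'] sum.Int_Diff[of J' "\<lambda>j. v $ j" J]
    by (simp add: Int_commute add.commute)
  also have "\<dots> = (\<Sum>j\<in>J - J'. v $ j) + (\<Sum>j\<in>J' - J. v $ j)"
    by (simp only: ac_simps bit_add_self add_0_right) (simp add: add.assoc[symmetric] add.commute)
  also have "\<dots> = (\<Sum>j\<in>(J - J') \<union> (J' - J). v $ j)"
    by (rule sum.union_disjoint[symmetric]) auto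
  finally show ?thesis ..
qed

lemma codeword_xor: "(\<lambda>i. codeword J a i \<noteq> codeword J' b i) = codeword ((J - J') \<union> (J' - J)) (a \<noteq> b)"
proof
  fix i
  show "(codeword J a i \<noteq> codeword J' b i) = codeword ((J - J') \<union> (J' - J)) (a \<noteq> b) i"
    unfolding codeword_def sum_sym_diff
    by (cases "(\<Sum>j\<in>J. c i $ j) = 0"; cases "(\<Sum>j\<in>J'. c i $ j) = 0") auto
qed

lemma code_xor:
  assumes "x \<in> code a"
  shows "(\<lambda>i. x i \<noteq> y i) \<in> code b \<longleftrightarrow> y \<in> code (a \<noteq> b)"
proof -
  have closed: "(\<lambda>i. x i \<noteq> y i) \<in> code (a \<noteq> b)" if "x \<in> code a" "y \<in> code b" for x y a b
    using that codeword_xor unfolding code_def by blast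
  show ?thesis
  proof
    assume "(\<lambda>i. x i \<noteq> y i) \<in> code b"
    then have "(\<lambda>i. x i \<noteq> (x i \<noteq> y i)) \<in> code (a \<noteq> b)"
      using closed[OF assms] by blast
    moreover have "(\<lambda>i. x i \<noteq> (x i \<noteq> y i)) = y"
      by auto
    ultimately show "y \<in> code (a \<noteq> b)"
      by simp
  next
    assume "y \<in> code (a \<noteq> b)"
    then have "(\<lambda>i. x i \<noteq> y i) \<in> code (a \<noteq> (a \<noteq> b))"
      using closed[OF assms] by blast
    moreover have "(a \<noteq> (a \<noteq> b)) = b"
      by auto
    ultimately show "(\<lambda>i. x i \<noteq> y i) \<in> code b"
      by simp
  qed
qed

lemma row_parity:
  assumes "V $ x $ a \<noteq> 0" "S \<noteq> {}" "card S + 2 \<le> CARD('n)"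
  shows "(\<Sum>i\<in>UNIV. of_bool (x i) * (\<Prod>k\<in>S. c i $ k)) = 0"
proof -
  let ?A = "{i. \<forall>k\<in>S. c i $ k = 1}"
  have "of_real (parity_sign ?A x) * V $ x $ a = V $ x $ a"
    using arg_cong[OF Z_checks[OF assms(2,3)], of "\<lambda>M. M $ x $ a"] unfolding Z_on_mult_nth .
  then have "parity_sign ?A x = 1"
    using assms(1) by simp
  then have "(\<Sum>i\<in>?A. of_bool (x i) :: bit) = 0"
    by (simp add: parity_sign_bit split: if_splits)
  moreover have "(\<Sum>i\<in>UNIV. of_bool (x i) * (\<Prod>k\<in>S. c i $ k)) = (\<Sum>i\<in>UNIV. if i \<in> ?A then of_bool (x i) else 0)"
    by (intro sum.cong) (auto simp: prod_of_bool_bit)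
  ultimately show ?thesis
    by (simp add: sum.If_cases)
qed

lemma total_parity:
  assumes "V $ x $ a \<noteq> 0"
  shows "(\<Sum>i\<in>UNIV. of_bool (x i)) = (of_bool a :: bit)"
proof -
  have "of_real (parity_sign UNIV x) * V $ x $ a = (V ** pauli_Z) $ x $ a"
    using arg_cong[OF logical_Z, of "\<lambda>M. M $ x $ a"] unfolding Z_on_mult_nth .
  also have "\<dots> = V $ x $ a * (if a then - 1 else 1)"
    by (cases a) (simp_all add: mult_nth UNIV_bool)
  finally have "complex_of_real (parity_sign UNIV x) = (if a then - 1 else 1)"
    using assms by simp
  then have "parity_sign UNIV x = (if a then - 1 else 1)"
    by (metis of_real_1 of_real_eq_iff of_real_minus)
  then show ?thesis
    by (auto simp: parity_sign_bit split: if_splits)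
qed

text \<open>A label in the support satisfies all Z checks. Extended to the missing zero vector it is
  orthogonal to all monomials of degree at most n - 2, hence affine.\<close>

lemma support:
  assumes "V $ x $ a \<noteq> 0"
  shows "x \<in> code a"
proof -
  have bij: "bij_betw c UNIV (UNIV - {0})"
    using bij_c by (simp add: Compl_eq_Diff_UNIV[symmetric] Collect_neg_eq[symmetric] set_diff_eq)
  have inj: "inj c"
    using bij_c by (simp add: bij_betw_def)
  \<comment> \<open>The value \<open>a\<close> at 0 makes the overall parity even, as orthogonality
    to the constant monomial demands, and it becomes the constant term of the affine
    function.\<close>
  define f where "f v = (if v = 0 then of_bool a else of_bool (x (inv c v)) :: bit)" for v
  have f_c: "f (c i) = of_bool (x i)" for i
    using c_nonzero inj by (simp add: f_def)
  have "(\<Sum>v\<in>UNIV. f v * (\<Prod>k\<in>S. v $ k)) = 0" if S: "card S + 2 \<le> CARD('n)" for S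
  proof -
    have "(\<Sum>v\<in>UNIV. f v * (\<Prod>k\<in>S. v $ k)) = f 0 * (\<Prod>k\<in>S. 0 $ k) + (\<Sum>v\<in>UNIV - {0}. f v * (\<Prod>k\<in>S. v $ k))"
      by (rule sum.remove) auto
    also have "(\<Sum>v\<in>UNIV - {0}. f v * (\<Prod>k\<in>S. v $ k)) = (\<Sum>i\<in>UNIV. of_bool (x i) * (\<Prod>k\<in>S. c i $ k))"
      using sum.reindex_bij_betw[OF bij, of "\<lambda>v. f v * (\<Prod>k\<in>S. v $ k)"] by (simp add: f_c)
    also have "f 0 * (\<Prod>k\<in>S. 0 $ k) + (\<Sum>i\<in>UNIV. of_bool (x i) * (\<Prod>k\<in>S. c i $ k)) = 0"
    proof (cases "S = {}")
      case True
      then show ?thesis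
        using total_parity[OF assms] by (simp add: f_def)
    next
      case False
      then have "(\<Prod>k\<in>S. 0 $ k :: bit) = 0"
        by (subst prod_of_bool_bit) auto
      then show ?thesis
        using row_parity[OF assms False S] by simp
    qed
    finally show ?thesis .
  qed
  then obtain J where J: "f v = f 0 + (\<Sum>j\<in>J. v $ j)" for v
    using affine_if_orthogonal by blast
  have "x i = codeword J a i" for i
    using J[of "c i"] unfolding f_c codeword_def
    by (cases "(\<Sum>j\<in>J. c i $ j) = 0"; cases a; cases "x i") (simp_all add: f_def)
  then show ?thesis
    unfolding code_def by blast
qed

lemma X_on_row_span: "X_on {i. (\<Sum>j\<in>J. c i $ j) = 1} ** V = V"
proof (induction J rule: finite_induct[OF finite])
  case 1
  show ?case
    by (simp add: X_on_empty)
next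
  case (2 j J)
  have "{i. (\<Sum>j\<in>insert j J. c i $ j) = 1} =
      ({i. c i $ j = 1} - {i. (\<Sum>j\<in>J. c i $ j) = 1}) \<union> ({i. (\<Sum>j\<in>J. c i $ j) = 1} - {i. c i $ j = 1})"
    using 2 by auto
  then have "X_on {i. (\<Sum>j\<in>insert j J. c i $ j) = 1} ** V = X_on {i. c i $ j = 1} ** (X_on {i. (\<Sum>j\<in>J. c i $ j) = 1} ** V)"
    by (simp only: X_on_mult[symmetric] matrix_mul_assoc)
  then show ?case
    using 2 X_check by simp
qed

definition amplitude :: complex
  where "amplitude = V $ (\<lambda>_. False) $ False"

text \<open>Products of X checks lead from the constant word to every word of its class, and logical
  X links the two constant words; all of them preserve amplitudes.\<close>

lemma V_nth: "V $ x $ a = (if x \<in> code a then amplitude else 0)"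
proof (cases "x \<in> code a")
  case True
  then obtain J where x: "x = codeword J a"
    unfolding code_def by blast
  have "V $ x $ a = V $ (\<lambda>_. a) $ a"
  proof -
    have "flip {i. (\<Sum>j\<in>J. c i $ j) = 1} (\<lambda>_. a) = x"
      unfolding x flip_def codeword_def by auto
    then show ?thesis
      using X_on_mult_nth[of "{i. (\<Sum>j\<in>J. c i $ j) = 1}" V "\<lambda>_. a" a] by (simp add: X_on_row_span)
  qed
  also have "\<dots> = amplitude"
  proof (cases a)
    case True
    have "V $ flip UNIV (\<lambda>_. False) $ True = (V ** pauli_X) $ (\<lambda>_. False) $ True"
      unfolding logical_X[symmetric] X_on_mult_nth ..
    then show ?thesis
      using True by (simp add: flip_def mult_nth UNIV_bool amplitude_def)
  qed (simp add: amplitude_def)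
  finally show ?thesis
    using True by simp
qed (use support in auto)

lemma amplitude_nonzero: "amplitude \<noteq> 0"
proof
  assume "amplitude = 0"
  then have "V = 0"
    by (simp add: vec_eq_iff V_nth)
  then have "mat 1 = (0 :: qmat)"
    using isometry by simp
  then have "mat 1 $ True $ True = (0 :: qmat) $ True $ True"
    by (rule arg_cong)
  then show False
    by (simp add: mat_nth)
qed

end

section \<open>The Steane code and the 15-qubit code\<close>

lemma mult_column: "(A ** V) $ x $ a = (A *v column a V) $ x"
  by (simp add: mult_nth mult_vec_nth column_def)

lemma matrix_eq_columns:
  assumes "\<And>a. A *v column a V = column a U"
  shows "A ** V = U"
  using assms by (simp add: vec_eq_iff mult_column) (simp add: column_def)

text \<open>The columns are orthogonal because they belong to different eigenvalues of the Hermitian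
  operator \<open>Z_on UNIV\<close>.\<close>

lemma encoding_isometry_matrix:
  assumes "encoding_isometry gens V"
  shows "adj V ** V = mat 1" "X_on UNIV ** V = V ** pauli_X" "Z_on UNIV ** V = V ** pauli_Z"
    "g \<in> gens \<Longrightarrow> g ** V = V"
proof -
  define v where "v a = column a V" for a
  have gens: "g *v v a = v a" if "g \<in> gens" for g a
    using assms that unfolding encoding_isometry_def Let_def v_def stabilized_space_def by (cases a) auto
  have norm: "norm (v a) = 1" for a
    using assms unfolding encoding_isometry_def Let_def v_def by (cases a) auto
  have Z: "Z_on UNIV *v v False = v False" "Z_on UNIV *v v True = - v True" and X: "X_on UNIV *v v False = v True"
    using assms unfolding encoding_isometry_def Let_def v_def by auto
  have X': "X_on UNIV *v v True = v False"
    unfolding X[symmetric] matrix_vector_mul_assoc X_on_square by simp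
  show "g ** V = V" if "g \<in> gens"
    by (rule matrix_eq_columns) (use gens[OF that] in \<open>simp add: v_def\<close>)
  show "X_on UNIV ** V = V ** pauli_X"
  proof (rule matrix_eq_columns)
    fix a
    have "column a (V ** pauli_X) = v (\<not> a)"
      by (cases a) (simp_all add: vec_eq_iff column_def v_def mult_nth UNIV_bool)
    then show "X_on UNIV *v column a V = column a (V ** pauli_X)"
      using X X' by (cases a) (simp_all add: v_def)
  qed
  show "Z_on UNIV ** V = V ** pauli_Z"
  proof (rule matrix_eq_columns)
    fix a
    have "column a (V ** pauli_Z) = (if a then - v a else v a)"
      by (cases a) (simp_all add: vec_eq_iff column_def v_def mult_nth UNIV_bool)
    then show "Z_on UNIV *v column a V = column a (V ** pauli_Z)"
      using Z by (cases a) (simp_all add: v_def)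
  qed
  have "cdot (v False) (v True) = cdot (Z_on UNIV *v v False) (v True)"
    by (simp add: Z)
  also have "\<dots> = cdot (v False) (- v True)"
    using cdot_adj[of "v False" "Z_on UNIV" "v True"] by (simp add: adj_Z_on Z)
  also have "\<dots> = - cdot (v False) (v True)"
    by (simp add: cdot_def sum_negf)
  finally have FT: "cdot (v False) (v True) = 0"
    by simp
  then have TF: "cdot (v True) (v False) = 0"
    by (metis cdot_commute complex_cnj_zero)
  have "(adj V ** V) $ a $ b = cdot (v a) (v b)" for a b
    by (simp add: mult_nth cdot_def v_def column_def)
  moreover have "cdot (v a) (v b) = mat 1 $ a $ b" for a b
    using norm FT TF by (cases a; cases b) (simp_all add: mat_nth norm_eq_1_iff)
  ultimately show "adj V ** V = mat 1"
    by (simp add: vec_eq_iff)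
qed

lemma steane_quantum_rm_code:
  assumes "bij_betw c UNIV {v. v \<noteq> 0}" "encoding_isometry (steane_generators c) V"
  shows "quantum_rm_code c V"
proof
  note iso = encoding_isometry_matrix[OF assms(2)]
  show "bij_betw c UNIV {v. v \<noteq> 0}" "3 \<le> CARD(3)" "adj V ** V = mat 1"
    "X_on UNIV ** V = V ** pauli_X" "Z_on UNIV ** V = V ** pauli_Z"
    using assms(1) iso by simp_all
  show "X_on {i. c i $ j = 1} ** V = V" for j
    by (rule iso(4)) (simp add: steane_generators_def)
  show "Z_on {i. \<forall>k\<in>S. c i $ k = 1} ** V = V" if "S \<noteq> {}" "card S + 2 \<le> CARD(3)" for S
  proof -
    have "card S \<noteq> 0" "card S \<le> 1"
      using that by simp_all
    then have "card S = 1"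
      by linarith
    then obtain j where "S = {j}"
      by (rule card_1_singletonE)
    then show ?thesis
      by (intro iso(4)) (simp add: steane_generators_def)
  qed
qed

lemma rm_quantum_rm_code:
  assumes "encoding_isometry rm_generators W"
  shows "quantum_rm_code rm_vec W"
proof
  note iso = encoding_isometry_matrix[OF assms]
  have "range rm_vec = {v. v \<noteq> 0}"
    using type_definition.Rep_range[OF type_definition_rm_qubit] .
  then show "bij_betw rm_vec UNIV {v. v \<noteq> 0}"
    by (simp add: bij_betw_def inj_def rm_vec_inject)
  show "3 \<le> CARD(4)" "adj W ** W = mat 1"
    "X_on UNIV ** W = W ** pauli_X" "Z_on UNIV ** W = W ** pauli_Z"
    using iso by simp_all
  show "X_on {i. rm_vec i $ j = 1} ** W = W" for j
    by (rule iso(4)) (simp add: rm_generators_def)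
  show "Z_on {i. \<forall>k\<in>S. rm_vec i $ k = 1} ** W = W" if "S \<noteq> {}" "card S + 2 \<le> CARD(4)" for S
  proof -
    have "card S \<noteq> 0" "card S \<le> 2"
      using that by simp_all
    then consider "card S = 1" | "card S = 2"
      by linarith
    then show ?thesis
    proof cases
      case 1
      then obtain j where "S = {j}"
        by (rule card_1_singletonE)
      then show ?thesis
        by (intro iso(4)) (simp add: rm_generators_def)
    next
      case 2
      then obtain i j where "S = {i, j}" "i \<noteq> j"
        by (auto simp: card_2_iff)
      then show ?thesis
        by (intro iso(4)) (auto simp: rm_generators_def)
    qed
  qed
qed

text \<open>Both encodings are uniform on the same words, so they differ only in their single
  amplitude; the isometry property makes the quotient a phase.\<close>

lemma quantum_rm_code_unique:
  assumes "quantum_rm_code c V" "quantum_rm_code c V'"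
  obtains z where "cmod z = 1" "V' = cscale z V"
proof -
  interpret V: quantum_rm_code c V
    by fact
  interpret V': quantum_rm_code c V'
    by fact
  define z where "z = V'.amplitude / V.amplitude"
  have V': "V' = cscale z V"
    using V.amplitude_nonzero by (simp add: vec_eq_iff V.V_nth V'.V_nth z_def)
  then have "adj V' ** V' = cscale (cnj z * z) (adj V ** V)"
    by (simp add: adj_cscale cscale_mult_left cscale_mult_right mult.commute)
  then have "(mat 1 :: qmat) $ True $ True = cscale (cnj z * z) (mat 1) $ True $ True"
    unfolding V.isometry V'.isometry by (rule arg_cong)
  then have "complex_of_real ((cmod z)\<^sup>2) = 1"
    unfolding complex_norm_square by (simp add: mat_nth mult.commute)
  then have "cmod z = 1"
    unfolding of_real_eq_1_iff by (metis abs_norm_cancel abs_square_eq_1)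
  then show thesis
    using that V' by blast
qed

lemma hadamard_eq: "hadamard = cscale (1 / of_real (sqrt 2)) (pauli_X + pauli_Z)"
  by (simp add: vec_eq_iff)

lemma hadamard_pauli: "hadamard ** pauli_X = pauli_Z ** hadamard" "hadamard ** pauli_Z = pauli_X ** hadamard"
  by (simp_all add: vec_eq_iff mult_nth UNIV_bool)

lemma
  fixes A :: "'q::finite set"
  shows hadamard_all_X: "X_on A ** tensor (\<lambda>_. hadamard) = tensor (\<lambda>_. hadamard) ** Z_on A"
  and hadamard_all_Z: "Z_on A ** tensor (\<lambda>_. hadamard) = tensor (\<lambda>_. hadamard) ** X_on A"
  unfolding X_on_def Z_on_def tensor_mult
  by (rule arg_cong[where f = tensor]; auto simp: hadamard_pauli)+

text \<open>With three rows, the X and the Z checks have the same supports, so that transversal Hadamard gates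
  preserve the code.\<close>

lemma transversal_hadamard:
  fixes c :: "'q::finite \<Rightarrow> bit ^ 'n"
  assumes "quantum_rm_code c V" and three: "CARD('n) = 3"
  obtains z where "cmod z = 1" "tensor (\<lambda>_. hadamard) ** V = cscale z (V ** hadamard)"
proof -
  interpret quantum_rm_code c V
    by fact
  define T where "T = (tensor (\<lambda>_. hadamard) :: 'q oper)"
  \<comment> \<open>X and Z are exchanged twice, physically on the left and logically on the right,
    so this is another encoding for the same code; uniqueness then compares it with
    \<open>V\<close>.\<close>
  define V' where "V' = T ** V ** hadamard"
  have T: "adj T ** T = mat 1"
    unfolding T_def adj_tensor tensor_mult adj_hadamard hadamard_square tensor_one ..
  have XT: "X_on A ** T = T ** Z_on A" and ZT: "Z_on A ** T = T ** X_on A" for A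
    unfolding T_def by (rule hadamard_all_X hadamard_all_Z)+
  have X': "X_on A ** V' = T ** (Z_on A ** V) ** hadamard" and Z': "Z_on A ** V' = T ** (X_on A ** V) ** hadamard" for A
    unfolding V'_def by (simp_all add: matrix_mul_assoc XT ZT)
  have "quantum_rm_code c V'"
  proof
    show "bij_betw c UNIV {v. v \<noteq> 0}" "3 \<le> CARD('n)"
      by (fact bij_c rows)+
    have "adj V' ** V' = hadamard ** (adj V ** (adj T ** T) ** V) ** hadamard"
      by (simp add: V'_def adj_mult adj_hadamard matrix_mul_assoc)
    then show "adj V' ** V' = mat 1"
      by (simp add: T isometry hadamard_square)
    show "X_on {i. c i $ j = 1} ** V' = V'" for j
      unfolding X' Z_check by (simp add: V'_def)
    show "Z_on {i. \<forall>k\<in>S. c i $ k = 1} ** V' = V'" if "S \<noteq> {}" "card S + 2 \<le> CARD('n)" for S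
    proof -
      have "card S \<noteq> 0" "card S \<le> 1"
        using that three by simp_all
      then have "card S = 1"
        by linarith
      then obtain j where "S = {j}"
        by (rule card_1_singletonE)
      then show ?thesis
        unfolding Z' by (simp add: X_check V'_def)
    qed
    show "X_on UNIV ** V' = V' ** pauli_X"
      unfolding X' logical_Z unfolding V'_def by (simp add: matrix_mul_assoc[symmetric] hadamard_pauli)
    show "Z_on UNIV ** V' = V' ** pauli_Z"
      unfolding Z' logical_X unfolding V'_def by (simp add: matrix_mul_assoc[symmetric] hadamard_pauli)
  qed
  then obtain z where z: "cmod z = 1" "V' = cscale z V"
    using quantum_rm_code_unique[OF assms(1)] by blast
  have "T ** V = V' ** hadamard"
    unfolding V'_def by (simp add: matrix_mul_assoc[symmetric] hadamard_square)
  then show thesis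
    using that z by (simp add: T_def cscale_mult_left)
qed

lemma card_bit: "CARD(bit) = 2"
proof -
  have "(UNIV :: bit set) = {0, 1}"
    using bit_not_one_iff by blast
  then show ?thesis
    by (metis card_2_iff zero_neq_one)
qed

text \<open>Adding a basis vector of a coordinate in \<open>J\<close> toggles the functional, so it
  takes both values equally often.\<close>

lemma card_linear_functional:
  fixes J :: "'n::finite set"
  assumes "J \<noteq> {}"
  shows "2 * card {v :: bit ^ 'n. (\<Sum>j\<in>J. v $ j) = 1} = 2 ^ CARD('n)"
proof -
  obtain j where j: "j \<in> J"
    using assms by blast
  have shift: "(\<Sum>k\<in>J. v $ k + axis j 1 $ k) = (\<Sum>k\<in>J. v $ k) + 1" for v :: "bit ^ 'n"
    using j by (simp add: sum.distrib axis_def)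
  let ?A = "\<lambda>b. {v :: bit ^ 'n. (\<Sum>j\<in>J. v $ j) = b}"
  have "v + axis j 1 + axis j 1 = v" for v :: "bit ^ 'n"
    by (simp only: add.assoc vec_bit_add_self add_0_right)
  then have "bij_betw (\<lambda>v. v + axis j 1) (?A 1) (?A 0)"
    by (intro bij_betw_byWitness[where f' = "\<lambda>v. v + axis j 1"]) (auto simp: shift)
  then have "card (?A 1) = card (?A 0)"
    by (rule bij_betw_same_card)
  moreover have "card (?A 1 \<union> ?A 0) = card (?A 1) + card (?A 0)"
    by (rule card_Un_disjoint) auto
  moreover have "?A 1 \<union> ?A 0 = UNIV"
    by auto
  ultimately show ?thesis
    by (simp add: card_bit)
qed

lemma range_rm_vec: "range rm_vec = UNIV - {0}"
  using type_definition.Rep_range[OF type_definition_rm_qubit] by auto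

lemma inj_rm_vec: "inj rm_vec"
  by (simp add: inj_def rm_vec_inject)

lemma card_rm_qubit: "CARD(rm_qubit) = 15"
proof -
  have "CARD(rm_qubit) = card (range rm_vec)"
    using inj_rm_vec by (simp add: card_image)
  also have "\<dots> = 15"
    unfolding range_rm_vec by (simp add: card_Diff_singleton card_bit)
  finally show ?thesis .
qed

text \<open>The weights are 0 or 8 for logical 0 and, for the complements among 15 positions, 15 or
  7 for logical 1. Modulo 8 only the logical value remains.\<close>

lemma rm_codeword_weight:
  fixes w :: complex
  assumes "quantum_rm_code rm_vec W" "x \<in> quantum_rm_code.code rm_vec a" "w ^ 8 = 1"
  shows "w ^ card {v. x v} = (if a then w ^ 7 else 1)"
proof -
  interpret quantum_rm_code rm_vec W
    by fact
  obtain J where x: "x v = (a \<noteq> ((\<Sum>j\<in>J. rm_vec v $ j) = 1))" for v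
    using assms(2) unfolding code_def codeword_def by auto
  note range = range_rm_vec and inj = inj_rm_vec and total = card_rm_qubit
  have w15: "w ^ 15 = w ^ 7"
    using assms(3) power_add[of w 8 7] by simp
  let ?B = "{v. (\<Sum>j\<in>J. rm_vec v $ j) = 1}"
  show ?thesis
  proof (cases "J = {}")
    case True
    then show ?thesis
      by (cases a) (simp_all add: x total w15)
  next
    case False
    have "rm_vec ` ?B = {v. (\<Sum>j\<in>J. v $ j) = 1}"
    proof -
      have "v \<in> rm_vec ` ?B" if "(\<Sum>j\<in>J. v $ j) = 1" for v
      proof -
        have "v \<noteq> 0"
          using that by auto
        then have "v \<in> range rm_vec"
          using range by blast
        then show ?thesis
          using that by auto
      qed
      then show ?thesis
        by auto
    qed
    then have "card ?B = card {v :: bit ^ 4. (\<Sum>j\<in>J. v $ j) = 1}"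
      using inj by (metis card_image inj_on_subset subset_UNIV)
    then have B: "card ?B = 8"
      using card_linear_functional[OF False] by simp
    show ?thesis
    proof (cases a)
      case True
      have "{v. x v} = UNIV - ?B"
        using True by (auto simp: x)
      then have "card {v. x v} = 7"
        using card_Diff_subset[of ?B UNIV] by (simp add: B total)
      then show ?thesis
        using True by simp
    next
      case False
      then show ?thesis
        using B assms(3) by (simp add: x)
    qed
  qed
qed

section \<open>A logical Hadamard circuit\<close>

lemma permutation_X_on:
  assumes "\<And>x. \<sigma> (flip A x) = flip B (\<sigma> x)"
  shows "permutation_gate \<sigma> ** X_on A = X_on B ** permutation_gate \<sigma>"
proof -
  have "(permutation_gate \<sigma> ** X_on A) $ x $ y = (X_on B ** permutation_gate \<sigma>) $ x $ y" for x y
  proof -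
    have "(permutation_gate \<sigma> ** X_on A) $ x $ y = (\<Sum>u\<in>UNIV. if u = flip A y then if x = \<sigma> u then 1 else 0 else 0)"
      unfolding mult_nth by (intro sum.cong refl) (auto simp: X_on_nth flip_flip)
    also have "\<dots> = (if x = flip B (\<sigma> y) then 1 else 0)"
      by (simp add: assms)
    also have "\<dots> = (X_on B ** permutation_gate \<sigma>) $ x $ y"
      unfolding X_on_mult_nth permutation_gate_nth using flip_flip by metis
    finally show ?thesis .
  qed
  then show ?thesis
    by (simp add: vec_eq_iff)
qed

lemma permutation_Z_on:
  assumes "\<And>x. parity_sign A x = parity_sign B (\<sigma> x)"
  shows "permutation_gate \<sigma> ** Z_on A = Z_on B ** permutation_gate \<sigma>"
proof -
  have "(permutation_gate \<sigma> ** Z_on A) $ x $ y = (Z_on B ** permutation_gate \<sigma>) $ x $ y" for x y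
  proof -
    have "(permutation_gate \<sigma> ** Z_on A) $ x $ y =
        (\<Sum>u\<in>UNIV. if u = y then if x = \<sigma> u then of_real (parity_sign A u) else 0 else 0)"
      unfolding mult_nth by (intro sum.cong refl) (auto simp: Z_on_eq_diagonal)
    then show ?thesis
      by (simp add: Z_on_mult_nth assms)
  qed
  then show ?thesis
    by (simp add: vec_eq_iff)
qed

lemma circuit_adj: "circuit (map adj (rev gs)) = adj (circuit gs)"
  by (induction gs) (simp_all add: circuit_Cons circuit_append adj_mult)

text \<open>A CNOT copies an X from its control to its target and a Z from its target to its
  control; this and the next three lemmas iterate these rules.\<close>

lemma cnot_fan_out_X:
  assumes "distinct js" "q \<notin> set js"
  shows "circuit (map (\<lambda>j. permutation_gate (cnot_map q j)) js) ** X_on {q} =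
    X_on (insert q (set js)) ** circuit (map (\<lambda>j. permutation_gate (cnot_map q j)) js)"
  using assms
proof (induction js rule: rev_induct)
  case (snoc j js)
  let ?C = "circuit (map (\<lambda>j. permutation_gate (cnot_map q j)) js)" and ?P = "permutation_gate (cnot_map q j)"
  have "cnot_map q j (flip (insert q (set js)) x) = flip (insert q (set (js @ [j]))) (cnot_map q j x)" for x
    using snoc.prems by (intro ext) (auto simp: cnot_map_def flip_def)
  then have "?P ** X_on (insert q (set js)) = X_on (insert q (set (js @ [j]))) ** ?P"
    by (rule permutation_X_on)
  then have "?P ** (?C ** X_on {q}) = X_on (insert q (set (js @ [j]))) ** (?P ** ?C)"
    using snoc by (simp add: matrix_mul_assoc)
  then show ?case
    by (simp add: circuit_append circuit_Cons matrix_mul_assoc)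
qed simp

lemma cnot_fan_out_Z:
  assumes "q \<notin> set js"
  shows "circuit (map (\<lambda>j. permutation_gate (cnot_map q j)) js) ** Z_on {q} =
    Z_on {q} ** circuit (map (\<lambda>j. permutation_gate (cnot_map q j)) js)"
  using assms
proof (induction js rule: rev_induct)
  case (snoc j js)
  let ?C = "circuit (map (\<lambda>j. permutation_gate (cnot_map q j)) js)" and ?P = "permutation_gate (cnot_map q j)"
  have "parity_sign {q} x = parity_sign {q} (cnot_map q j x)" for x
    using snoc.prems by (simp add: parity_sign_def cnot_map_def)
  then have "?P ** Z_on {q} = Z_on {q} ** ?P"
    by (rule permutation_Z_on)
  then have "?P ** (?C ** Z_on {q}) = Z_on {q} ** (?P ** ?C)"
    using snoc by (simp add: matrix_mul_assoc)
  then show ?case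
    by (simp add: circuit_append circuit_Cons matrix_mul_assoc)
qed simp

text \<open>Every gate has an X on its control and so toggles the X on the common target
  \<open>q\<close>; only the parity of the number of gates matters.\<close>

lemma cnot_fan_in_X:
  assumes "q \<notin> set js"
  shows "circuit (map (\<lambda>j. permutation_gate (cnot_map j q)) js) ** X_on UNIV =
    X_on (if even (length js) then UNIV else - {q}) ** circuit (map (\<lambda>j. permutation_gate (cnot_map j q)) js)"
  using assms
proof (induction js rule: rev_induct)
  case (snoc j js)
  let ?C = "circuit (map (\<lambda>j. permutation_gate (cnot_map j q)) js)" and ?P = "permutation_gate (cnot_map j q)"
  let ?A = "\<lambda>js. if even (length js) then UNIV else - {q}"
  have "cnot_map j q (flip (?A js) x) = flip (?A (js @ [j])) (cnot_map j q x)" for x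
    using snoc.prems by (intro ext) (auto simp: cnot_map_def flip_def)
  then have P: "?P ** X_on (?A js) = X_on (?A (js @ [j])) ** ?P"
    by (rule permutation_X_on)
  have "?C ** X_on UNIV = X_on (?A js) ** ?C"
    by (rule snoc.IH) (use snoc.prems in simp)
  then have "?P ** (?C ** X_on UNIV) = (?P ** X_on (?A js)) ** ?C"
    by (simp only: matrix_mul_assoc)
  then have "?P ** (?C ** X_on UNIV) = X_on (?A (js @ [j])) ** (?P ** ?C)"
    unfolding P by (simp only: matrix_mul_assoc)
  then show ?case
    by (simp only: circuit_append circuit_Cons map_append list.map circuit_Nil matrix_mul_lid matrix_mul_assoc)
qed simp

lemma cnot_fan_in_Z:
  assumes "distinct js" "q \<notin> set js"
  shows "circuit (map (\<lambda>j. permutation_gate (cnot_map j q)) js) ** Z_on {q} =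
    Z_on (insert q (set js)) ** circuit (map (\<lambda>j. permutation_gate (cnot_map j q)) js)"
  using assms
proof (induction js rule: rev_induct)
  case (snoc j js)
  let ?C = "circuit (map (\<lambda>j. permutation_gate (cnot_map j q)) js)" and ?P = "permutation_gate (cnot_map j q)"
  have "insert j (insert q (set js)) = insert q (set (js @ [j]))"
    by auto
  moreover have "parity_sign (insert q (set js)) x = parity_sign (insert j (insert q (set js))) (cnot_map j q x)" for x
    using snoc.prems by (intro parity_sign_cnot) auto
  then have "?P ** Z_on (insert q (set js)) = Z_on (insert j (insert q (set js))) ** ?P"
    by (rule permutation_Z_on)
  ultimately have "?P ** (?C ** Z_on {q}) = Z_on (insert q (set (js @ [j]))) ** (?P ** ?C)"
    using snoc by (simp add: matrix_mul_assoc)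
  then show ?case
    by (simp add: circuit_append circuit_Cons matrix_mul_assoc)
qed simp

text \<open>CNOT gates conjugate the Pauli operators of one qubit into those on all qubits, since the number
  of the other qubits is even.\<close>

lemma logical_hadamard_circuit:
  assumes "odd CARD('q::finite)"
  obtains gs :: "('q::finite) oper list" where "\<And>g. g \<in> set gs \<Longrightarrow> unitary g \<and> (\<exists>B. card B \<le> 3 \<and> acts_on B g)"
    "circuit gs = cscale (1 / of_real (sqrt 2)) (X_on UNIV + Z_on UNIV)"
proof -
  obtain q :: 'q where True
    by blast
  obtain js where js: "set js = UNIV - {q}" "distinct js"
    using finite_distinct_list[of "UNIV - {q}"] by auto
  have q: "q \<notin> set js" and UNIV: "insert q (set js) = UNIV"
    using js by auto
  have "length js = CARD('q) - 1"
    using js distinct_card[of js] by (simp add: card_Diff_singleton)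
  then have even: "even (length js)"
    using assms by simp
  define fan_out where "fan_out = map (\<lambda>j. permutation_gate (cnot_map q j)) js"
  define fan_in where "fan_in = map (\<lambda>j. permutation_gate (cnot_map j q)) js"
  define C where "C = circuit (fan_out @ fan_in)"
  \<comment> \<open>Lists are executed from the head, so the inverse CNOT gates come first: the
    circuit conjugates one physical Hadamard gate by \<open>C\<close>.\<close>
  define gs where "gs = map adj (rev (fan_out @ fan_in)) @ [site q hadamard] @ fan_out @ fan_in"
  have cnots: "unitary g \<and> (\<exists>B. card B \<le> 3 \<and> acts_on B g) \<and> unitary (adj g) \<and> (\<exists>B. card B \<le> 3 \<and> acts_on B (adj g))"
    if g: "g \<in> set (fan_out @ fan_in)" for g
  proof -
    obtain p r where pr: "p \<noteq> r" "g = permutation_gate (cnot_map p r)"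
    proof -
      obtain j where j: "j \<in> set js"
        and "g = permutation_gate (cnot_map q j) \<or> g = permutation_gate (cnot_map j q)"
        using g by (auto simp: fan_out_def fan_in_def)
      then show ?thesis
        using that[of q j] that[of j q] q by blast
    qed
    have "unitary g"
      unfolding pr(2) by (rule permutation_gate_unitary[OF inj_cnot_map[OF pr(1)]])
    moreover have "adj g = g"
    proof -
      have "x = cnot_map p r y \<longleftrightarrow> y = cnot_map p r x" for x y
        using pr(1) by (auto simp: cnot_map_def fun_eq_iff)
      then show ?thesis
        unfolding pr(2) by (simp add: vec_eq_iff if_distrib[of cnj] cong: if_cong)
    qed
    moreover have "acts_on {p, r} g" "card {p, r} \<le> 3"
      unfolding pr(2) using acts_on_cnot pr(1) by auto
    ultimately show ?thesis
      by metis
  qed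
  have "unitary g \<and> (\<exists>B. card B \<le> 3 \<and> acts_on B g)" if g: "g \<in> set gs" for g
  proof -
    consider "g = site q hadamard" | "g \<in> set (fan_out @ fan_in)" | h where "g = adj h" "h \<in> set (fan_out @ fan_in)"
      using g unfolding gs_def by auto
    then show ?thesis
    proof cases
      case 1
      have "acts_on {q} g" "card {q} \<le> 3"
        using 1 acts_on_site by simp_all
      then show ?thesis
        using 1 site_unitary[OF hadamard_unitary] by blast
    qed (use cnots in blast)+
  qed
  moreover have "circuit gs = cscale (1 / of_real (sqrt 2)) (X_on UNIV + Z_on UNIV)"
  proof -
    have C_eq: "C = circuit fan_in ** circuit fan_out"
      by (simp add: C_def circuit_append)
    have CX: "C ** X_on {q} = X_on UNIV ** C"
    proof -
      have "C ** X_on {q} = circuit fan_in ** (X_on UNIV ** circuit fan_out)"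
        unfolding C_eq matrix_mul_assoc[symmetric] fan_out_def cnot_fan_out_X[OF js(2) q] UNIV ..
      then show ?thesis
        using cnot_fan_in_X[OF q] even by (simp add: C_eq fan_in_def matrix_mul_assoc)
    qed
    have CZ: "C ** Z_on {q} = Z_on UNIV ** C"
    proof -
      have "C ** Z_on {q} = circuit fan_in ** (Z_on {q} ** circuit fan_out)"
        unfolding C_eq matrix_mul_assoc[symmetric] fan_out_def cnot_fan_out_Z[OF q] ..
      then show ?thesis
        using cnot_fan_in_Z[OF js(2) q] UNIV by (simp add: C_eq fan_in_def matrix_mul_assoc)
    qed
    have "unitary C"
      unfolding C_def by (rule circuit_unitary) (use cnots in blast)
    then have CC: "C ** adj C = mat 1"
      by (simp add: unitary_def)
    have "site q pauli_X = X_on {q}" "site q pauli_Z = Z_on {q}"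
      by (simp_all add: site_def X_on_def Z_on_def)
    then have "site q hadamard = cscale (1 / of_real (sqrt 2)) (X_on {q} + Z_on {q})"
      unfolding hadamard_eq site_cscale site_add by (rule arg_cong2[where f = "\<lambda>A B. cscale _ (A + B)"])
    moreover have "circuit gs = C ** (site q hadamard ** adj C)"
      unfolding gs_def C_def by (simp only: circuit_append circuit_adj circuit_Cons circuit_Nil matrix_mul_lid matrix_mul_assoc)
    ultimately have "circuit gs = cscale (1 / of_real (sqrt 2)) ((C ** X_on {q} + C ** Z_on {q}) ** adj C)"
      by (simp add: cscale_mult_left cscale_mult_right matrix_add_ldistrib matrix_add_rdistrib matrix_mul_assoc)
    also have "\<dots> = cscale (1 / of_real (sqrt 2)) ((X_on UNIV + Z_on UNIV) ** (C ** adj C))"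
      unfolding CX CZ by (simp add: matrix_add_rdistrib matrix_mul_assoc)
    finally show ?thesis
      unfolding CC by simp
  qed
  ultimately show thesis
    by (rule that)
qed

section \<open>The concatenated code and its recovery\<close>

section \<open>Operators that act on each location of the outer code separately\<close>

text \<open>One factor for each qubit of the outer code, an encoding-shaped map for a further
  encoded qubit and a one-qubit matrix for a bare one. Unlike \<open>inner_encoding\<close>, this
  family is closed under multiplication by local operators.\<close>

definition location_tensor :: "('b::finite \<Rightarrow> complex ^ bool ^ ('v::finite \<Rightarrow> bool)) \<Rightarrow> ('i::finite \<Rightarrow> qmat)
    \<Rightarrow> complex ^ ('b + 'i \<Rightarrow> bool) ^ ('b \<times> 'v + 'i \<Rightarrow> bool)"
  where "location_tensor N B = (\<chi> x s. (\<Prod>b\<in>UNIV. N b $ (\<lambda>v. x (Inl (b, v))) $ s (Inl b)) *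
    (\<Prod>i\<in>UNIV. B i $ x (Inr i) $ s (Inr i)))"

lemma location_tensor_nth: "location_tensor N B $ x $ s =
    (\<Prod>b\<in>UNIV. N b $ (\<lambda>v. x (Inl (b, v))) $ s (Inl b)) * (\<Prod>i\<in>UNIV. B i $ x (Inr i) $ s (Inr i))"
  by (simp add: location_tensor_def)

lemma inner_encoding_eq: "inner_encoding W = location_tensor (\<lambda>_. W) (\<lambda>_. mat 1)"
proof -
  have "(\<Prod>i\<in>UNIV. mat 1 $ x (Inr i) $ y (Inr i)) = (if \<forall>i. x (Inr i) = y (Inr i) then 1 else (0 :: complex))"
    for x :: "qubit49 \<Rightarrow> bool" and y :: "steane_qubit \<Rightarrow> bool"
    by (auto simp: mat_nth)
  then show ?thesis
    unfolding inner_encoding_def location_tensor_def by simp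
qed

lemma prod_Plus: "(\<Prod>p\<in>UNIV. f p) = (\<Prod>a\<in>UNIV. f (Inl a)) * (\<Prod>b\<in>UNIV. f (Inr b))"
  for f :: "'a::finite + 'b::finite \<Rightarrow> complex"
  unfolding UNIV_Plus_UNIV[symmetric] by (subst prod.Plus) simp_all

lemma prod_Times: "(\<Prod>p\<in>UNIV. f p) = (\<Prod>a\<in>UNIV. \<Prod>b\<in>UNIV. f (a, b))"
  for f :: "'a::finite \<times> 'b::finite \<Rightarrow> complex"
  by (simp add: prod.cartesian_product UNIV_Times_UNIV[symmetric] del: UNIV_Times_UNIV)

lemma sum_locations:
  fixes F :: "('b::finite \<Rightarrow> 'v::finite \<Rightarrow> bool) \<Rightarrow> ('i::finite \<Rightarrow> bool) \<Rightarrow> complex"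
  shows "(\<Sum>x\<in>UNIV. F (\<lambda>b v. x (Inl (b, v))) (\<lambda>i. x (Inr i))) = (\<Sum>g\<in>UNIV. \<Sum>h\<in>UNIV. F g h)"
proof -
  have "(\<Sum>x\<in>UNIV. F (\<lambda>b v. x (Inl (b, v))) (\<lambda>i. x (Inr i))) = (\<Sum>(g, h)\<in>UNIV. F g h)"
    by (rule sum.reindex_bij_witness[of _ "\<lambda>(g, h). case_sum (case_prod g) h"
          "\<lambda>x. (\<lambda>b v. x (Inl (b, v)), \<lambda>i. x (Inr i))"]) (auto simp: fun_eq_iff split: sum.split)
  then show ?thesis
    by (simp add: sum.cartesian_product UNIV_Times_UNIV[symmetric] del: UNIV_Times_UNIV)
qed

lemma sum_labels:
  fixes F :: "('b::finite \<Rightarrow> bool) \<Rightarrow> ('i::finite \<Rightarrow> bool) \<Rightarrow> complex"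
  shows "(\<Sum>x\<in>UNIV. F (\<lambda>b. x (Inl b)) (\<lambda>i. x (Inr i))) = (\<Sum>g\<in>UNIV. \<Sum>h\<in>UNIV. F g h)"
proof -
  have "(\<Sum>x\<in>UNIV. F (\<lambda>b. x (Inl b)) (\<lambda>i. x (Inr i))) = (\<Sum>(g, h)\<in>UNIV. F g h)"
    by (rule sum.reindex_bij_witness[of _ "\<lambda>(g, h). case_sum g h"
          "\<lambda>x. (\<lambda>b. x (Inl b), \<lambda>i. x (Inr i))"]) (auto simp: fun_eq_iff split: sum.split)
  then show ?thesis
    by (simp add: sum.cartesian_product UNIV_Times_UNIV[symmetric] del: UNIV_Times_UNIV)
qed

lemma tensor_location_tensor: "tensor M ** location_tensor N B =
    location_tensor (\<lambda>b. tensor (\<lambda>v. M (Inl (b, v))) ** N b) (\<lambda>i. M (Inr i) ** B i)" (is "?L = ?R")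
proof -
  have "?L $ x $ s = ?R $ x $ s" for x s
  proof -
    have "?L $ x $ s = (\<Sum>u\<in>UNIV.
        (\<Prod>b\<in>UNIV. tensor (\<lambda>v. M (Inl (b, v))) $ (\<lambda>v. x (Inl (b, v))) $ (\<lambda>v. u (Inl (b, v))) *
          N b $ (\<lambda>v. u (Inl (b, v))) $ s (Inl b)) *
        (\<Prod>i\<in>UNIV. M (Inr i) $ x (Inr i) $ u (Inr i) * B i $ u (Inr i) $ s (Inr i)))"
      unfolding mult_nth tensor_nth location_tensor_nth prod_Plus prod_Times prod.distrib
      by (intro sum.cong refl) (simp only: ac_simps)
    also have "\<dots> = (\<Sum>g\<in>UNIV. \<Sum>h\<in>UNIV.
        (\<Prod>b\<in>UNIV. tensor (\<lambda>v. M (Inl (b, v))) $ (\<lambda>v. x (Inl (b, v))) $ g b * N b $ g b $ s (Inl b)) *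
        (\<Prod>i\<in>UNIV. M (Inr i) $ x (Inr i) $ h i * B i $ h i $ s (Inr i)))"
      by (rule sum_locations)
    finally show ?thesis
      unfolding location_tensor_nth mult_nth prod_sum_fun sum_product .
  qed
  then show ?thesis
    by (simp add: vec_eq_iff)
qed

lemma location_tensor_mult_tensor: "location_tensor N B ** tensor A =
    location_tensor (\<lambda>b. N b ** A (Inl b)) (\<lambda>i. B i ** A (Inr i))" (is "?L = ?R")
proof -
  have "?L $ x $ s = ?R $ x $ s" for x s
  proof -
    have "?L $ x $ s = (\<Sum>u\<in>UNIV.
        (\<Prod>b\<in>UNIV. N b $ (\<lambda>v. x (Inl (b, v))) $ u (Inl b) * A (Inl b) $ u (Inl b) $ s (Inl b)) *
        (\<Prod>i\<in>UNIV. B i $ x (Inr i) $ u (Inr i) * A (Inr i) $ u (Inr i) $ s (Inr i)))"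
      unfolding mult_nth tensor_nth location_tensor_nth prod_Plus prod.distrib
      by (intro sum.cong refl) (simp only: ac_simps)
    also have "\<dots> = (\<Sum>g\<in>UNIV. \<Sum>h\<in>UNIV.
        (\<Prod>b\<in>UNIV. N b $ (\<lambda>v. x (Inl (b, v))) $ g b * A (Inl b) $ g b $ s (Inl b)) *
        (\<Prod>i\<in>UNIV. B i $ x (Inr i) $ h i * A (Inr i) $ h i $ s (Inr i)))"
      by (rule sum_labels)
    finally show ?thesis
      unfolding location_tensor_nth mult_nth prod_sum_fun sum_product .
  qed
  then show ?thesis
    by (simp add: vec_eq_iff)
qed

lemma adj_location_tensor_mult: "adj (location_tensor N B) ** location_tensor N' B' =
    tensor (case_sum (\<lambda>b. adj (N b) ** N' b) (\<lambda>i. adj (B i) ** B' i))" (is "?L = ?R")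
proof -
  have "?L $ s $ t = ?R $ s $ t" for s t
  proof -
    have "?L $ s $ t = (\<Sum>u\<in>UNIV.
        (\<Prod>b\<in>UNIV. cnj (N b $ (\<lambda>v. u (Inl (b, v))) $ s (Inl b)) * N' b $ (\<lambda>v. u (Inl (b, v))) $ t (Inl b)) *
        (\<Prod>i\<in>UNIV. cnj (B i $ u (Inr i) $ s (Inr i)) * B' i $ u (Inr i) $ t (Inr i)))"
      unfolding mult_nth adj_nth location_tensor_nth prod.distrib complex_cnj_mult cnj_prod
      by (intro sum.cong refl) (simp only: ac_simps)
    also have "\<dots> = (\<Sum>g\<in>UNIV. \<Sum>h\<in>UNIV.
        (\<Prod>b\<in>UNIV. cnj (N b $ g b $ s (Inl b)) * N' b $ g b $ t (Inl b)) *
        (\<Prod>i\<in>UNIV. cnj (B i $ h i $ s (Inr i)) * B' i $ h i $ t (Inr i)))"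
      by (rule sum_locations)
    finally show ?thesis
      unfolding tensor_nth prod_Plus mult_nth adj_nth sum.case prod_sum_fun sum_product .
  qed
  then show ?thesis
    by (simp add: vec_eq_iff)
qed

lemma location_tensor_mult_adj: "(location_tensor N B ** adj (location_tensor N' B')) $ x $ y =
    (\<Prod>b\<in>UNIV. (N b ** adj (N' b)) $ (\<lambda>v. x (Inl (b, v))) $ (\<lambda>v. y (Inl (b, v)))) *
    (\<Prod>i\<in>UNIV. (B i ** adj (B' i)) $ x (Inr i) $ y (Inr i))"
proof -
  have "(location_tensor N B ** adj (location_tensor N' B')) $ x $ y = (\<Sum>u\<in>UNIV.
      (\<Prod>b\<in>UNIV. N b $ (\<lambda>v. x (Inl (b, v))) $ u (Inl b) * cnj (N' b $ (\<lambda>v. y (Inl (b, v))) $ u (Inl b))) *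
      (\<Prod>i\<in>UNIV. B i $ x (Inr i) $ u (Inr i) * cnj (B' i $ y (Inr i) $ u (Inr i))))"
    unfolding mult_nth adj_nth location_tensor_nth prod.distrib complex_cnj_mult cnj_prod
    by (intro sum.cong refl) (simp only: ac_simps)
  also have "\<dots> = (\<Sum>g\<in>UNIV. \<Sum>h\<in>UNIV.
      (\<Prod>b\<in>UNIV. N b $ (\<lambda>v. x (Inl (b, v))) $ g b * cnj (N' b $ (\<lambda>v. y (Inl (b, v))) $ g b)) *
      (\<Prod>i\<in>UNIV. B i $ x (Inr i) $ h i * cnj (B' i $ y (Inr i) $ h i)))"
    by (rule sum_labels)
  finally show ?thesis
    unfolding mult_nth adj_nth prod_sum_fun sum_product .
qed

definition in_block :: "'b \<Rightarrow> 'v \<Rightarrow> 'b \<times> 'v + 'i"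
  where "in_block b v = Inl (b, v)"

lemma inj_in_block: "inj (in_block b)"
  by (simp add: inj_def in_block_def)

lemma override_in_block:
  fixes x :: "'b \<times> 'v + 'i \<Rightarrow> bool"
  shows "override (in_block b) a x (Inl (d, v)) = (if d = b then a v else x (Inl (d, v)))"
    "override (in_block b) a x (Inr i) = x (Inr i)"
proof -
  show "override (in_block b) a x (Inl (d, v)) = (if d = b then a v else x (Inl (d, v)))"
  proof (cases "d = b")
    case True
    then show ?thesis
      using fun_cong[OF override_comp[OF inj_in_block, of b a x], of v] by (simp add: in_block_def)
  next
    case False
    then have "Inl (d, v) \<notin> range (in_block b :: 'v \<Rightarrow> 'b \<times> 'v + 'i)"
      by (auto simp: in_block_def)
    then show ?thesis
      using False by (simp add: override_other)
  qed
  have "Inr i \<notin> range (in_block b :: 'v \<Rightarrow> 'b \<times> 'v + 'i)"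
    by (auto simp: in_block_def)
  then show "override (in_block b) a x (Inr i) = x (Inr i)"
    by (simp add: override_other)
qed

lemma embed_location_tensor:
  "embed_gate (in_block b) U ** location_tensor N B = location_tensor (N(b := U ** N b)) B" (is "?L = ?R")
proof -
  have "?L $ x $ s = ?R $ x $ s" for x s
  proof -
    let ?rest = "(\<Prod>d\<in>UNIV - {b}. N d $ (\<lambda>v. x (Inl (d, v))) $ s (Inl d)) * (\<Prod>i\<in>UNIV. B i $ x (Inr i) $ s (Inr i))"
    have split: "location_tensor N B $ override (in_block b) a x $ s = N b $ a $ s (Inl b) * ?rest" for a
    proof -
      have "(\<Prod>d\<in>UNIV. N d $ (\<lambda>v. override (in_block b) a x (Inl (d, v))) $ s (Inl d)) =
          N b $ a $ s (Inl b) * (\<Prod>d\<in>UNIV - {b}. N d $ (\<lambda>v. x (Inl (d, v))) $ s (Inl d))"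
        by (subst prod.remove[of _ b]) (auto simp: override_in_block intro!: prod.cong)
      then show ?thesis
        unfolding location_tensor_nth override_in_block(2) by (simp only: mult.assoc)
    qed
    have "?L $ x $ s = (\<Sum>a\<in>UNIV. U $ (x \<circ> in_block b) $ a * location_tensor N B $ override (in_block b) a x $ s)"
      unfolding mult_nth by (rule sum_embed_gate[OF inj_in_block])
    also have "\<dots> = (\<Sum>a\<in>UNIV. U $ (x \<circ> in_block b) $ a * N b $ a $ s (Inl b)) * ?rest"
      unfolding split sum_distrib_right by (simp only: mult.assoc)
    also have "\<dots> = (U ** N b) $ (\<lambda>v. x (Inl (b, v))) $ s (Inl b) * ?rest"
      by (simp add: mult_nth comp_def in_block_def)
    also have "\<dots> = ?R $ x $ s"
    proof -
      have "(\<Prod>d\<in>UNIV. (N(b := U ** N b)) d $ (\<lambda>v. x (Inl (d, v))) $ s (Inl d)) =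
          (U ** N b) $ (\<lambda>v. x (Inl (b, v))) $ s (Inl b) * (\<Prod>d\<in>UNIV - {b}. N d $ (\<lambda>v. x (Inl (d, v))) $ s (Inl d))"
        by (subst prod.remove[of _ b]) (auto intro!: prod.cong)
      then show ?thesis
        unfolding location_tensor_nth by (simp only: mult.assoc)
    qed
    finally show ?thesis .
  qed
  then show ?thesis
    by (simp add: vec_eq_iff)
qed

lemma site_Inr_location_tensor:
  "site (Inr i) A ** location_tensor N B = location_tensor N (B(i := A ** B i))"
proof -
  have "site (Inr i) A ** location_tensor N B =
      location_tensor (\<lambda>b. tensor (\<lambda>v. mat 1) ** N b) (B(i := A ** B i))"
    unfolding site_def tensor_location_tensor by (rule arg_cong2[where f = location_tensor]) auto
  then show ?thesis
    by (simp add: tensor_one)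
qed

section \<open>Recovery for the concatenated code\<close>

type_synonym 'q syndrome = "('q option \<times> 'q option) + ('q \<Rightarrow> bool)"

text \<open>Decoders map a block to a qubit, opposite to the direction of
  \<open>location_tensor\<close>, hence the two adjoints; each block has its own syndrome.\<close>

definition block_decoder :: "complex ^ bool ^ ('v::finite \<Rightarrow> bool) \<Rightarrow> ('b::finite \<Rightarrow> 'v syndrome)
    \<Rightarrow> complex ^ ('b \<times> 'v + 'i::finite \<Rightarrow> bool) ^ ('b + 'i \<Rightarrow> bool)"
  where "block_decoder W e = adj (location_tensor (\<lambda>b. adj (decoder W (e b))) (\<lambda>_. mat 1))"

definition concatenated_recovery ::
    "complex ^ bool ^ ('b::finite + 'i::finite \<Rightarrow> bool) \<Rightarrow> complex ^ bool ^ ('v::finite \<Rightarrow> bool) \<Rightarrow>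
      ('b + 'i) syndrome \<times> ('b \<Rightarrow> 'v syndrome) \<Rightarrow> ('b \<times> 'v + 'i) oper"
  where "concatenated_recovery V W k =
    location_tensor (\<lambda>_. W) (\<lambda>_. mat 1) ** V ** decoder V (fst k) ** block_decoder W (snd k)"

locale concatenated_code =
  outer: check_code c V + inner: check_code d W
  for c :: "'b::finite + 'i::finite \<Rightarrow> bit ^ 'm" and V
    and d :: "'v::finite \<Rightarrow> bit ^ 'n" and W
begin

abbreviation encoding :: "complex ^ bool ^ ('b \<times> 'v + 'i \<Rightarrow> bool)"
  where "encoding \<equiv> location_tensor (\<lambda>_. W) (\<lambda>_. mat 1) ** V"

lemma location_isometry:
  "adj (location_tensor (\<lambda>_. W) (\<lambda>_. mat 1)) ** location_tensor (\<lambda>_. W) (\<lambda>_. mat 1) = (mat 1 :: ('b + 'i) oper)"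
proof -
  have "case_sum (\<lambda>_. adj W ** W) (\<lambda>_. adj (mat 1) ** mat 1) = (\<lambda>_ :: 'b + 'i. mat 1)"
    by (auto simp: fun_eq_iff inner.isometry split: sum.split)
  then show ?thesis
    by (simp only: adj_location_tensor_mult tensor_one)
qed

lemma encoding_isometry: "adj encoding ** encoding = mat 1"
proof -
  have "adj encoding ** encoding = adj V ** (adj (location_tensor (\<lambda>_. W) (\<lambda>_. mat 1)) **
      location_tensor (\<lambda>_. W) (\<lambda>_. mat 1)) ** V"
    by (simp only: adj_mult matrix_mul_assoc)
  then show ?thesis
    unfolding location_isometry by (simp add: outer.isometry)
qed

text \<open>The sum over tuples of syndromes is a product over the blocks, and each factor is the
  identity because a single decoder is complete.\<close>

lemma block_decoder_complete:
  "(\<Sum>e\<in>UNIV. adj (block_decoder W e) ** block_decoder W e) = (mat 1 :: ('b \<times> 'v + 'i) oper)"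
proof -
  have "(\<Sum>e\<in>UNIV. adj (block_decoder W e) ** block_decoder W e) $ x $ y = (mat 1 :: ('b \<times> 'v + 'i) oper) $ x $ y" for x y
  proof -
    have "(\<Sum>e\<in>UNIV. adj (block_decoder W e) ** block_decoder W e) $ x $ y =
        (\<Sum>e\<in>UNIV. \<Prod>b\<in>UNIV. (adj (decoder W (e b)) ** decoder W (e b)) $ (\<lambda>v. x (Inl (b, v))) $ (\<lambda>v. y (Inl (b, v)))) *
        (\<Prod>i\<in>UNIV. if x (Inr i) = y (Inr i) then 1 else 0)"
      by (simp add: block_decoder_def location_tensor_mult_adj sum_distrib_right mat_nth)
    also have "(\<Sum>e\<in>UNIV. \<Prod>b\<in>UNIV. (adj (decoder W (e b)) ** decoder W (e b)) $ (\<lambda>v. x (Inl (b, v))) $ (\<lambda>v. y (Inl (b, v)))) =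
        (\<Prod>b\<in>UNIV. (\<Sum>k\<in>UNIV. adj (decoder W k) ** decoder W k) $ (\<lambda>v. x (Inl (b, v))) $ (\<lambda>v. y (Inl (b, v))))"
      unfolding sum_component by (rule prod_sum_fun[symmetric])
    also have "\<dots> = (\<Prod>b\<in>UNIV. if \<forall>v. x (Inl (b, v)) = y (Inl (b, v)) then 1 else 0)"
      unfolding inner.decoder_complete by (simp add: mat_nth fun_eq_iff)
    also have "\<dots> * (\<Prod>i\<in>UNIV. if x (Inr i) = y (Inr i) then 1 else 0) = (mat 1 :: ('b \<times> 'v + 'i) oper) $ x $ y"
    proof -
      have "x = y \<longleftrightarrow> (\<forall>b v. x (Inl (b, v)) = y (Inl (b, v))) \<and> (\<forall>i. x (Inr i) = y (Inr i))"
        unfolding fun_eq_iff by (metis obj_sumE surj_pair)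
      then show ?thesis
        by (simp only: prod_indicator[OF finite] mat_nth) simp
    qed
    finally show ?thesis .
  qed
  then show ?thesis
    by (simp add: vec_eq_iff)
qed

lemma recovery_complete:
  "(\<Sum>k\<in>UNIV. adj (concatenated_recovery V W k) ** concatenated_recovery V W k) = mat 1"
proof -
  have "adj (concatenated_recovery V W k) ** concatenated_recovery V W k =
      adj (block_decoder W (snd k)) ** (adj (decoder V (fst k)) ** decoder V (fst k)) ** block_decoder W (snd k)" for k
  proof -
    have "adj (concatenated_recovery V W k) ** concatenated_recovery V W k =
        adj (block_decoder W (snd k)) ** (adj (decoder V (fst k)) ** (adj encoding ** encoding) ** decoder V (fst k)) **
          block_decoder W (snd k)"
      unfolding concatenated_recovery_def by (simp only: adj_mult matrix_mul_assoc)
    then show ?thesis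
      by (simp add: encoding_isometry)
  qed
  then have "(\<Sum>k\<in>UNIV. adj (concatenated_recovery V W k) ** concatenated_recovery V W k) =
      (\<Sum>e\<in>UNIV. \<Sum>j\<in>UNIV. adj (block_decoder W e) ** (adj (decoder V j) ** decoder V j) ** block_decoder W e)"
    by (subst sum.swap) (simp add: sum.cartesian_product UNIV_Times_UNIV[symmetric] case_prod_beta del: UNIV_Times_UNIV)
  also have "\<dots> = (\<Sum>e\<in>UNIV. adj (block_decoder W e) ** (\<Sum>j\<in>UNIV. adj (decoder V j) ** decoder V j) ** block_decoder W e)"
    by (simp only: sum_mult_left sum_mult_right)
  finally show ?thesis
    by (simp add: outer.decoder_complete block_decoder_complete)
qed

text \<open>Inner decoding turns a product error into a product of one-qubit matrices on the outer
  code. If all but one of them are scalars, the outer decoder faces a single error, which may be any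
  matrix at all.\<close>

lemma correctableI:
  assumes "\<And>M e. (\<And>q. q \<notin> A \<Longrightarrow> M q = mat 1) \<Longrightarrow>
    \<exists>q0. \<forall>q. q \<noteq> q0 \<longrightarrow> (\<exists>l. case_sum (\<lambda>b. decoder W (e b) ** (tensor (\<lambda>v. M (Inl (b, v))) ** W))
      (\<lambda>i. M (Inr i)) q = cscale l (mat 1))"
  shows "correctable (concatenated_recovery V W) encoding A"
  unfolding correctable_def recovers_def
proof (intro allI impI)
  fix M :: "'b \<times> 'v + 'i \<Rightarrow> qmat" and k :: "('b + 'i) syndrome \<times> ('b \<Rightarrow> 'v syndrome)"
  assume M: "\<forall>q. q \<notin> A \<longrightarrow> M q = mat 1"
  define f where "f = case_sum (\<lambda>b. decoder W (snd k b) ** (tensor (\<lambda>v. M (Inl (b, v))) ** W)) (\<lambda>i. M (Inr i))"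
  obtain q0 where "\<forall>q. q \<noteq> q0 \<longrightarrow> (\<exists>l. f q = cscale l (mat 1))"
    using assms[of M "snd k"] M unfolding f_def by blast
  then obtain l where l: "\<And>q. q \<noteq> q0 \<Longrightarrow> f q = cscale (l q) (mat 1)"
    by metis
  have "tensor f = tensor (\<lambda>q. cscale (if q = q0 then 1 else l q) (if q = q0 then f q0 else mat 1))"
    by (rule arg_cong[where f = tensor]) (auto simp: l)
  then have f: "tensor f = cscale (\<Prod>q\<in>UNIV. if q = q0 then 1 else l q) (site q0 (f q0))"
    unfolding tensor_cscale site_def .
  obtain m where m: "decoder V (fst k) ** (site q0 (f q0) ** V) = cscale m (mat 1)"
    using outer.decoder_site by blast
  have decoded: "block_decoder W (snd k) ** (tensor M ** location_tensor (\<lambda>_. W) (\<lambda>_. mat 1)) = tensor f"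
    unfolding block_decoder_def tensor_location_tensor adj_location_tensor_mult f_def
    by (rule arg_cong[where f = tensor]) (auto split: sum.split)
  have "concatenated_recovery V W k ** (tensor M ** encoding) = encoding ** decoder V (fst k) **
      (block_decoder W (snd k) ** (tensor M ** location_tensor (\<lambda>_. W) (\<lambda>_. mat 1))) ** V"
    unfolding concatenated_recovery_def by (simp only: matrix_mul_assoc)
  also have "\<dots> = encoding ** (decoder V (fst k) ** (tensor f ** V))"
    unfolding decoded by (simp only: matrix_mul_assoc)
  also have "\<dots> = cscale ((\<Prod>q\<in>UNIV. if q = q0 then 1 else l q) * m) encoding"
    unfolding f by (simp add: cscale_mult_left cscale_mult_right m)
  finally show "\<exists>l. concatenated_recovery V W k ** (tensor M ** encoding) = cscale l encoding"
    by blast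
qed

lemma inner_single:
  assumes "\<And>u. u \<noteq> v \<Longrightarrow> M u = mat 1"
  shows "\<exists>l. decoder W e ** (tensor M ** W) = cscale l (mat 1)"
proof -
  have "tensor M = site v (M v)"
    unfolding site_def by (rule arg_cong[where f = tensor]) (auto simp: assms)
  then show ?thesis
    using inner.decoder_site by simp
qed

text \<open>The error touches each block in at most one qubit, so the inner decoders remove it
  completely and nothing is left for the outer code.\<close>

lemma correctable_transversal: "correctable (concatenated_recovery V W) encoding (range (\<lambda>b. Inl (b, v)))"
proof (rule correctableI)
  fix M :: "'b \<times> 'v + 'i \<Rightarrow> qmat" and e
  assume M: "\<And>q. q \<notin> range (\<lambda>b. Inl (b, v)) \<Longrightarrow> M q = mat 1"
  have "\<exists>l. decoder W (e b) ** (tensor (\<lambda>v. M (Inl (b, v))) ** W) = cscale l (mat 1)" for b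
    by (rule inner_single[of v]) (auto intro: M)
  moreover have "\<exists>l. M (Inr i) = cscale l (mat 1)" for i
    using M[of "Inr i"] by (intro exI[of _ 1]) auto
  ultimately show "\<exists>q0. \<forall>q. q \<noteq> q0 \<longrightarrow> (\<exists>l. case_sum (\<lambda>b. decoder W (e b) ** (tensor (\<lambda>v. M (Inl (b, v))) ** W))
      (\<lambda>i. M (Inr i)) q = cscale l (mat 1))"
    by (auto split: sum.split)
qed

text \<open>The decoder of the damaged block may return an arbitrary one-qubit matrix, which the
  outer code sees as one error.\<close>

lemma correctable_block: "correctable (concatenated_recovery V W) encoding (range (in_block b0))"
proof (rule correctableI)
  fix M :: "'b \<times> 'v + 'i \<Rightarrow> qmat" and e
  assume M: "\<And>q. q \<notin> range (in_block b0) \<Longrightarrow> M q = mat 1"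
  have "\<exists>l. decoder W (e b) ** (tensor (\<lambda>v. M (Inl (b, v))) ** W) = cscale l (mat 1)" if "b \<noteq> b0" for b
    \<comment> \<open>No qubit of this block is damaged, so any position can stand for the place of
      the error.\<close>
    by (rule inner_single[of undefined]) (use that in \<open>auto simp: in_block_def intro: M\<close>)
  moreover have "\<exists>l. M (Inr i) = cscale l (mat 1)" for i
    using M[of "Inr i"] by (intro exI[of _ 1]) (auto simp: in_block_def)
  ultimately show "\<exists>q0. \<forall>q. q \<noteq> q0 \<longrightarrow> (\<exists>l. case_sum (\<lambda>b. decoder W (e b) ** (tensor (\<lambda>v. M (Inl (b, v))) ** W))
      (\<lambda>i. M (Inr i)) q = cscale l (mat 1))"
    by (intro exI[of _ "Inl b0"]) (auto split: sum.split)
qed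

lemma correctable_bare: "correctable (concatenated_recovery V W) encoding {Inr i0}"
proof (rule correctableI)
  fix M :: "'b \<times> 'v + 'i \<Rightarrow> qmat" and e
  assume M: "\<And>q. q \<notin> {Inr i0} \<Longrightarrow> M q = mat 1"
  have "\<exists>l. decoder W (e b) ** (tensor (\<lambda>v. M (Inl (b, v))) ** W) = cscale l (mat 1)" for b
    by (rule inner_single[of undefined]) (auto intro: M)
  moreover have "\<exists>l. M (Inr i) = cscale l (mat 1)" if "i \<noteq> i0" for i
    using M[of "Inr i"] that by (intro exI[of _ 1]) auto
  ultimately show "\<exists>q0. \<forall>q. q \<noteq> q0 \<longrightarrow> (\<exists>l. case_sum (\<lambda>b. decoder W (e b) ** (tensor (\<lambda>v. M (Inl (b, v))) ** W))
      (\<lambda>i. M (Inr i)) q = cscale l (mat 1))"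
    by (intro exI[of _ "Inr i0"]) (auto split: sum.split)
qed

text \<open>The partition for H, whose gates mix the qubits of a whole Reed-Muller block.\<close>

definition location_classes :: "('b \<times> 'v + 'i) set set"
  where "location_classes = range (\<lambda>b. range (in_block b)) \<union> range (\<lambda>i. {Inr i})"

text \<open>The partition for T and S, whose gates couple equally labelled qubits of the three
  blocks.\<close>

definition transversal_classes :: "('b \<times> 'v + 'i) set set"
  where "transversal_classes = range (\<lambda>v. range (\<lambda>b. Inl (b, v))) \<union> range (\<lambda>i. {Inr i})"

lemma correctable_classes:
  "A \<in> location_classes \<union> transversal_classes \<Longrightarrow> correctable (concatenated_recovery V W) encoding A"
  unfolding location_classes_def transversal_classes_def
  using correctable_block correctable_transversal correctable_bare by blast

lemma disjoint_classes: "disjoint location_classes" "disjoint transversal_classes"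
  unfolding location_classes_def transversal_classes_def disjoint_def in_block_def by auto

lemma cover_classes: "\<Union>location_classes = UNIV" "\<Union>transversal_classes = UNIV"
proof -
  have "q \<in> \<Union>location_classes \<and> q \<in> \<Union>transversal_classes" for q
    unfolding location_classes_def transversal_classes_def in_block_def by (cases q) auto
  then show "\<Union>location_classes = UNIV" "\<Union>transversal_classes = UNIV"
    by blast+
qed

lemma correctable_single: "correctable (concatenated_recovery V W) encoding {q}"
proof -
  have "q \<in> \<Union>location_classes"
    by (simp add: cover_classes)
  then obtain A where "A \<in> location_classes" "q \<in> A"
    by blast
  then show ?thesis
    using correctable_mono[of _ _ A "{q}"] correctable_classes by blast
qed

end

section \<open>Fault-tolerant logical gates\<close>

section \<open>Logical gates\<close>

lemma circuit_diagonal: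
  "distinct vs \<Longrightarrow> circuit (map (\<lambda>v. diagonal (f v)) vs) = diagonal (\<lambda>x. \<Prod>v\<in>set vs. f v x)"
proof (induction vs)
  case Nil
  show ?case
    by (simp add: vec_eq_iff mat_nth)
next
  case (Cons v vs)
  then show ?case
    by (simp add: circuit_Cons diagonal_mult mult.commute)
qed

lemma diagonal_mult_nth: "(diagonal f ** M) $ x $ a = f x * M $ x $ a"
  by (simp add: mult_nth if_distrib[of "\<lambda>z. z * _"] cong: if_cong)

lemma permutation_cnot_mult_nth:
  assumes "p \<noteq> q"
  shows "(permutation_gate (cnot_map p q) ** M) $ x $ a = M $ cnot_map p q x $ a"
proof -
  have "cnot_map p q (cnot_map p q y) = y" for y
    using assms by (auto simp: cnot_map_def fun_eq_iff)
  then have "(permutation_gate (cnot_map p q) ** M) $ x $ a =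
      (\<Sum>y\<in>UNIV. if y = cnot_map p q x then M $ y $ a else 0)"
    unfolding mult_nth by (intro sum.cong refl) auto
  then show ?thesis
    by simp
qed

lemma UNIV_01: "UNIV = {0, 1 :: 2}"
  using exhaust_01 by auto

lemma CNOT_gate_eq: "CNOT_gate = permutation_gate (cnot_map 0 1)"
proof -
  have "embed_gate id CNOT_gate = CNOT_gate"
    by (simp add: vec_eq_iff embed_gate_nth)
  then show ?thesis
    using embed_CNOT_gate[of id] by simp
qed

text \<open>All controls lie in the first block, which no gate changes, so every flip can be read
  off from the original label.\<close>

lemma transversal_cnot_mult_nth:
  fixes M :: "complex ^ 'k ^ (2 \<times> 'q::finite \<Rightarrow> bool)"
  assumes "distinct qs"
  shows "(circuit (map (\<lambda>q. permutation_gate (cnot_map (0, q) (1, q))) qs) ** M) $ x $ a =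
    M $ (\<lambda>p. x p \<noteq> (fst p = 1 \<and> snd p \<in> set qs \<and> x (0, snd p))) $ a"
  using assms
proof (induction qs arbitrary: x rule: rev_induct)
  case (snoc q qs)
  have "(circuit (map (\<lambda>q. permutation_gate (cnot_map (0, q) (1, q))) (qs @ [q])) ** M) $ x $ a =
      (permutation_gate (cnot_map (0, q) (1, q)) **
        (circuit (map (\<lambda>q. permutation_gate (cnot_map (0, q) (1, q))) qs) ** M)) $ x $ a"
    by (simp add: circuit_append circuit_Cons matrix_mul_assoc)
  also have "\<dots> = (circuit (map (\<lambda>q. permutation_gate (cnot_map (0, q) (1, q))) qs) ** M) $ cnot_map (0, q) (1, q) x $ a"
    by (rule permutation_cnot_mult_nth) simp
  also have "\<dots> = M $ (\<lambda>p. cnot_map (0, q) (1, q) x p \<noteq>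
      (fst p = 1 \<and> snd p \<in> set qs \<and> cnot_map (0, q) (1, q) x (0, snd p))) $ a"
    using snoc by simp
  also have "(\<lambda>p. cnot_map (0, q) (1, q) x p \<noteq> (fst p = 1 \<and> snd p \<in> set qs \<and> cnot_map (0, q) (1, q) x (0, snd p))) =
      (\<lambda>p. x p \<noteq> (fst p = 1 \<and> snd p \<in> set (qs @ [q]) \<and> x (0, snd p)))"
    using snoc.prems by (intro ext) (auto simp: cnot_map_def)
  finally show ?case .
qed simp

lemma circuit_blocks_location_tensor:
  assumes "distinct bs"
  shows "circuit (concat (map (\<lambda>b. map (embed_gate (in_block b)) hs) bs)) ** location_tensor N B =
    location_tensor (\<lambda>b. if b \<in> set bs then circuit hs ** N b else N b) B"
  using assms
proof (induction bs rule: rev_induct)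
  case (snoc b bs)
  have "circuit (concat (map (\<lambda>b. map (embed_gate (in_block b)) hs) (bs @ [b]))) ** location_tensor N B =
      embed_gate (in_block b) (circuit hs) **
        (circuit (concat (map (\<lambda>b. map (embed_gate (in_block b)) hs) bs)) ** location_tensor N B)"
    by (simp add: circuit_append circuit_embed[OF inj_in_block] matrix_mul_assoc)
  also have "\<dots> = embed_gate (in_block b) (circuit hs) **
      location_tensor (\<lambda>b. if b \<in> set bs then circuit hs ** N b else N b) B"
    using snoc by simp
  also have "\<dots> = location_tensor (\<lambda>d. if d \<in> set (bs @ [b]) then circuit hs ** N d else N d) B"
    unfolding embed_location_tensor using snoc.prems by (intro arg_cong2[where f = location_tensor] ext) auto
  finally show ?case .
qed simp

lemma circuit_sites_location_tensor:
  assumes "distinct is"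
  shows "circuit (map (\<lambda>i. site (Inr i) A) is) ** location_tensor N B =
    location_tensor N (\<lambda>i. if i \<in> set is then A ** B i else B i)"
  using assms
proof (induction "is" rule: rev_induct)
  case (snoc i "is")
  have "circuit (map (\<lambda>i. site (Inr i) A) (is @ [i])) ** location_tensor N B =
      site (Inr i) A ** (circuit (map (\<lambda>i. site (Inr i) A) is) ** location_tensor N B)"
    by (simp add: circuit_append circuit_Cons matrix_mul_assoc)
  also have "\<dots> = site (Inr i) A ** location_tensor N (\<lambda>i. if i \<in> set is then A ** B i else B i)"
    using snoc by simp
  also have "\<dots> = location_tensor N (\<lambda>k. if k \<in> set (is @ [i]) then A ** B k else B k)"
    unfolding site_Inr_location_tensor using snoc.prems by (intro arg_cong2[where f = location_tensor] ext) auto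
  finally show ?case .
qed simp

text \<open>This law holds for the encodings because their columns are uniform superpositions over the cosets
  of a linear code.\<close>

definition xor_law :: "complex ^ bool ^ ('q::finite \<Rightarrow> bool) \<Rightarrow> bool"
  where "xor_law M \<longleftrightarrow> (\<forall>x y a b. M $ x $ a * M $ (\<lambda>q. x q \<noteq> y q) $ b = M $ x $ a * M $ y $ (a \<noteq> b))"

lemma xor_lawD: "xor_law M \<Longrightarrow> M $ x $ a * M $ (\<lambda>q. x q \<noteq> y q) $ b = M $ x $ a * M $ y $ (a \<noteq> b)"
  unfolding xor_law_def
  by (drule spec[of _ x], drule spec[of _ y], drule spec[of _ a], drule spec[of _ b])

text \<open>Transversal CNOT adds the word of the first block to that of the second, and the law
  translates this into addition of the logical bits.\<close>

lemma xor_law_cnot: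
  fixes Q :: "complex ^ bool ^ ('q::finite \<Rightarrow> bool)"
  assumes "xor_law Q" "distinct qs" "set qs = UNIV"
  shows "circuit (map (\<lambda>q. permutation_gate (cnot_map (0, q) (1, q))) qs) ** encode_blocks Q = encode_blocks Q ** CNOT_gate"
    (is "?C ** _ = _")
proof -
  have enc: "encode_blocks Q $ x $ a = Q $ (\<lambda>q. x (0, q)) $ a 0 * Q $ (\<lambda>q. x (1, q)) $ a 1"
    for x :: "2 \<times> 'q \<Rightarrow> bool" and a
    by (simp add: encode_blocks_def UNIV_01)
  have "(?C ** encode_blocks Q) $ x $ a = (encode_blocks Q ** CNOT_gate) $ x $ a" for x a
  proof -
    have "(?C ** encode_blocks Q) $ x $ a = encode_blocks Q $ (\<lambda>p. x p \<noteq> (fst p = 1 \<and> snd p \<in> set qs \<and> x (0, snd p))) $ a"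
      by (rule transversal_cnot_mult_nth[OF assms(2)])
    also have "\<dots> = Q $ (\<lambda>q. x (0, q)) $ a 0 * Q $ (\<lambda>q. x (0, q) \<noteq> x (1, q)) $ a 1"
    proof -
      have "(\<lambda>q. x (1, q) \<noteq> x (0, q)) = (\<lambda>q. x (0, q) \<noteq> x (1, q))"
        by auto
      then show ?thesis
        unfolding enc assms(3) by simp
    qed
    also have "\<dots> = Q $ (\<lambda>q. x (0, q)) $ a 0 * Q $ (\<lambda>q. x (1, q)) $ (a 0 \<noteq> a 1)"
      by (rule xor_lawD[OF assms(1)])
    also have "\<dots> = encode_blocks Q $ x $ cnot_map 0 1 a"
    proof -
      have "cnot_map 0 1 a 0 = a 0" "cnot_map 0 1 a 1 = (a 0 \<noteq> a 1)"
        by (auto simp: cnot_map_def)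
      then show ?thesis
        unfolding enc by simp
    qed
    also have "\<dots> = (encode_blocks Q ** CNOT_gate) $ x $ a"
      by (simp add: mult_nth CNOT_gate_eq if_distrib[of "(*) _"] cong: if_cong)
    finally show ?thesis .
  qed
  then show ?thesis
    by (simp add: vec_eq_iff)
qed

context quantum_rm_code
begin

lemma xor_law_V: "xor_law V"
  unfolding xor_law_def V_nth using code_xor by simp

lemma code_add:
  assumes "x \<in> code a" "y \<in> code b"
  shows "(\<lambda>i. x i \<noteq> y i) \<in> code (a \<noteq> b)"
proof -
  have "(a \<noteq> (a \<noteq> b)) = b"
    by auto
  then show ?thesis
    using code_xor[OF assms(1), of y "a \<noteq> b"] assms(2) by simp
qed

end

text \<open>In the double sum over the intermediate labels \<open>s\<close> and \<open>t\<close>,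
  the inner law turns the xor of physical words into an xor of labels. Replacing \<open>t\<close> by
  its xor with \<open>s\<close> moves this into the outer encoding, where the outer law
  applies.\<close>

lemma xor_law_concatenated:
  fixes V :: "complex ^ bool ^ ('b::finite + 'i::finite \<Rightarrow> bool)" and W :: "complex ^ bool ^ ('v::finite \<Rightarrow> bool)"
  assumes V: "xor_law V" and W: "xor_law W"
  shows "xor_law (location_tensor (\<lambda>_. W) (\<lambda>_. mat 1) ** V)"
  unfolding xor_law_def
proof (intro allI)
  fix x y :: "'b \<times> 'v + 'i \<Rightarrow> bool" and a b
  define I where "I = (location_tensor (\<lambda>_. W) (\<lambda>_. mat 1) :: complex ^ ('b + 'i \<Rightarrow> bool) ^ ('b \<times> 'v + 'i \<Rightarrow> bool))"
  have I: "I $ x $ s * I $ (\<lambda>q. x q \<noteq> y q) $ t = I $ x $ s * I $ y $ (\<lambda>q. s q \<noteq> t q)" for s t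
  proof -
    have W': "W $ (\<lambda>v. x (Inl (d, v))) $ s (Inl d) * W $ (\<lambda>v. x (Inl (d, v)) \<noteq> y (Inl (d, v))) $ t (Inl d) =
        W $ (\<lambda>v. x (Inl (d, v))) $ s (Inl d) * W $ (\<lambda>v. y (Inl (d, v))) $ (s (Inl d) \<noteq> t (Inl d))" for d
      by (rule xor_lawD[OF W])
    have mat: "mat 1 $ x (Inr i) $ s (Inr i) * mat 1 $ (x (Inr i) \<noteq> y (Inr i)) $ t (Inr i) =
        mat 1 $ x (Inr i) $ s (Inr i) * (mat 1 $ y (Inr i) $ (s (Inr i) \<noteq> t (Inr i)) :: complex)" for i
      by (auto simp: mat_nth)
    have pair: "prod f UNIV * prod g UNIV * (prod f' UNIV * prod g' UNIV) =
        (\<Prod>d\<in>UNIV. f d * f' d) * (\<Prod>i\<in>UNIV. g i * g' i)" for f f' :: "'b \<Rightarrow> complex" and g g' :: "'i \<Rightarrow> complex"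
      unfolding prod.distrib by (simp only: ac_simps)
    show ?thesis
      unfolding I_def location_tensor_nth pair W' mat ..
  qed
  have V': "V $ s $ a * V $ (\<lambda>q. s q \<noteq> t q) $ b = V $ s $ a * V $ t $ (a \<noteq> b)" for s t
    by (rule xor_lawD[OF V])
  have "(I ** V) $ x $ a * (I ** V) $ (\<lambda>q. x q \<noteq> y q) $ b =
      (\<Sum>s\<in>UNIV. \<Sum>t\<in>UNIV. (I $ x $ s * I $ (\<lambda>q. x q \<noteq> y q) $ t) * (V $ s $ a * V $ t $ b))"
    unfolding mult_nth sum_product by (simp only: ac_simps)
  also have "\<dots> = (\<Sum>s\<in>UNIV. \<Sum>t\<in>UNIV. (I $ x $ s * I $ y $ t) * (V $ s $ a * V $ (\<lambda>q. s q \<noteq> t q) $ b))"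
  proof (rule sum.cong[OF refl])
    fix s :: "'b + 'i \<Rightarrow> bool"
    have "(\<lambda>q. s q \<noteq> (s q \<noteq> t q)) = t" for t
      by auto
    then show "(\<Sum>t\<in>UNIV. (I $ x $ s * I $ (\<lambda>q. x q \<noteq> y q) $ t) * (V $ s $ a * V $ t $ b)) =
        (\<Sum>t\<in>UNIV. (I $ x $ s * I $ y $ t) * (V $ s $ a * V $ (\<lambda>q. s q \<noteq> t q) $ b))"
      unfolding I by (intro sum.reindex_bij_witness[of _ "\<lambda>t q. s q \<noteq> t q" "\<lambda>t q. s q \<noteq> t q"]) simp_all
  qed
  also have "\<dots> = (I ** V) $ x $ a * (I ** V) $ y $ (a \<noteq> b)"
    unfolding V' mult_nth sum_product by (simp only: ac_simps)
  finally show "(I ** V) $ x $ a * (I ** V) $ (\<lambda>q. x q \<noteq> y q) $ b = (I ** V) $ x $ a * (I ** V) $ y $ (a \<noteq> b)" .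
qed

locale Q49 =
  fixes c :: "steane_qubit \<Rightarrow> bit ^ 3"
    and V :: "complex ^ bool ^ (steane_qubit \<Rightarrow> bool)"
    and W :: "complex ^ bool ^ (rm_qubit \<Rightarrow> bool)"
  assumes bij_c: "bij_betw c UNIV {v. v \<noteq> 0}"
    and line: "c (Inl Q1) + c (Inl Q2) + c (Inl Q7) = 0"
    and V: "encoding_isometry (steane_generators c) V"
    and W: "encoding_isometry rm_generators W"

sublocale Q49 \<subseteq> outer: quantum_rm_code c V
  by (rule steane_quantum_rm_code[OF bij_c V])

sublocale Q49 \<subseteq> inner: quantum_rm_code rm_vec W
  by (rule rm_quantum_rm_code[OF W])

sublocale Q49 \<subseteq> concatenated_code c V rm_vec W
  by unfold_locales

context Q49
begin

lemma encoding_eq: "Q49_encoding V W = encoding"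
  by (simp add: Q49_encoding_def inner_encoding_eq)

abbreviation recovery where "recovery \<equiv> kraus (concatenated_recovery V W)"

definition triple_parity :: "rm_qubit \<Rightarrow> (qubit49 \<Rightarrow> bool) \<Rightarrow> bool"
  where "triple_parity v x = ((x (Inl (Q1, v)) \<noteq> x (Inl (Q2, v))) \<noteq> x (Inl (Q7, v)))"

text \<open>The three columns add up to 0, so the contribution of every row combination cancels, and
  the xor of three copies of \<open>a\<close> is \<open>a\<close>.\<close>

lemma outer_triple_parity:
  assumes "s \<in> outer.code a"
  shows "((s (Inl Q1) \<noteq> s (Inl Q2)) \<noteq> s (Inl Q7)) = a"
proof -
  obtain J where J: "\<And>i. s i = (a \<noteq> ((\<Sum>j\<in>J. c i $ j) = 1))"
    using assms unfolding outer.code_def outer.codeword_def by auto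
  have "(\<Sum>j\<in>J. c (Inl Q1) $ j) + (\<Sum>j\<in>J. c (Inl Q2) $ j) + (\<Sum>j\<in>J. c (Inl Q7) $ j) =
      (\<Sum>j\<in>J. (c (Inl Q1) + c (Inl Q2) + c (Inl Q7)) $ j)"
    by (simp add: sum.distrib)
  also have "\<dots> = 0"
    by (simp add: line)
  finally show ?thesis
    unfolding J
    by (cases "(\<Sum>j\<in>J. c (Inl Q1) $ j) = 0"; cases "(\<Sum>j\<in>J. c (Inl Q2) $ j) = 0"; cases "(\<Sum>j\<in>J. c (Inl Q7) $ j) = 0")
      auto
qed

text \<open>The three blocks hold Reed-Muller words whose classes are the three outer bits. Their
  xor is a word of class \<open>a\<close> by \<open>outer_triple_parity\<close>, and its weight
  modulo 8 is determined by \<open>a\<close>.\<close>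

lemma triple_parity_weight:
  fixes w :: complex
  assumes "encoding $ x $ a \<noteq> 0" "w ^ 8 = 1"
  shows "w ^ card {v. triple_parity v x} = (if a then w ^ 7 else 1)"
proof -
  obtain s where "location_tensor (\<lambda>_. W) (\<lambda>_. mat 1) $ x $ s * V $ s $ a \<noteq> 0"
    using assms(1) unfolding mult_nth by (meson sum.not_neutral_contains_not_neutral)
  then have "V $ s $ a \<noteq> 0" "\<And>b. W $ (\<lambda>v. x (Inl (b, v))) $ s (Inl b) \<noteq> 0"
    by (auto simp: location_tensor_nth)
  then have s: "s \<in> outer.code a" and x: "\<And>b. (\<lambda>v. x (Inl (b, v))) \<in> inner.code (s (Inl b))"
    using outer.support inner.support by blast+
  have "(\<lambda>v. triple_parity v x) \<in> inner.code ((s (Inl Q1) \<noteq> s (Inl Q2)) \<noteq> s (Inl Q7))"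
    unfolding triple_parity_def by (intro inner.code_add x)
  then have "(\<lambda>v. triple_parity v x) \<in> inner.code a"
    unfolding outer_triple_parity[OF s] .
  then show ?thesis
    using rm_codeword_weight[OF inner.quantum_rm_code_axioms _ assms(2)] by blast
qed

lemma fault_tolerant_phase_gate:
  assumes "cmod z = 1" "z ^ 8 = 1"
  shows "fault_tolerant encoding recovery (tensor (\<lambda>_ :: 1. phase_gate z))"
proof -
  \<comment> \<open>Words of logical value 1 have weight 7 modulo 8, and
    \<open>w ^ 7 = z ^ 49 = z\<close>.\<close>
  define w where "w = z ^ 7"
  have w: "w ^ 8 = 1" "w ^ 7 = z" "cmod w = 1"
  proof -
    have "w ^ 8 = (z ^ 8) ^ 7" "w ^ 7 = (z ^ 8) ^ 6 * z"
      by (simp_all add: w_def power_mult[symmetric] power_Suc2[symmetric] del: power_Suc)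
    then show "w ^ 8 = 1" "w ^ 7 = z"
      by (simp_all add: assms(2))
    show "cmod w = 1"
      by (simp add: w_def norm_power assms(1))
  qed
  obtain vs :: "rm_qubit list" where vs: "set vs = UNIV" "distinct vs"
    using finite_distinct_list[of "UNIV :: rm_qubit set"] by auto
  define g where "g v = diagonal (\<lambda>x. if triple_parity v x then w else 1)" for v
  define A :: "rm_qubit \<Rightarrow> qubit49 set" where "A v = {Inl (Q1, v), Inl (Q2, v), Inl (Q7, v)}" for v
  show ?thesis
  proof (rule fault_tolerant_one_qubitI[where gs = "map g vs" and z = 1, OF encoding_isometry recovery_complete
        disjoint_classes(2) cover_classes(2)])
    show "correctable (concatenated_recovery V W) encoding B" if "B \<in> transversal_classes" for B
      using that correctable_classes by blast
    fix h assume "h \<in> set (map g vs)"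
    then obtain v where h: "h = g v"
      by auto
    have "unitary (g v)"
      unfolding g_def by (rule diagonal_unitary) (simp add: w)
    moreover have "acts_on (A v) (g v)"
      unfolding g_def by (rule acts_on_diagonal) (simp add: triple_parity_def A_def)
    moreover have "card (A v) \<le> 3"
      unfolding A_def by (simp add: card_insert_if)
    moreover have "A v \<subseteq> range (\<lambda>b. Inl (b, v))" "range (\<lambda>b. Inl (b, v)) \<in> transversal_classes"
      by (auto simp: A_def transversal_classes_def)
    ultimately show "unitary h \<and> (\<exists>B. card B \<le> 3 \<and> acts_on B h \<and> (\<exists>A\<in>transversal_classes. B \<subseteq> A))"
      unfolding h by blast
  next
    have "circuit (map g vs) = diagonal (\<lambda>x. w ^ card {v. triple_parity v x})"
      unfolding g_def circuit_diagonal[OF vs(2)] vs(1) by (simp add: prod.If_cases)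
    then have "(circuit (map g vs) ** encoding) $ x $ a = (encoding ** phase_gate z) $ x $ a" for x a
    proof (cases "encoding $ x $ a = 0")
      case True
      then show ?thesis
        unfolding \<open>circuit (map g vs) = _\<close> diagonal_mult_nth by (cases a) (simp_all add: mult_nth[of encoding] UNIV_bool)
    next
      case False
      have "(encoding ** phase_gate z) $ x $ a = encoding $ x $ a * (if a then z else 1)"
        by (cases a) (simp_all add: mult_nth[of encoding] UNIV_bool)
      then show ?thesis
        unfolding \<open>circuit (map g vs) = _\<close> diagonal_mult_nth triple_parity_weight[OF False w(1)]
        by (simp add: w(2) mult.commute)
    qed
    then show "circuit (map g vs) ** encoding = cscale 1 (encoding ** phase_gate z)"
      by (simp add: vec_eq_iff)
  qed simp
qed

text \<open>Each gate joins the two copies of one physical qubit, so single qubits serve as classes: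
  an error leaves at most one damaged qubit in each block.\<close>

lemma fault_tolerant_CNOT_gate: "fault_tolerant encoding recovery CNOT_gate"
proof -
  obtain qs :: "qubit49 list" where qs: "set qs = UNIV" "distinct qs"
    using finite_distinct_list[of "UNIV :: qubit49 set"] by auto
  define g where "g q = permutation_gate (cnot_map (0 :: 2, q) (1, q))" for q :: qubit49
  show ?thesis
  proof (rule fault_tolerantI[where gs = "map g qs" and \<A> = "range (\<lambda>q. {q})" and z = 1,
        OF encoding_isometry recovery_complete])
    show "disjoint (range (\<lambda>q :: qubit49. {q}))" "\<Union>(range (\<lambda>q :: qubit49. {q})) = UNIV"
      by (auto simp: disjoint_def)
    show "correctable (concatenated_recovery V W) encoding A" if "A \<in> range (\<lambda>q. {q})" for A
      using that correctable_single by blast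
    fix h assume "h \<in> set (map g qs)"
    then obtain q where h: "h = g q"
      by auto
    have "unitary (g q)"
      unfolding g_def by (rule permutation_gate_unitary[OF inj_cnot_map]) simp
    moreover have "acts_on {(0, q), (1, q)} (g q)"
      unfolding g_def by (rule acts_on_cnot)
    moreover have "card {(0 :: 2, q), (1, q)} \<le> 3" "{(0 :: 2, q), (1, q)} \<subseteq> UNIV \<times> {q}"
      by (simp_all add: card_insert_if)
    ultimately show "unitary h \<and> (\<exists>B. card B \<le> 3 \<and> acts_on B h \<and> (\<exists>A\<in>range (\<lambda>q. {q}). B \<subseteq> UNIV \<times> A))"
      unfolding h by blast
  next
    have "xor_law encoding"
      by (rule xor_law_concatenated[OF outer.xor_law_V inner.xor_law_V])
    then show "circuit (map g qs) ** encode_blocks encoding = cscale 1 (encode_blocks encoding ** CNOT_gate)"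
      using xor_law_cnot[OF _ qs(2,1)] unfolding g_def by simp
  qed simp
qed

text \<open>Logical H on each Reed-Muller block and physical H on each bare qubit together apply H
  to every Steane qubit, which is logical H of the Steane code up to phase.\<close>

lemma fault_tolerant_H_gate: "fault_tolerant encoding recovery (tensor (\<lambda>_ :: 1. hadamard))"
proof -
  obtain hs :: "rm_qubit oper list" where hs: "\<And>g. g \<in> set hs \<Longrightarrow> unitary g \<and> (\<exists>B. card B \<le> 3 \<and> acts_on B g)"
    and circuit_hs: "circuit hs = cscale (1 / of_real (sqrt 2)) (X_on UNIV + Z_on UNIV)"
    using logical_hadamard_circuit[where 'q = rm_qubit] card_rm_qubit by auto
  obtain bs :: "encoded_pos list" where bs: "set bs = UNIV" "distinct bs"
    using finite_distinct_list[of "UNIV :: encoded_pos set"] by auto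
  obtain ks :: "bare_pos list" where ks: "set ks = UNIV" "distinct ks"
    using finite_distinct_list[of "UNIV :: bare_pos set"] by auto
  obtain z where z: "cmod z = 1" and HV: "tensor (\<lambda>_. hadamard) ** V = cscale z (V ** hadamard)"
    using transversal_hadamard[OF outer.quantum_rm_code_axioms] by auto
  define block_gates :: "qubit49 oper list" where "block_gates = concat (map (\<lambda>b. map (embed_gate (in_block b)) hs) bs)"
  define bare_gates :: "qubit49 oper list" where "bare_gates = map (\<lambda>i. site (Inr i) hadamard) ks"
  show ?thesis
  proof (rule fault_tolerant_one_qubitI[where gs = "block_gates @ bare_gates", OF encoding_isometry recovery_complete
        disjoint_classes(1) cover_classes(1) _ _ z])
    show "correctable (concatenated_recovery V W) encoding A" if "A \<in> location_classes" for A
      using that correctable_classes by blast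
    fix h :: "qubit49 oper"
    assume h: "h \<in> set (block_gates @ bare_gates)"
    then consider b g where "g \<in> set hs" "h = embed_gate (in_block b) g" | i where "h = site (Inr i) hadamard"
      unfolding block_gates_def bare_gates_def by auto
    then show "unitary h \<and> (\<exists>B. card B \<le> 3 \<and> acts_on B h \<and> (\<exists>A\<in>location_classes. B \<subseteq> A))"
    proof cases
      case 1
      obtain B where B: "unitary g" "card B \<le> 3" "acts_on B g"
        using hs[OF 1(1)] by blast
      have "card (in_block b ` B :: qubit49 set) \<le> 3"
        by (rule le_trans[OF card_image_le[OF finite] B(2)])
      moreover have "(in_block b ` B :: qubit49 set) \<subseteq> range (in_block b)" "range (in_block b) \<in> location_classes"
        by (auto simp: location_classes_def)
      ultimately show ?thesis
        using embed_gate_unitary[OF inj_in_block B(1)] acts_on_embed[OF inj_in_block B(3)] 1(2) by blast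
    next
      case 2
      have "card {Inr i :: qubit49} \<le> 3" "{Inr i} \<in> location_classes"
        by (auto simp: location_classes_def)
      then show ?thesis
        using site_unitary[OF hadamard_unitary] acts_on_site 2 by blast
    qed
  next
    \<comment> \<open>On the code the physical operators \<open>X_on UNIV\<close> and
      \<open>Z_on UNIV\<close> act as logical X and Z, so their normalized sum acts as logical
      H.\<close>
    have "circuit hs ** W = cscale (1 / of_real (sqrt 2)) (W ** (pauli_X + pauli_Z))"
      unfolding circuit_hs cscale_mult_left matrix_add_rdistrib inner.logical_X inner.logical_Z matrix_add_ldistrib ..
    also have "\<dots> = W ** hadamard"
      unfolding hadamard_eq cscale_mult_right ..
    finally have HW: "circuit hs ** W = W ** hadamard" .
    define I where "I = (location_tensor (\<lambda>_. W) (\<lambda>_. mat 1) :: complex ^ (steane_qubit \<Rightarrow> bool) ^ (qubit49 \<Rightarrow> bool))"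
    have "circuit (block_gates @ bare_gates) ** I = circuit bare_gates ** (circuit block_gates ** I)"
      by (simp add: circuit_append matrix_mul_assoc)
    also have "\<dots> = location_tensor (\<lambda>_. W ** hadamard) (\<lambda>_. hadamard)"
      unfolding block_gates_def bare_gates_def I_def circuit_blocks_location_tensor[OF bs(2)]
        circuit_sites_location_tensor[OF ks(2)] bs(1) ks(1) by (simp add: HW)
    also have "\<dots> = I ** tensor (\<lambda>_. hadamard)"
      unfolding I_def location_tensor_mult_tensor by simp
    finally have "circuit (block_gates @ bare_gates) ** I = I ** tensor (\<lambda>_. hadamard)" .
    then have "circuit (block_gates @ bare_gates) ** (I ** V) = I ** (tensor (\<lambda>_. hadamard) ** V)"
      by (simp add: matrix_mul_assoc)
    also have "\<dots> = cscale z (I ** V ** hadamard)"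
      unfolding HV by (simp add: cscale_mult_right matrix_mul_assoc)
    finally show "circuit (block_gates @ bare_gates) ** encoding = cscale z (encoding ** hadamard)"
      unfolding I_def .
  qed
qed

end

theorem mainTheorem1:
  fixes c :: "steane_qubit \<Rightarrow> bit ^ 3"
    and V :: "complex ^ bool ^ (steane_qubit \<Rightarrow> bool)"
    and W :: "complex ^ bool ^ (rm_qubit \<Rightarrow> bool)"
  assumes "bij_betw c UNIV {v. v \<noteq> 0}"
    and "c (Inl Q1) + c (Inl Q2) + c (Inl Q7) = 0"
    and "encoding_isometry (steane_generators c) V"
    and "encoding_isometry rm_generators W"
  shows "universal_on TYPE('n::finite) {H_gate, S_gate, T_gate} {CNOT_gate} \<and>
    (\<exists>\<R> :: qubit49 oper \<Rightarrow> qubit49 oper. quantum_channel \<R> \<and>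
      (\<forall>p \<E>. quantum_channel \<E> \<longrightarrow> corrects (Q49_encoding V W) \<R> (on_qubit p \<E>)) \<and>
      fault_tolerant (Q49_encoding V W) \<R> H_gate \<and>
      fault_tolerant (Q49_encoding V W) \<R> S_gate \<and>
      fault_tolerant (Q49_encoding V W) \<R> T_gate \<and>
      fault_tolerant (Q49_encoding V W) \<R> CNOT_gate)"
proof -
  interpret Q49 c V W
    using assms by (rule Q49.intro)
  have "corrects encoding recovery (on_qubit p \<E>)" if "quantum_channel \<E>" for p \<E>
    by (rule correctable_corrects[OF encoding_isometry recovery_complete correctable_single _ that]) simp
  moreover have "cis (pi / 4) ^ 8 = 1"
    by (simp add: Complex.DeMoivre)
  moreover have "\<i> ^ 8 = 1"
    using power_mult[of \<i> 2 4] by simp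
  ultimately show ?thesis
    unfolding encoding_eq H_gate_eq S_gate_def T_gate_def using clifford_T_universal
      kraus_quantum_channel[OF recovery_complete] fault_tolerant_H_gate fault_tolerant_CNOT_gate
      fault_tolerant_phase_gate[of \<i>] fault_tolerant_phase_gate[of "cis (pi / 4)"]
    by (auto simp: H_gate_eq S_gate_def T_gate_def intro!: exI[of _ recovery])
qed

end
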